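(* Let $T>0$, let $\phi$ and $u_0$ satisfy assumptions (A.1)--(A.5) listed in the context, and for each $\Delta x>0$ let $u_{\Delta x}$ be the semi-discrete approximation defined in the context. Assume moreover that there is a constant $C$, independent of $\Delta x$, such that $$\bigl|\tau^{(i)}_{\Delta x}(\cdot,0)\bigr|_{BV(\mathbb{R})}\le C,\qquad i=1,\dots,n,$$ with $\tau^{(i)}_{\Delta x}$ as defined in the context. Then there exist a function $u\in L^\infty([0,T];L^1_{\mathrm{loc}}(\mathbb{R}))$ (with values in $\mathbb{R}^n$) and a subsequence $\{\Delta x_j\}$ of $\{\Delta x\}$ such that $u_{\Delta x_j}\to u$ in $L^1_{\mathrm{loc}}(\mathbb{R}\times(0,T))$ as $\Delta x_j\to 0$. The function $u$ is a weak solution of $$u_t+\bigl(u\,\phi(|u|)\bigr)_x=0 \ \text{ in } \mathbb{R}\times(0,T),\qquad u(x,0)=u_0(x).$$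
   Context: Here $u:\mathbb{R}\times[0,T)\to\mathbb{R}^n$, $|\cdot|$ and $(\cdot,\cdot)$ denote the Euclidean norm and inner product, and $u_0:\mathbb{R}\to\mathbb{R}^n$. $\{\Delta x\}$ denotes a sequence of positive numbers tending to $0$. Assumptions. $\phi:[0,\infty)\to[0,\infty)$ is twice differentiable, and "relevant $r$" means $r\in[0,\||u_0|\|_{L^\infty}]$: (A.1) $\phi(0)=0$, and $\phi(r)>0$ (for $r>0$) and $\phi'(r)\ge0$ for all relevant $r$. (A.2) $\phi(r),\phi'(r),\phi''(r)$ are bounded for all relevant $r$. (A.3) The set $\{r : 2\phi'(r)+r\phi''(r)=0\}$ has Lebesgue measure $0$. (A.4) $|u_0|\in L^1(\mathbb{R})\cap L^\infty(\mathbb{R})$, and for every $K\in\mathbb{R}$ there is a constant $C_K>0$ with $\inf_{x\in\mathcal{A}(|u_0|,K)}|u_0(x)|\ge C_K$, where $$\mathcal{A}(f,K)=\Bigl\{x\in(-\infty,K] : \exists\,\varepsilon>0 \text{ with } f(y)>\liminf_{z\to x}f(z)\text{ for a.e. } y\in(x-\varepsilon,x)\Bigr\}.$$ (A.5) $u_0$ takes values in the cone $\Gamma_\delta=\{u\in\mathbb{R}^n : \delta|u|\le(e,u)\}$, where $e=(1,\dots,1)/\sqrt n$ and $\delta\in(\sqrt{(n-1)/n},1)$ is fixed. Scheme. Put $x_j=j\Delta x$, $x_{j\pm1/2}=x_j\pm\Delta x/2$, $I_j=[x_{j-1/2},x_{j+1/2})$, $D_-a_j=(a_j-a_{j-1})/\Delta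 x$. Let $\{u_j(t)\}_{j\in\mathbb{Z}}$ solve $$u_j'(t)+D_-\bigl(\phi(r_j(t))u_j(t)\bigr)=0,\quad r_j(t)=|u_j(t)|,\quad t>0,\qquad u_j(0)=\frac1{\Delta x}\int_{I_j}u_0(x)\,dx,$$ as an ordinary differential equation in $L^2$, and set $u_{\Delta x}(x,t)=\sum_j u_j(t)\mathbf 1_{I_j}(x)$. Define the vectors $\tau_j=(\tau_j^{(1)},\dots,\tau_j^{(n)})$ by $\tau_j=u_j/(u_j,e)$ if $u_j\neq0$, and $\tau_j=\tau_{j+1}$ if $u_j=0$; set $\tau^{(i)}_{\Delta x}(x,t)=\sum_j\tau^{(i)}_j(t)\mathbf 1_{I_j}(x)$. For a lattice function, $|v_{\Delta x}|_{BV(\mathbb{R})}=\sum_j|v_j-v_{j-1}|$. Weak solution: $u\in L^\infty$ and for all $\psi\in C_0^\infty(\mathbb{R}\times[0,T))$, $$\int_0^T\!\!\int_{\mathbb{R}}\bigl(u\psi_t+u\phi(|u|)\psi_x\bigr)\,dx\,dt+\int_{\mathbb{R}}u_0(x)\psi(x,0)\,dx=0.$$ *)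

theory Defs
  imports "HOL-Analysis.Analysis" "HOL-Probability.Essential_Supremum"
begin

text \<open>Functions of space and time are curried as \<open>u x t\<close>, lattice functions with time as
  \<open>u t j\<close>. The space dimension \<open>n\<close> of the values is \<open>CARD('n)\<close>.\<close>

definition Linfty :: "'a measure \<Rightarrow> ('a \<Rightarrow> 'b::real_normed_vector) \<Rightarrow> bool" where
  "Linfty M f \<longleftrightarrow> f \<in> borel_measurable M \<and> esssup M (\<lambda>x. ereal (norm (f x))) < \<infinity>"

definition relevant :: "(real \<Rightarrow> 'a::real_normed_vector) \<Rightarrow> real set" where
  "relevant u0 = {r. 0 \<le> r \<and> ereal r \<le> esssup lebesgue (\<lambda>x. ereal (norm (u0 x)))}"

text \<open>The limit inferior is over the punctured neighbourhoods of \<open>x\<close> and extended-real valued.\<close>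

definition \<A> :: "(real \<Rightarrow> real) \<Rightarrow> real \<Rightarrow> real set" where
  "\<A> f K = {x. x \<le> K \<and> (\<exists>\<epsilon>>0. AE y in lebesgue. y \<in> {x - \<epsilon><..<x} \<longrightarrow>
      Liminf (at x) (\<lambda>z. ereal (f z)) < ereal (f y))}"

definition e_vec :: "real ^ 'n" where
  "e_vec = (1 / sqrt (real CARD('n))) *\<^sub>R (\<chi> i. 1)"

definition Gamma_cone :: "real \<Rightarrow> (real ^ 'n) set" where
  "Gamma_cone \<delta> = {u. \<delta> * norm u \<le> e_vec \<bullet> u}"

definition cell :: "real \<Rightarrow> int \<Rightarrow> real set" where
  "cell h j = {of_int j * h - h / 2 ..< of_int j * h + h / 2}"

definition D_minus :: "real \<Rightarrow> (int \<Rightarrow> 'a::real_vector) \<Rightarrow> int \<Rightarrow> 'a" where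
  "D_minus h a j = (a j - a (j - 1)) /\<^sub>R h"

definition step_fun :: "real \<Rightarrow> (int \<Rightarrow> 'a::real_normed_vector) \<Rightarrow> real \<Rightarrow> 'a" where
  "step_fun h v x = (\<Sum>\<^sub>\<infinity>j. indicator (cell h j) x *\<^sub>R v j)"

text \<open>The squared \<open>L\<^sup>2\<close> norm of \<open>step_fun h v\<close>. It and the variation below are \<open>ennreal\<close>-valued
  sums, so that a divergent series has the value \<open>\<infinity>\<close> and not the default value \<open>0\<close>.\<close>

definition L2_sq :: "real \<Rightarrow> (int \<Rightarrow> 'a::real_normed_vector) \<Rightarrow> ennreal" where
  "L2_sq h v = (\<Sum>\<^sub>\<infinity>j. ennreal (h * (norm (v j))\<^sup>2))"

definition lattice_BV :: "(int \<Rightarrow> real) \<Rightarrow> ennreal" where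
  "lattice_BV v = (\<Sum>\<^sub>\<infinity>j. ennreal \<bar>v j - v (j - 1)\<bar>)"

text \<open>The differential equation is one in \<open>L\<^sup>2\<close>: the solution is an \<open>L\<^sup>2\<close>-valued curve, continuous
  at \<open>0\<close>, whose difference quotients converge in \<open>L\<^sup>2\<close> for \<open>t > 0\<close>, and not merely a family of
  solutions of the component equations.\<close>

definition scheme_solution ::
    "(real \<Rightarrow> real) \<Rightarrow> (real \<Rightarrow> real ^ 'n) \<Rightarrow> real \<Rightarrow> (real \<Rightarrow> int \<Rightarrow> real ^ 'n) \<Rightarrow> bool" where
  "scheme_solution \<phi> u0 h u \<longleftrightarrow>
     (\<forall>t\<ge>0. L2_sq h (u t) < \<infinity>) \<and>
     ((\<lambda>t. L2_sq h (\<lambda>j. u t j - u 0 j)) \<longlongrightarrow> 0) (at_right 0) \<and>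
     (\<forall>t>0. ((\<lambda>s. L2_sq h (\<lambda>j. (u s j - u t j) /\<^sub>R (s - t)
                - (- D_minus h (\<lambda>i. \<phi> (norm (u t i)) *\<^sub>R u t i) j))) \<longlongrightarrow> 0) (at t)) \<and>
     (\<forall>j. u 0 j = (1 / h) *\<^sub>R (LINT x:cell h j|lebesgue. u0 x))"

text \<open>A relation and not a function: if \<open>v\<close> vanishes on \<open>{j..}\<close> for some \<open>j\<close>, the rule
  \<open>\<tau> j = \<tau> (j + 1)\<close> determines \<open>\<tau>\<close> there only up to one constant vector.\<close>

definition is_tau :: "(int \<Rightarrow> real ^ 'n) \<Rightarrow> (int \<Rightarrow> real ^ 'n) \<Rightarrow> bool" where
  "is_tau v \<tau> \<longleftrightarrow> (\<forall>j. \<tau> j = (if v j \<noteq> 0 then v j /\<^sub>R (v j \<bullet> e_vec) else \<tau> (j + 1)))"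

text \<open>The space \<open>C\<^sub>0\<^sup>\<infinity>(\<real> \<times> [0,T))\<close>: all mixed partial derivatives \<open>D i j\<close> (of order \<open>i\<close> in \<open>x\<close> and
  \<open>j\<close> in \<open>t\<close>, one-sided at \<open>t = 0\<close>) exist and are continuous up to \<open>t = 0\<close>, and the support is a
  compact subset of \<open>\<real> \<times> [0,T)\<close>, so \<open>\<psi>\<close> need not vanish at \<open>t = 0\<close>.\<close>

definition test_function :: "real \<Rightarrow> (real \<Rightarrow> real \<Rightarrow> real) \<Rightarrow> bool" where
  "test_function T \<psi> \<longleftrightarrow>
     (\<exists>D. D 0 0 = \<psi> \<and>
        (\<forall>i j. continuous_on (UNIV \<times> {0..<T}) (\<lambda>(x, t). D i j x t) \<and>
           (\<forall>x. \<forall>t\<in>{0..<T}.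
              ((\<lambda>y. D i j y t) has_real_derivative D (Suc i) j x t) (at x) \<and>
              ((\<lambda>s. D i j x s) has_real_derivative D i (Suc j) x t) (at t within {0..<T})))) \<and>
     (\<exists>K. compact K \<and> K \<subseteq> UNIV \<times> {0..<T} \<and>
        (\<forall>x. \<forall>t\<in>{0..<T}. (x, t) \<notin> K \<longrightarrow> \<psi> x t = 0))"

definition weak_solution ::
    "(real \<Rightarrow> real) \<Rightarrow> real \<Rightarrow> (real \<Rightarrow> real ^ 'n) \<Rightarrow> (real \<Rightarrow> real \<Rightarrow> real ^ 'n) \<Rightarrow> bool" where
  "weak_solution \<phi> T u0 u \<longleftrightarrow>
     Linfty (lebesgue_on (UNIV \<times> {0<..<T})) (\<lambda>(x, t). u x t) \<and>
     (\<forall>\<psi>. test_function T \<psi> \<longrightarrow>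
        (LINT t:{0<..<T}|lebesgue. LINT x|lebesgue.
           deriv (\<lambda>s. \<psi> x s) t *\<^sub>R u x t
           + (\<phi> (norm (u x t)) * deriv (\<lambda>y. \<psi> y t) x) *\<^sub>R u x t)
        + (LINT x|lebesgue. \<psi> x 0 *\<^sub>R u0 x) = 0)"

text \<open>Membership in \<open>L\<^sup>\<infinity>([0,T]; L\<^sup>1\<^sub>l\<^sub>o\<^sub>c(\<real>))\<close>, with one essential bound for each of the seminorms
  of \<open>L\<^sup>1\<^sub>l\<^sub>o\<^sub>c(\<real>)\<close>.\<close>

definition Linfty_L1loc :: "real \<Rightarrow> (real \<Rightarrow> real \<Rightarrow> real ^ 'n) \<Rightarrow> bool" where
  "Linfty_L1loc T u \<longleftrightarrow>
     (\<lambda>(x, t). u x t) \<in> borel_measurable (lebesgue_on (UNIV \<times> {0..T})) \<and>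
     (\<forall>K. compact K \<longrightarrow> (\<exists>M. AE t in lebesgue. t \<in> {0..T} \<longrightarrow>
        set_integrable lebesgue K (\<lambda>x. u x t) \<and> (LINT x:K|lebesgue. norm (u x t)) \<le> M))"

definition tendsto_L1loc ::
    "'a::euclidean_space set \<Rightarrow> (nat \<Rightarrow> 'a \<Rightarrow> 'b::euclidean_space) \<Rightarrow> ('a \<Rightarrow> 'b) \<Rightarrow> bool" where
  "tendsto_L1loc \<Omega> f g \<longleftrightarrow>
     (\<forall>K. compact K \<and> K \<subseteq> \<Omega> \<longrightarrow>
        (\<forall>k. set_integrable lebesgue K (f k)) \<and> set_integrable lebesgue K g \<and>
        (\<lambda>k. LINT p:K|lebesgue. norm (f k p - g p)) \<longlonglongrightarrow> 0)"

end

theory Submission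
  imports Defs "HOL-Complex_Analysis.Great_Picard" "HOL-Probability.Distributions"
begin

text \<open>
  Write \<open>v\<^sub>j = (e, u\<^sub>j)\<close>, \<open>r\<^sub>j = |u\<^sub>j|\<close> and \<open>\<tau>\<^sub>j = u\<^sub>j / v\<^sub>j\<close>. Maximum principles on the lattice keep the
  scheme in the cone and below \<open>M = ess sup |u\<^sub>0|\<close>. The direction \<open>\<tau>\<close> is transported with the mass \<open>v\<close>:
  in the continuous problem it is a fixed function of the cumulated mass. Since it has bounded
  variation initially, it is close in the mean to a Lipschitz function \<open>F\<close> of the cumulated mass.
  The energy \<open>\<Sum> h v\<^sub>j |\<tau>\<^sub>j - z\<^sub>j|\<^sup>2\<close>, with \<open>z\<^sub>j\<close> the mean of \<open>F\<close> over the mass of the cell \<open>j\<close>, grows only by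
  \<open>O(h)\<close>, and its dissipation controls the defect by which \<open>r\<close> fails to solve the upwind scheme of the
  scalar law \<open>r\<^sub>t + (r \<phi>(r))\<^sub>x = 0\<close>. The \<open>L\<^sup>1\<close> contraction of that scheme then bounds the translations of
  \<open>r\<close>, and together with the energy those of \<open>u\<close>, in \<open>L\<^sup>1\<close> uniformly in \<open>h\<close> and \<open>t\<close>. This gives compactness.
\<close>

subsection \<open>Differential inequalities on the lattice\<close>

text \<open>The defect by which \<open>r\<close> fails to solve the scalar scheme is quadratic in
  the jumps of the direction. An energy measured from a constant direction would bound the sum of
  the defects over space and time but not make it small, and a merely bounded defect is useless for
  estimating small translations. This is why the comparison is with a profile on a scale \<epsilon>:
  a direction of variation \<open>V\<close> leaves an initial energy of at most
  \<open>V^2 * \<epsilon>\<close>, while a profile with Lipschitz constant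
  \<open>V / \<epsilon>\<close> is transported with an error of order
  \<open>h / \<epsilon>^2\<close> in the energy. Letting \<open>h\<close> tend to 0 at fixed
  \<epsilon>, and then \<epsilon> to 0, removes both. The second difficulty is vacuum, where
  \<open>u / v\<close> is meaningless. Transport goes to the right only, so a cell that is empty at
  one positive time is empty at all times, together with all cells on its left; every other cell has
  \<open>v > 0\<close> for all \<open>t > 0\<close>. The energy is therefore differentiable at
  positive times, and only its continuity at time 0 needs care, in cells that are empty
  initially.\<close>

lemma growth_le:
  fixes f :: "real \<Rightarrow> real"
  assumes "0 \<le> t" "continuous_on {0..t} f"
    and "\<And>s. 0 < s \<Longrightarrow> s < t \<Longrightarrow> \<exists>D. (f has_real_derivative D) (at s) \<and> D \<le> c"
  shows "f t \<le> f 0 + c * t"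
proof -
  have "f t - c * t \<le> f 0 - c * 0"
  proof (rule DERIV_nonpos_imp_decreasing_open[OF assms(1), of "\<lambda>s. f s - c * s"])
    show "continuous_on {0..t} (\<lambda>s. f s - c * s)"
      by (intro continuous_intros assms)
    fix s assume "0 < s" "s < t"
    then obtain D where D: "(f has_real_derivative D) (at s)" "D \<le> c" using assms(3) by blast
    have "((\<lambda>s. f s - c * s) has_real_derivative D - c) (at s)"
      by (auto intro!: derivative_eq_intros D(1))
    then show "\<exists>y. ((\<lambda>s. f s - c * s) has_real_derivative y) (at s) \<and> y \<le> 0"
      using D(2) by (intro exI[of _ "D - c"]) auto
  qed
  then show ?thesis by simp
qed

text \<open>The uniform tail reduces a supremum over the infinite lattice to a maximum over finitely
  many sites, so a positive value forces a maximum of the damped function at some site and time. The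
  derivative hypothesis concerns only positive spatial maxima, because there the neighbours can be
  compared with the maximal value.\<close>

lemma lattice_maximum_principle:
  fixes X :: "real \<Rightarrow> int \<Rightarrow> real"
  assumes cont: "\<And>j. continuous_on {0..T} (\<lambda>t. X t j)"
    and tail: "\<And>\<epsilon>. 0 < \<epsilon> \<Longrightarrow> \<exists>N. \<forall>t\<in>{0..T}. \<forall>j. N \<le> \<bar>j\<bar> \<longrightarrow> X t j < \<epsilon>"
    and init: "\<And>j. X 0 j \<le> 0"
    and deriv: "\<And>t j. 0 < t \<Longrightarrow> t \<le> T \<Longrightarrow> 0 < X t j \<Longrightarrow> (\<And>i. X t i \<le> X t j) \<Longrightarrow>
        \<exists>D. ((\<lambda>s. X s j) has_real_derivative D) (at t) \<and> D \<le> C * X t j"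
    and t: "0 \<le> t" "t \<le> T"
  shows "X t j \<le> 0"
proof (rule ccontr)
  assume "\<not> X t j \<le> 0"
  then have pos: "0 < X t j" by simp
  \<comment> \<open>\<open>K\<close> exceeds \<open>C\<close>, which makes the derivative of the
    damped function strictly negative at its maximum, and it is positive, which keeps the damping
    factor at most 1.\<close>
  define K where "K = \<bar>C\<bar> + 1"
  define Y where "Y s i = exp (- K * s) * X s i" for s i
  have K: "0 < K" by (simp add: K_def)
  have Ypos: "0 < Y t j" using pos by (simp add: Y_def)
  have Ycont: "continuous_on {0..T} (\<lambda>s. Y s i)" for i
    unfolding Y_def by (intro continuous_intros cont)
  obtain N where N: "\<And>s i. s \<in> {0..T} \<Longrightarrow> N \<le> \<bar>i\<bar> \<Longrightarrow> X s i < Y t j"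
    using tail[OF Ypos] by blast
  have Ysmall: "Y s i \<le> Y t j" if "s \<in> {0..T}" "N \<le> \<bar>i\<bar>" for s i
  proof (cases "X s i \<le> 0")
    case True
    then have "Y s i \<le> 0" by (simp add: Y_def mult_nonneg_nonpos)
    then show ?thesis using Ypos by linarith
  next
    case False
    have "exp (- K * s) \<le> 1" using K that by simp
    then have "Y s i \<le> 1 * X s i" unfolding Y_def using False by (intro mult_right_mono) auto
    then show ?thesis using N[OF that] by simp
  qed
  have "\<exists>s\<in>{0..T}. \<forall>s'\<in>{0..T}. Y s' i \<le> Y s i" for i
    using continuous_attains_sup[OF compact_Icc _ Ycont[of i]] t by auto
  then obtain s where s: "\<And>i. s i \<in> {0..T}" "\<And>i s'. s' \<in> {0..T} \<Longrightarrow> Y s' i \<le> Y (s i) i"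
    by metis
  define I where "I = insert j {- \<bar>N\<bar>..\<bar>N\<bar>}"
  have I: "finite I" "j \<in> I" by (auto simp: I_def)
  define m where "m = Max ((\<lambda>i. Y (s i) i) ` I)"
  have "m \<in> (\<lambda>i. Y (s i) i) ` I" unfolding m_def using I by (intro Max_in) auto
  then obtain k where k: "k \<in> I" "m = Y (s k) k" by auto
  have mge: "Y (s i) i \<le> m" if "i \<in> I" for i
    unfolding m_def using I that by (intro Max_ge) auto
  have mt: "Y t j \<le> m" using mge[OF I(2)] s(2)[of t j] t by force
  have kmax: "Y s' i \<le> Y (s k) k" if "s' \<in> {0..T}" for s' i
  proof (cases "i \<in> I")
    case True
    then show ?thesis using mge[OF True] s(2)[OF that, of i] k by linarith
  next
    case False
    then have "N \<le> \<bar>i\<bar>" by (auto simp: I_def)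
    then show ?thesis using Ysmall[OF that] mt k by force
  qed
  have Xk: "0 < X (s k) k"
  proof -
    have "0 < exp (- K * s k) * X (s k) k" using mt k Ypos unfolding Y_def by linarith
    then show ?thesis by (simp add: zero_less_mult_iff)
  qed
  have sk: "0 < s k" "s k \<le> T"
    using s(1)[of k] init[of k] Xk by (auto simp: le_less)
  have "X (s k) i \<le> X (s k) k" for i
    using kmax[OF s(1)[of k], of i] by (simp add: Y_def)
  then obtain D where D: "((\<lambda>s. X s k) has_real_derivative D) (at (s k))" "D \<le> C * X (s k) k"
    using deriv[OF sk Xk] by blast
  have "((\<lambda>s. Y s k) has_real_derivative exp (- K * s k) * (D - K * X (s k) k)) (at (s k))"
    unfolding Y_def by (rule derivative_eq_intros D(1) refl | simp add: algebra_simps)+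
  moreover have "D < K * X (s k) k"
  proof -
    have "C * X (s k) k \<le> \<bar>C\<bar> * X (s k) k" using Xk by (intro mult_right_mono) auto
    also have "\<dots> < K * X (s k) k" using Xk by (simp add: K_def)
    finally show ?thesis using D(2) by linarith
  qed
  then have "exp (- K * s k) * (D - K * X (s k) k) < 0"
    by (simp add: mult_less_0_iff)
  \<comment> \<open>The maximum may lie at the final time \<open>T\<close>, so the contradiction is
    drawn from earlier times, which exist because \<open>s k > 0\<close>.\<close>
  ultimately obtain d where d: "0 < d" "\<And>x. 0 < x \<Longrightarrow> x < d \<Longrightarrow> Y (s k) k < Y (s k - x) k"
    using DERIV_neg_dec_left by blast
  define x where "x = min (d / 2) (s k)"
  have "0 < x" "x < d" "x \<le> s k" using d sk by (auto simp: x_def)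
  then have "Y (s k) k < Y (s k - x) k" "s k - x \<in> {0..T}" using d sk by auto
  then show False using kmax[of "s k - x" k] by linarith
qed

lemma sum_int_telescope:
  fixes f :: "int \<Rightarrow> 'a::ab_group_add"
  assumes "a \<le> b + 1"
  shows "(\<Sum>i\<in>{a..b}. f i - f (i - 1)) = f b - f (a - 1)"
proof -
  have "(\<Sum>i\<in>{a..a + int n - 1}. f i - f (i - 1)) = f (a + int n - 1) - f (a - 1)" for n
  proof (induction n)
    case (Suc n)
    have "{a..a + int (Suc n) - 1} = insert (a + int n) {a..a + int n - 1}" by auto
    then show ?case using Suc by (simp add: algebra_simps)
  qed simp
  from this[of "nat (b + 1 - a)"] show ?thesis using assms by simp
qed

lemma has_real_derivative_norm:
  fixes f :: "real \<Rightarrow> 'a::real_inner"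
  assumes "(f has_vector_derivative D) (at t)" "f t \<noteq> 0"
  shows "((\<lambda>s. norm (f s)) has_real_derivative (f t \<bullet> D) / norm (f t)) (at t)"
proof -
  have 1: "((\<lambda>s. f s \<bullet> f s) has_real_derivative 2 * (f t \<bullet> D)) (at t)"
    using has_derivative_inner[OF assms(1)[unfolded has_vector_derivative_def] assms(1)[unfolded has_vector_derivative_def]]
    unfolding has_field_derivative_def
    by (rule has_derivative_eq_rhs) (auto simp: inner_commute algebra_simps fun_eq_iff)
  have "((\<lambda>s. sqrt (f s \<bullet> f s)) has_real_derivative inverse (sqrt (f t \<bullet> f t)) / 2 * (2 * (f t \<bullet> D))) (at t)"
    using assms(2) by (intro DERIV_chain2[OF DERIV_real_sqrt 1]) simp
  then show ?thesis by (simp add: norm_eq_sqrt_inner field_simps)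
qed

subsection \<open>The semi-discrete scheme\<close>

lemma sum_le_L2_sq:
  assumes "0 < h" "finite A"
  shows "ennreal (\<Sum>j\<in>A. h * (norm (v j))\<^sup>2) \<le> L2_sq h v"
proof -
  have "ennreal (\<Sum>j\<in>A. h * (norm (v j))\<^sup>2) = (\<Sum>j\<in>A. ennreal (h * (norm (v j))\<^sup>2))"
    using assms by (intro sum_ennreal[symmetric]) auto
  also have "\<dots> \<le> L2_sq h v"
    unfolding L2_sq_def using assms
    by (subst nonneg_infsum_complete) (auto intro!: SUP_upper)
  finally show ?thesis .
qed

lemma norm_less_of_L2_sq:
  assumes "0 < h" "L2_sq h v < ennreal (h * \<epsilon>\<^sup>2)" "0 \<le> \<epsilon>"
  shows "norm (v j) < \<epsilon>"
proof -
  have "ennreal (h * (norm (v j))\<^sup>2) \<le> L2_sq h v"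
    using sum_le_L2_sq[OF assms(1), of "{j}" v] by simp
  then have "ennreal (h * (norm (v j))\<^sup>2) < ennreal (h * \<epsilon>\<^sup>2)" using assms(2) by (rule le_less_trans)
  then have "(norm (v j))\<^sup>2 < \<epsilon>\<^sup>2" using assms(1) by (simp add: ennreal_less_iff)
  then show ?thesis using assms(3) by (rule power_less_imp_less_base)
qed

text \<open>Every site with \<open>norm (v j) \<ge> \<epsilon>\<close> contributes at least
  \<open>h * \<epsilon>\<^sup>2\<close> to a finite sum, so there are only finitely many of
  them.\<close>

lemma L2_sq_tail:
  assumes h: "0 < h" and fin: "L2_sq h v < \<infinity>" and \<epsilon>: "0 < \<epsilon>"
  shows "\<exists>N. \<forall>j. N \<le> \<bar>j\<bar> \<longrightarrow> norm (v j) < \<epsilon>"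
proof -
  define S where "S = {j. \<epsilon> \<le> norm (v j)}"
  obtain c where c: "L2_sq h v = ennreal c" "0 \<le> c"
    using fin by (cases "L2_sq h v") auto
  have bd: "real (card A) * (h * \<epsilon>\<^sup>2) \<le> c" if "finite A" "A \<subseteq> S" for A
  proof -
    have "real (card A) * (h * \<epsilon>\<^sup>2) = (\<Sum>j\<in>A. h * \<epsilon>\<^sup>2)" by simp
    also have "\<dots> \<le> (\<Sum>j\<in>A. h * (norm (v j))\<^sup>2)"
      using that h \<epsilon> by (intro sum_mono mult_left_mono power_mono) (auto simp: S_def)
    finally have "real (card A) * (h * \<epsilon>\<^sup>2) \<le> (\<Sum>j\<in>A. h * (norm (v j))\<^sup>2)" .
    moreover have "(\<Sum>j\<in>A. h * (norm (v j))\<^sup>2) \<le> c"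
      using sum_le_L2_sq[OF h that(1), of v] c by simp
    ultimately show ?thesis by linarith
  qed
  have "finite S"
  proof (rule ccontr)
    assume "infinite S"
    obtain n where n: "c < real n * (h * \<epsilon>\<^sup>2)"
      using reals_Archimedean3[of "h * \<epsilon>\<^sup>2"] h \<epsilon> by auto
    obtain A where "A \<subseteq> S" "finite A" "card A = n"
      using infinite_arbitrarily_large[OF \<open>infinite S\<close>] by blast
    then show False using bd[of A] n by simp
  qed
  then have "bdd_above (abs ` S)" by simp
  then obtain N where N: "\<And>j. j \<in> S \<Longrightarrow> \<bar>j\<bar> \<le> N" unfolding bdd_above_def by blast
  have "norm (v j) < \<epsilon>" if "N + 1 \<le> \<bar>j\<bar>" for j
  proof (rule ccontr)
    assume "\<not> norm (v j) < \<epsilon>"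
    then have "\<bar>j\<bar> \<le> N" by (intro N) (simp add: S_def)
    then show False using that by simp
  qed
  then show ?thesis by blast
qed

text \<open>What the later arguments need of the equation in L2: it holds at every site, and the
  solution decays at infinity uniformly on compact time intervals. The last property supplies the
  tail hypothesis of the maximum principle.\<close>

locale lattice_ode =
  fixes \<phi> :: "real \<Rightarrow> real" and h :: real and u :: "real \<Rightarrow> int \<Rightarrow> 'a::real_inner"
  assumes h_pos: "0 < h"
    and phi_nonneg: "\<And>r. 0 \<le> r \<Longrightarrow> 0 \<le> \<phi> r"
    and phi_cont: "continuous_on {0..} \<phi>"
    and u_cont: "\<And>j. continuous_on {0..} (\<lambda>t. u t j)"
    and u_deriv: "\<And>t j. 0 < t \<Longrightarrow> ((\<lambda>s. u s j) has_vector_derivative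
        - D_minus h (\<lambda>i. \<phi> (norm (u t i)) *\<^sub>R u t i) j) (at t)"
    and u_tail: "\<And>T \<epsilon>. 0 < \<epsilon> \<Longrightarrow> \<exists>N. \<forall>t\<in>{0..T}. \<forall>j. N \<le> \<bar>j\<bar> \<longrightarrow> norm (u t j) < \<epsilon>"

text \<open>At a fixed mesh size the L2 norm dominates the supremum norm, so the difference
  quotients converge uniformly in \<open>j\<close>. Hence the curve is continuous uniformly in
  \<open>j\<close>, and compactness of \<open>[0, T]\<close> carries the tails at single times over
  to all times.\<close>

lemma lattice_ode_of_scheme_solution:
  fixes u :: "real \<Rightarrow> int \<Rightarrow> real ^ 'n"
  assumes h: "0 < h" and sol: "scheme_solution \<phi> u0 h u"
    and phi_nonneg: "\<And>r. 0 \<le> r \<Longrightarrow> 0 \<le> \<phi> r" and phi_cont: "continuous_on {0..} \<phi>"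
  shows "lattice_ode \<phi> h u"
proof -
  define F where "F t j = - D_minus h (\<lambda>i. \<phi> (norm (u t i)) *\<^sub>R u t i) j" for t j
  have fin: "L2_sq h (u t) < \<infinity>" if "0 \<le> t" for t
    using sol that by (auto simp: scheme_solution_def)
  have lim0: "((\<lambda>t. L2_sq h (\<lambda>j. u t j - u 0 j)) \<longlongrightarrow> 0) (at_right 0)"
    using sol by (auto simp: scheme_solution_def)
  have lim: "((\<lambda>s. L2_sq h (\<lambda>j. (u s j - u t j) /\<^sub>R (s - t) - F t j)) \<longlongrightarrow> 0) (at t)" if "0 < t" for t
    using sol that by (auto simp: scheme_solution_def F_def)
  have quot: "\<forall>\<^sub>F s in at t. \<forall>j. norm ((u s j - u t j) /\<^sub>R (s - t) - F t j) < \<epsilon>"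
    if "0 < t" "0 < \<epsilon>" for t \<epsilon>
  proof -
    have "\<forall>\<^sub>F s in at t. L2_sq h (\<lambda>j. (u s j - u t j) /\<^sub>R (s - t) - F t j) < ennreal (h * \<epsilon>\<^sup>2)"
      using h that by (intro order_tendstoD(2)[OF lim]) (auto simp: ennreal_zero_less_mult_iff)
    then show ?thesis
      by eventually_elim (use norm_less_of_L2_sq[OF h] that in force)
  qed
  have pbound: "\<exists>B\<ge>0. \<forall>j. norm (u t j) \<le> B" if t: "0 \<le> t" for t
  proof -
    obtain N where N: "\<And>j. N \<le> \<bar>j\<bar> \<Longrightarrow> norm (u t j) < 1"
      using L2_sq_tail[OF h fin[OF t], of 1] by auto
    have "norm (u t j) \<le> 1 + (\<Sum>i\<in>{-N..N}. norm (u t i))" for j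
    proof (cases "N \<le> \<bar>j\<bar>")
      case True
      then show ?thesis using N[OF True] sum_nonneg[of "{-N..N}" "\<lambda>i. norm (u t i)"] by simp
    next
      case False
      then have "norm (u t j) \<le> (\<Sum>i\<in>{-N..N}. norm (u t i))" by (intro member_le_sum) auto
      then show ?thesis by linarith
    qed
    moreover have "0 \<le> 1 + (\<Sum>i\<in>{-N..N}. norm (u t i))" by (intro add_nonneg_nonneg sum_nonneg) auto
    ultimately show ?thesis by blast
  qed
  have Fbound: "\<exists>B\<ge>0. \<forall>j. norm (F t j) \<le> B" if t: "0 \<le> t" for t
  proof -
    obtain B where B: "0 \<le> B" "\<And>j. norm (u t j) \<le> B" using pbound[OF t] by blast
    have "compact (\<phi> ` {0..B})"
      by (rule compact_continuous_image[OF continuous_on_subset[OF phi_cont]]) auto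
    then have "bounded (\<phi> ` {0..B})" by (rule compact_imp_bounded)
    then obtain P where "\<forall>y\<in>\<phi> ` {0..B}. norm y \<le> P" unfolding bounded_iff by blast
    then have P: "\<And>r. 0 \<le> r \<Longrightarrow> r \<le> B \<Longrightarrow> norm (\<phi> r) \<le> P" by simp
    have P0: "0 \<le> P" using P[of 0] B(1) norm_ge_zero[of "\<phi> 0"] by linarith
    have fl: "norm (\<phi> (norm (u t i)) *\<^sub>R u t i) \<le> P * B" for i
      unfolding norm_scaleR using P[of "norm (u t i)"] B(2)[of i] P0 by (intro mult_mono) simp_all
    have "norm (F t j) \<le> (P * B + P * B) / h" for j
    proof -
      have "norm (\<phi> (norm (u t j)) *\<^sub>R u t j - \<phi> (norm (u t (j - 1))) *\<^sub>R u t (j - 1)) \<le> P * B + P * B"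
        using fl[of j] fl[of "j - 1"] by (intro norm_triangle_le_diff add_mono)
      from divide_right_mono[OF this, of h] show ?thesis
        unfolding F_def D_minus_def using h by (simp add: divide_inverse mult.commute)
    qed
    moreover have "0 \<le> (P * B + P * B) / h" using P0 B(1) h by simp
    ultimately show ?thesis by blast
  qed
  have unif: "\<exists>d>0. \<forall>s\<ge>0. \<bar>s - t\<bar> < d \<longrightarrow> (\<forall>j. norm (u s j - u t j) < \<epsilon>)" if t: "0 \<le> t" and \<epsilon>: "0 < \<epsilon>" for t \<epsilon>
  proof (cases "t = 0")
    case True
    have "\<forall>\<^sub>F s in at_right 0. L2_sq h (\<lambda>j. u s j - u 0 j) < ennreal (h * \<epsilon>\<^sup>2)"
      using h \<epsilon> by (intro order_tendstoD(2)[OF lim0]) (auto simp: ennreal_zero_less_mult_iff)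
    then have "\<exists>d>0. \<forall>s>0. s < d \<longrightarrow> L2_sq h (\<lambda>j. u s j - u 0 j) < ennreal (h * \<epsilon>\<^sup>2)"
      by (simp only: eventually_at_right_field)
    then obtain d where d: "0 < d" "\<And>s. 0 < s \<Longrightarrow> s < d \<Longrightarrow> L2_sq h (\<lambda>j. u s j - u 0 j) < ennreal (h * \<epsilon>\<^sup>2)"
      by (elim exE conjE) simp
    have "norm (u s j - u 0 j) < \<epsilon>" if s: "0 \<le> s" "s < d" for s j
    proof (cases "s = 0")
      case False
      then show ?thesis using s \<epsilon> by (intro norm_less_of_L2_sq[OF h d(2)]) simp_all
    qed (simp add: \<epsilon>)
    then have "\<forall>s\<ge>0. \<bar>s - t\<bar> < d \<longrightarrow> (\<forall>j. norm (u s j - u t j) < \<epsilon>)" using True by simp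
    then show ?thesis using d(1) by blast
  next
    case False
    then have t': "0 < t" using t by simp
    obtain B where B: "0 \<le> B" "\<And>j. norm (F t j) \<le> B" using Fbound[OF t] by blast
    \<comment> \<open>The right-hand side at time \<open>t\<close> is bounded by \<open>B\<close> on
      the whole lattice, so quotients within distance 1 of it give the Lipschitz bound
      \<open>(1 + B) * |s - t|\<close> near \<open>t\<close> for all sites at once.\<close>
    have "\<exists>d>0. \<forall>s. s \<noteq> t \<and> dist s t < d \<longrightarrow> (\<forall>j. norm ((u s j - u t j) /\<^sub>R (s - t) - F t j) < 1)"
      using quot[OF t', of 1] by (simp add: eventually_at)
    then obtain d where d: "0 < d" "\<And>s j. s \<noteq> t \<Longrightarrow> dist s t < d \<Longrightarrow> norm ((u s j - u t j) /\<^sub>R (s - t) - F t j) < 1"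
      by (elim exE conjE) simp
    define d' where "d' = min d (\<epsilon> / (B + 1))"
    have d': "0 < d'" using d(1) \<epsilon> B(1) by (simp add: d'_def)
    have "norm (u s j - u t j) < \<epsilon>" if "\<bar>s - t\<bar> < d'" for s j
    proof (cases "s = t")
      case True
      then show ?thesis using \<epsilon> by simp
    next
      case False
      have "norm ((u s j - u t j) /\<^sub>R (s - t)) \<le> norm ((u s j - u t j) /\<^sub>R (s - t) - F t j) + norm (F t j)"
        using norm_triangle_sub by (metis add.commute)
      also have "\<dots> \<le> 1 + B"
        using d(2)[OF False, of j] that B(2)[of j] by (intro add_mono) (simp_all add: dist_real_def d'_def)
      finally have "norm (u s j - u t j) / \<bar>s - t\<bar> \<le> 1 + B" by (simp add: divide_inverse mult.commute)
      then have "norm (u s j - u t j) \<le> (1 + B) * \<bar>s - t\<bar>" using False by (simp add: field_simps)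
      also have "\<dots> < (1 + B) * (\<epsilon> / (B + 1))"
        using that B(1) by (intro mult_strict_left_mono) (simp_all add: d'_def)
      also have "\<dots> = \<epsilon>" using B(1) by (simp add: field_simps)
      finally show ?thesis .
    qed
    then show ?thesis using d' by blast
  qed
  show ?thesis
  proof
    show "0 < h" by fact
    show "0 \<le> \<phi> r" if "0 \<le> r" for r by (rule phi_nonneg[OF that])
    show "continuous_on {0..} \<phi>" by fact
    show "continuous_on {0..} (\<lambda>t. u t j)" for j
      unfolding continuous_on_iff
    proof (intro ballI allI impI)
      fix t :: real and \<epsilon> :: real assume "t \<in> {0..}" "0 < \<epsilon>"
      then show "\<exists>d>0. \<forall>x'\<in>{0..}. dist x' t < d \<longrightarrow> dist (u x' j) (u t j) < \<epsilon>"
        using unif[of t \<epsilon>] unfolding dist_norm real_norm_def atLeast_iff by blast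
    qed
    show "((\<lambda>s. u s j) has_vector_derivative - D_minus h (\<lambda>i. \<phi> (norm (u t i)) *\<^sub>R u t i) j) (at t)"
      if t: "0 < t" for t j
    proof -
      have "((\<lambda>s. (u s j - u t j) /\<^sub>R (s - t)) \<longlongrightarrow> F t j) (at t)"
      proof (rule tendstoI)
        fix \<epsilon> :: real assume "0 < \<epsilon>"
        from quot[OF t this] show "\<forall>\<^sub>F s in at t. dist ((u s j - u t j) /\<^sub>R (s - t)) (F t j) < \<epsilon>"
          by eventually_elim (simp add: dist_norm)
      qed
      then have "((\<lambda>s. norm ((u s j - u t j) /\<^sub>R (s - t) - F t j)) \<longlongrightarrow> 0) (at t)"
        by (intro tendsto_norm_zero LIM_zero)
      moreover have "\<forall>\<^sub>F s in at t. norm ((u s j - u t j) /\<^sub>R (s - t) - F t j)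
            = norm (u s j - u t j - (s - t) *\<^sub>R F t j) / norm (s - t)"
        unfolding eventually_at_filter
      proof (intro always_eventually allI impI)
        fix s assume "s \<noteq> t"
        then have "(u s j - u t j) /\<^sub>R (s - t) - F t j = (u s j - u t j - (s - t) *\<^sub>R F t j) /\<^sub>R (s - t)"
          by (simp add: scaleR_diff_right)
        then show "norm ((u s j - u t j) /\<^sub>R (s - t) - F t j) = norm (u s j - u t j - (s - t) *\<^sub>R F t j) / norm (s - t)"
          by (simp add: divide_inverse mult.commute)
      qed
      ultimately have "((\<lambda>s. norm (u s j - u t j - (s - t) *\<^sub>R F t j) / norm (s - t)) \<longlongrightarrow> 0) (at t)"
        by (rule Lim_transform_eventually)
      then show ?thesis
        unfolding has_vector_derivative_def has_derivative_iff_norm F_def[symmetric]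
        by (auto intro: bounded_linear_scaleR_left)
    qed
    show "\<exists>N. \<forall>t\<in>{0..T}. \<forall>j. N \<le> \<bar>j\<bar> \<longrightarrow> norm (u t j) < \<epsilon>" if \<epsilon>: "0 < \<epsilon>" for T \<epsilon>
    proof -
      have "\<exists>d>0. \<forall>s\<ge>0. \<bar>s - t\<bar> < d \<longrightarrow> (\<forall>j. norm (u s j - u t j) < \<epsilon> / 2)" if "0 \<le> t" for t
        by (rule unif[OF that]) (use \<epsilon> in simp)
      then obtain d where d: "\<And>t. 0 \<le> t \<Longrightarrow> 0 < d t"
        "\<And>t s j. 0 \<le> t \<Longrightarrow> 0 \<le> s \<Longrightarrow> \<bar>s - t\<bar> < d t \<Longrightarrow> norm (u s j - u t j) < \<epsilon> / 2" by metis
      have "\<exists>N. \<forall>j. N \<le> \<bar>j\<bar> \<longrightarrow> norm (u t j) < \<epsilon> / 2" if "0 \<le> t" for t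
        by (rule L2_sq_tail[OF h fin[OF that]]) (use \<epsilon> in simp)
      then obtain n where n: "\<And>t j. 0 \<le> t \<Longrightarrow> n t \<le> \<bar>j\<bar> \<Longrightarrow> norm (u t j) < \<epsilon> / 2" by metis
      have "{0..T} \<subseteq> (\<Union>t\<in>{0..T}. ball t (d t))"
        using d(1) by force
      then obtain A where A: "A \<subseteq> {0..T}" "finite A" "{0..T} \<subseteq> (\<Union>t\<in>A. ball t (d t))"
        by (rule compactE_image[OF compact_Icc, rotated]) auto
      define N where "N = (\<Sum>t\<in>A. \<bar>n t\<bar>)"
      have "norm (u s j) < \<epsilon>" if s: "s \<in> {0..T}" and j: "N \<le> \<bar>j\<bar>" for s j
      proof -
        obtain t where t: "t \<in> A" "s \<in> ball t (d t)" using A s by blast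
        have "\<bar>n t\<bar> \<le> N" unfolding N_def using t A by (intro member_le_sum) auto
        then have 1: "norm (u t j) < \<epsilon> / 2" using n[of t j] t A j by auto
        have 2: "norm (u s j - u t j) < \<epsilon> / 2"
          using d(2)[of t s j] t A s by (auto simp: dist_real_def abs_minus_commute)
        show ?thesis using 1 2 norm_triangle_sub[of "u s j" "u t j"] by linarith
      qed
      then show ?thesis by blast
    qed
  qed
qed

section \<open>A priori bound and invariant half-spaces\<close>

context lattice_ode
begin

lemma u_bounded: "\<exists>B>0. \<forall>t\<in>{0..T}. \<forall>j. norm (u t j) \<le> B"
proof -
  obtain N where N: "\<And>t j. t \<in> {0..T} \<Longrightarrow> N \<le> \<bar>j\<bar> \<Longrightarrow> norm (u t j) < 1"
    using u_tail[of 1 T] by (meson zero_less_one)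
  have "\<exists>b. \<forall>t\<in>{0..T}. norm (u t j) \<le> b" for j
  proof -
    have "continuous_on {0..T} (\<lambda>t. u t j)" by (rule continuous_on_subset[OF u_cont]) auto
    then have "bounded ((\<lambda>t. u t j) ` {0..T})"
      by (intro compact_imp_bounded compact_continuous_image) auto
    then show ?thesis unfolding bounded_iff by simp
  qed
  then obtain b where b: "\<And>t j. t \<in> {0..T} \<Longrightarrow> norm (u t j) \<le> b j" by metis
  have "norm (u t j) \<le> 1 + (\<Sum>i\<in>{-N..N}. \<bar>b i\<bar>)" if t: "t \<in> {0..T}" for t j
  proof (cases "N \<le> \<bar>j\<bar>")
    case True
    have "0 \<le> (\<Sum>i\<in>{-N..N}. \<bar>b i\<bar>)" by (rule sum_nonneg) simp
    then show ?thesis using N[OF t True] by linarith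
  next
    case False
    then have "\<bar>b j\<bar> \<le> (\<Sum>i\<in>{-N..N}. \<bar>b i\<bar>)" by (intro member_le_sum) auto
    then show ?thesis using b[OF t, of j] by linarith
  qed
  moreover have "0 < 1 + (\<Sum>i\<in>{-N..N}. \<bar>b i\<bar>)"
    by (intro add_pos_nonneg sum_nonneg) auto
  ultimately show ?thesis by blast
qed

lemma norm_u_cont: "continuous_on {0..T} (\<lambda>t. norm (u t j))"
  by (intro continuous_on_norm continuous_on_subset[OF u_cont]) auto

lemma inner_u_deriv:
  assumes "0 < t"
  shows "((\<lambda>s. w \<bullet> u s j) has_real_derivative
    - (\<phi> (norm (u t j)) * (w \<bullet> u t j) - \<phi> (norm (u t (j - 1))) * (w \<bullet> u t (j - 1))) / h) (at t)"
proof -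
  have "((\<lambda>s. w \<bullet> u s j) has_vector_derivative
     w \<bullet> (- D_minus h (\<lambda>i. \<phi> (norm (u t i)) *\<^sub>R u t i) j)) (at t)"
    by (rule bounded_linear.has_vector_derivative[OF bounded_linear_inner_right u_deriv[OF assms]])
  then show ?thesis
    unfolding has_real_derivative_iff_has_vector_derivative D_minus_def
    by (simp add: inner_diff_right divide_inverse algebra_simps)
qed

lemma norm_u_deriv:
  assumes "0 < t" "u t j \<noteq> 0"
  shows "((\<lambda>s. norm (u s j)) has_real_derivative
    - (norm (u t j) * \<phi> (norm (u t j)) - \<phi> (norm (u t (j - 1))) * (u t j \<bullet> u t (j - 1)) / norm (u t j)) / h) (at t)"
proof -
  have "(u t j \<bullet> (- D_minus h (\<lambda>i. \<phi> (norm (u t i)) *\<^sub>R u t i) j)) / norm (u t j) =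
    - (norm (u t j) * \<phi> (norm (u t j)) - \<phi> (norm (u t (j - 1))) * (u t j \<bullet> u t (j - 1)) / norm (u t j)) / h"
    using assms(2) h_pos unfolding D_minus_def
    by (simp add: inner_diff_right dot_square_norm field_simps power2_eq_square)
  then show ?thesis using has_real_derivative_norm[OF u_deriv[OF assms(1)] assms(2)] by simp
qed

text \<open>At a site where the norm is maximal, Cauchy-Schwarz bounds the inflow by
  \<open>q * \<phi> q\<close>, where \<open>q \<le> r\<close> is the norm at the left neighbour.
  Monotonicity of \<open>\<phi>\<close> is available only up to \<open>M\<close>; above
  \<open>M\<close> inflow and outflow are compared by the Lipschitz bound of
  \<open>r * \<phi> r\<close>, which costs a multiple of the excess \<open>r - M\<close>, as the
  maximum principle permits.\<close>

lemma norm_le_of_initial: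
  assumes M: "0 \<le> M"
    and lip: "\<And>B. \<exists>L\<ge>0. \<forall>r\<in>{0..B}. \<forall>s\<in>{0..B}. \<bar>r * \<phi> r - s * \<phi> s\<bar> \<le> L * \<bar>r - s\<bar>"
    and mono: "\<And>r s. 0 \<le> r \<Longrightarrow> r \<le> s \<Longrightarrow> s \<le> M \<Longrightarrow> \<phi> r \<le> \<phi> s"
    and init: "\<And>j. norm (u 0 j) \<le> M"
    and t: "0 \<le> t"
  shows "norm (u t j) \<le> M"
proof -
  obtain B where B: "\<And>s i. s \<in> {0..t} \<Longrightarrow> norm (u s i) \<le> B" using u_bounded[of t] by blast
  obtain L where L: "0 \<le> L" "\<And>r s. 0 \<le> r \<Longrightarrow> r \<le> max B M \<Longrightarrow> 0 \<le> s \<Longrightarrow> s \<le> max B M \<Longrightarrow>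
      \<bar>r * \<phi> r - s * \<phi> s\<bar> \<le> L * \<bar>r - s\<bar>"
    using lip[of "max B M"] by force
  have "norm (u t j) - M \<le> 0"
  proof (rule lattice_maximum_principle[where T = t and C = "L / h" and X = "\<lambda>s i. norm (u s i) - M"])
    show "continuous_on {0..t} (\<lambda>s. norm (u s i) - M)" for i
      by (intro continuous_intros norm_u_cont)
    show "\<exists>N. \<forall>s\<in>{0..t}. \<forall>i. N \<le> \<bar>i\<bar> \<longrightarrow> norm (u s i) - M < \<epsilon>" if \<epsilon>: "0 < \<epsilon>" for \<epsilon>
    proof -
      obtain N where "\<forall>s\<in>{0..t}. \<forall>i. N \<le> \<bar>i\<bar> \<longrightarrow> norm (u s i) < \<epsilon>" using u_tail[OF \<epsilon>] by blast
      then show ?thesis using M by (intro exI[of _ N]) force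
    qed
    show "norm (u 0 i) - M \<le> 0" for i using init[of i] by simp
    fix s i assume s: "0 < s" "s \<le> t" and pos: "0 < norm (u s i) - M"
      and top: "\<And>k. norm (u s k) - M \<le> norm (u s i) - M"
    define r where "r = norm (u s i)"
    define q where "q = norm (u s (i - 1))"
    have rM: "M < r" and qr: "q \<le> r" using pos top[of "i - 1"] by (auto simp: r_def q_def)
    have rB: "r \<le> max B M" "q \<le> max B M" "0 \<le> r" "0 \<le> q"
      using B[of s i] B[of s "i - 1"] s by (auto simp: r_def q_def)
    have nz: "u s i \<noteq> 0" using rM M by (auto simp: r_def)
    have "u s i \<bullet> u s (i - 1) \<le> r * q" unfolding r_def q_def by (rule norm_cauchy_schwarz)
    then have "\<phi> q * (u s i \<bullet> u s (i - 1)) \<le> \<phi> q * (r * q)"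
      using phi_nonneg[of q] rB by (intro mult_left_mono) auto
    then have 1: "\<phi> q * (u s i \<bullet> u s (i - 1)) / r \<le> q * \<phi> q"
      using rM M by (simp add: field_simps)
    have 2: "q * \<phi> q - r * \<phi> r \<le> L * (r - M)"
    proof (cases "M \<le> q")
      case True
      have "q * \<phi> q - r * \<phi> r \<le> L * \<bar>q - r\<bar>" using L(2)[of q r] rB by linarith
      also have "\<dots> \<le> L * (r - M)" using True qr L(1) by (intro mult_left_mono) auto
      finally show ?thesis .
    next
      case False
      have "q * \<phi> q \<le> M * \<phi> M"
        using False mono[of q M] rB phi_nonneg[of q] M by (intro mult_mono) auto
      moreover have "M * \<phi> M - r * \<phi> r \<le> L * \<bar>M - r\<bar>" using L(2)[of M r] rB M by linarith
      ultimately show ?thesis using rM by simp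
    qed
    have "- (r * \<phi> r - \<phi> q * (u s i \<bullet> u s (i - 1)) / r) \<le> L * (r - M)"
      using 1 2 by linarith
    from divide_right_mono[OF this, of h]
    have "- (r * \<phi> r - \<phi> q * (u s i \<bullet> u s (i - 1)) / r) / h \<le> L / h * (r - M)"
      using h_pos by simp
    then show "\<exists>D. ((\<lambda>s. norm (u s i) - M) has_real_derivative D) (at s) \<and> D \<le> L / h * (norm (u s i) - M)"
      using DERIV_diff[OF norm_u_deriv[OF s(1) nz] DERIV_const[of M]]
      unfolding r_def q_def by auto
  qed (use t in auto)
  then show ?thesis by simp
qed

text \<open>The flux is a nonnegative multiple of \<open>u\<close> and is taken from the left. Where
  the inner product with \<open>w\<close> is most negative, the outflow raises it, and the inflow
  lowers it at a rate of at most \<open>P / h\<close> times its size.\<close>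

lemma inner_nonneg_of_initial:
  assumes init: "\<And>j. 0 \<le> w \<bullet> u 0 j" and t: "0 \<le> t"
  shows "0 \<le> w \<bullet> u t j"
proof -
  obtain B where B: "0 < B" "\<And>s i. s \<in> {0..t} \<Longrightarrow> norm (u s i) \<le> B" using u_bounded[of t] by blast
  have "compact (\<phi> ` {0..B})"
    by (rule compact_continuous_image[OF continuous_on_subset[OF phi_cont]]) auto
  then have "bounded (\<phi> ` {0..B})" by (rule compact_imp_bounded)
  then obtain P where "\<forall>y\<in>\<phi> ` {0..B}. norm y \<le> P" unfolding bounded_iff by blast
  then have P: "\<And>r. 0 \<le> r \<Longrightarrow> r \<le> B \<Longrightarrow> \<phi> r \<le> P" by (auto simp: abs_le_iff)
  have "- (w \<bullet> u t j) \<le> 0"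
  proof (rule lattice_maximum_principle[where T = t and C = "P / h" and X = "\<lambda>s i. - (w \<bullet> u s i)"])
    show "continuous_on {0..t} (\<lambda>s. - (w \<bullet> u s i))" for i
      by (intro continuous_intros continuous_on_subset[OF u_cont]) auto
    show "\<exists>N. \<forall>s\<in>{0..t}. \<forall>i. N \<le> \<bar>i\<bar> \<longrightarrow> - (w \<bullet> u s i) < \<epsilon>" if \<epsilon>: "0 < \<epsilon>" for \<epsilon>
    proof -
      obtain N where N: "\<forall>s\<in>{0..t}. \<forall>i. N \<le> \<bar>i\<bar> \<longrightarrow> norm (u s i) < \<epsilon> / (norm w + 1)"
        using u_tail[of "\<epsilon> / (norm w + 1)" t] \<epsilon> by (auto simp: add_nonneg_pos)
      have "- (w \<bullet> u s i) < \<epsilon>" if "s \<in> {0..t}" "N \<le> \<bar>i\<bar>" for s i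
      proof -
        have "- (w \<bullet> u s i) \<le> norm w * norm (u s i)"
          using Cauchy_Schwarz_ineq2[of w "u s i"] by linarith
        also have "\<dots> \<le> (norm w + 1) * norm (u s i)" by (intro mult_right_mono) auto
        also have "\<dots> < (norm w + 1) * (\<epsilon> / (norm w + 1))"
          using N that by (intro mult_strict_left_mono) (auto simp: add_nonneg_pos)
        also have "\<dots> = \<epsilon>" using norm_ge_zero[of w] by (simp add: add_nonneg_eq_0_iff)
        finally show ?thesis .
      qed
      then show ?thesis by blast
    qed
    show "- (w \<bullet> u 0 i) \<le> 0" for i using init[of i] by simp
    fix s i assume s: "0 < s" "s \<le> t" and pos: "0 < - (w \<bullet> u s i)"
      and top: "\<And>k. - (w \<bullet> u s k) \<le> - (w \<bullet> u s i)"
    let ?p = "\<phi> (norm (u s i))" and ?q = "\<phi> (norm (u s (i - 1)))"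
    have pq: "0 \<le> ?p" "0 \<le> ?q" "?q \<le> P" using P B s phi_nonneg by auto
    have "?p * (w \<bullet> u s i) \<le> 0" using pq pos by (intro mult_nonneg_nonpos) auto
    moreover have "?q * (- (w \<bullet> u s (i - 1))) \<le> P * (- (w \<bullet> u s i))"
    proof (cases "- (w \<bullet> u s (i - 1)) \<le> 0")
      case True
      have "?q * (- (w \<bullet> u s (i - 1))) \<le> 0" using pq True by (intro mult_nonneg_nonpos) auto
      also have "0 \<le> P * (- (w \<bullet> u s i))" using pq pos by (intro mult_nonneg_nonneg) auto
      finally show ?thesis .
    next
      case False
      then show ?thesis using pq pos top[of "i - 1"] by (intro mult_mono) auto
    qed
    ultimately have "?p * (w \<bullet> u s i) - ?q * (w \<bullet> u s (i - 1)) \<le> P * (- (w \<bullet> u s i))" by simp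
    then have "- (- (?p * (w \<bullet> u s i) - ?q * (w \<bullet> u s (i - 1))) / h) \<le> P / h * (- (w \<bullet> u s i))"
      using h_pos by (simp add: field_simps)
    then show "\<exists>D. ((\<lambda>s. - (w \<bullet> u s i)) has_real_derivative D) (at s) \<and> D \<le> P / h * (- (w \<bullet> u s i))"
      using DERIV_minus[OF inner_u_deriv[OF s(1), of w i]] by blast
  qed (use t in auto)
  then show ?thesis by simp
qed

text \<open>The cone is the intersection of the half-spaces with normals
  \<open>e - \<delta> *\<^sub>R s\<close>, \<open>s\<close> in the unit ball, and each of them is
  invariant. For given \<open>t\<close> and \<open>j\<close> the one with
  \<open>s = sgn (u t j)\<close>, kept fixed in time, gives the claim.\<close>

lemma cone_of_initial:
  assumes init: "\<And>j. \<delta> * norm (u 0 j) \<le> e \<bullet> u 0 j" and "0 \<le> \<delta>" "0 \<le> t"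
  shows "\<delta> * norm (u t j) \<le> e \<bullet> u t j"
proof -
  define w where "w = e - \<delta> *\<^sub>R sgn (u t j)"
  have "0 \<le> w \<bullet> u 0 i" for i
  proof -
    have "sgn (u t j) \<bullet> u 0 i \<le> norm (sgn (u t j)) * norm (u 0 i)" by (rule norm_cauchy_schwarz)
    also have "\<dots> \<le> 1 * norm (u 0 i)" by (intro mult_right_mono) (auto simp: norm_sgn)
    finally have "\<delta> * (sgn (u t j) \<bullet> u 0 i) \<le> \<delta> * norm (u 0 i)" using assms(2) by (intro mult_left_mono) auto
    then show ?thesis using init[of i] unfolding w_def by (simp add: inner_diff_left)
  qed
  then have "0 \<le> w \<bullet> u t j" by (rule inner_nonneg_of_initial) fact
  moreover have "sgn (u t j) \<bullet> u t j = norm (u t j)"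
    by (cases "u t j = 0") (auto simp: sgn_div_norm dot_square_norm power2_eq_square)
  ultimately show ?thesis by (simp add: w_def inner_diff_left)
qed

end

section \<open>Density, vacuum and total mass in the cone\<close>

locale cone_scheme = lattice_ode \<phi> h u for \<phi> h and u :: "real \<Rightarrow> int \<Rightarrow> 'a::real_inner" +
  fixes M \<delta> L m :: real and e :: 'a
  assumes M_nonneg: "0 \<le> M" and delta_pos: "0 < \<delta>" and norm_e: "norm e = 1"
    and L_nonneg: "0 \<le> L"
    and norm_le: "\<And>t j. 0 \<le> t \<Longrightarrow> norm (u t j) \<le> M"
    and cone: "\<And>t j. 0 \<le> t \<Longrightarrow> \<delta> * norm (u t j) \<le> e \<bullet> u t j"
    and phi_pos: "\<And>r. 0 < r \<Longrightarrow> r \<le> M \<Longrightarrow> 0 < \<phi> r"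
    and phi_mono: "\<And>r s. 0 \<le> r \<Longrightarrow> r \<le> s \<Longrightarrow> s \<le> M \<Longrightarrow> \<phi> r \<le> \<phi> s"
    and flux_lipschitz: "\<And>r s. r \<in> {0..M} \<Longrightarrow> s \<in> {0..M} \<Longrightarrow> \<bar>r * \<phi> r - s * \<phi> s\<bar> \<le> L * \<bar>r - s\<bar>"
    and mass_initial: "\<And>a b. (\<Sum>i\<in>{a..b}. h * (e \<bullet> u 0 i)) \<le> m"
begin

text \<open>\<open>v\<close> is the density of the transported mass and \<open>a\<close> its flux;
  \<open>g\<close> is the flux of the scalar law for \<open>r\<close>.\<close>

definition v :: "real \<Rightarrow> int \<Rightarrow> real" where "v t j = e \<bullet> u t j"
definition r :: "real \<Rightarrow> int \<Rightarrow> real" where "r t j = norm (u t j)"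
definition a :: "real \<Rightarrow> int \<Rightarrow> real" where "a t j = \<phi> (r t j) * v t j"
definition g :: "real \<Rightarrow> int \<Rightarrow> real" where "g t j = r t j * \<phi> (r t j)"

lemma r_nonneg: "0 \<le> r t j" by (simp add: r_def)

lemma r_le: "0 \<le> t \<Longrightarrow> r t j \<le> M" by (simp add: r_def norm_le)

lemma v_ge: "0 \<le> t \<Longrightarrow> \<delta> * r t j \<le> v t j" using cone[of t j] by (simp add: r_def v_def)

lemma v_nonneg: "0 \<le> t \<Longrightarrow> 0 \<le> v t j"
  using v_ge[of t j] delta_pos r_nonneg[of t j] by (smt (verit) mult_nonneg_nonneg)

lemma v_le_r: "v t j \<le> r t j"
  using norm_cauchy_schwarz[of e "u t j"] by (simp add: v_def r_def norm_e)

lemma v_le: "0 \<le> t \<Longrightarrow> v t j \<le> M" using v_le_r[of t j] r_le[of t j] by simp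

lemma phi_le: "0 \<le> t \<Longrightarrow> \<phi> (r t j) \<le> \<phi> M" by (intro phi_mono r_nonneg r_le) auto

lemma phi_r_nonneg: "0 \<le> \<phi> (r t j)" by (intro phi_nonneg r_nonneg)

lemma a_nonneg: "0 \<le> t \<Longrightarrow> 0 \<le> a t j" by (simp add: a_def v_nonneg phi_r_nonneg)

lemma a_le: "0 \<le> t \<Longrightarrow> a t j \<le> \<phi> M * v t j"
  unfolding a_def by (intro mult_right_mono phi_le v_nonneg) auto

lemma u_eq_0_iff: "0 \<le> t \<Longrightarrow> u t j = 0 \<longleftrightarrow> v t j = 0"
  using v_ge[of t j] v_le_r[of t j] v_nonneg[of t j] delta_pos
  by (auto simp: r_def v_def mult_le_0_iff)

lemma a_eq_0_iff:
  assumes "0 \<le> t"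
  shows "a t j = 0 \<longleftrightarrow> v t j = 0"
proof -
  have "0 < \<phi> (r t j)" if "v t j \<noteq> 0"
    using that u_eq_0_iff[OF assms, of j] r_le[OF assms, of j] by (intro phi_pos) (auto simp: r_def)
  then show ?thesis by (cases "v t j = 0") (auto simp: a_def)
qed

lemma v_cont: "continuous_on {0..} (\<lambda>t. v t j)"
  unfolding v_def by (intro continuous_intros u_cont)

lemma r_cont: "continuous_on {0..} (\<lambda>t. r t j)"
  unfolding r_def by (intro continuous_intros u_cont)

lemma phi_r_cont: "continuous_on {0..} (\<lambda>t. \<phi> (r t j))"
  by (rule continuous_on_compose2[OF phi_cont r_cont]) (auto simp: r_nonneg)

lemma a_cont: "continuous_on {0..} (\<lambda>t. a t j)"
  unfolding a_def by (intro continuous_intros phi_r_cont v_cont)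

lemma v_deriv: "0 < t \<Longrightarrow> ((\<lambda>s. v s j) has_real_derivative - (a t j - a t (j - 1)) / h) (at t)"
  unfolding v_def a_def r_def by (rule inner_u_deriv)

lemma v_tail:
  assumes "0 < \<epsilon>"
  obtains N where "\<And>t j. t \<in> {0..T} \<Longrightarrow> N \<le> \<bar>j\<bar> \<Longrightarrow> v t j < \<epsilon>"
proof -
  obtain N where N: "\<forall>t\<in>{0..T}. \<forall>j. N \<le> \<bar>j\<bar> \<longrightarrow> norm (u t j) < \<epsilon>" using u_tail[OF assms] by blast
  have "v t j < \<epsilon>" if "t \<in> {0..T}" "N \<le> \<bar>j\<bar>" for t j
    using N that v_le_r[of t j] unfolding r_def by (meson le_less_trans)
  then show thesis by (rule that)
qed

text \<open>The outflow is at most \<open>\<phi> M * v\<close> and the inflow is nonnegative, so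
  \<open>exp (K * t) * v\<close> is nondecreasing in time: a cell once occupied never
  empties.\<close>

lemma v_vanishing_backward:
  assumes t: "0 < t" and v0: "v t j = 0" and s: "0 \<le> s" "s \<le> t"
  shows "v s j = 0"
proof -
  define K where "K = \<phi> M / h"
  have "exp (K * s) * v s j \<le> exp (K * t) * v t j"
  proof (rule DERIV_nonneg_imp_increasing_open[OF s(2), of "\<lambda>s. exp (K * s) * v s j"])
    fix x assume x: "s < x" "x < t"
    have x0: "0 < x" using x s by simp
    have "a x j - a x (j - 1) \<le> \<phi> M * v x j" using a_le[of x j] a_nonneg[of x "j - 1"] x0 by auto
    then have "0 \<le> (K * v x j + - (a x j - a x (j - 1)) / h)"
      using h_pos unfolding K_def by (simp add: field_simps)
    then have "0 \<le> exp (K * x) * (K * v x j + - (a x j - a x (j - 1)) / h)" by (intro mult_nonneg_nonneg) auto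
    moreover have "((\<lambda>s. exp (K * s) * v s j) has_real_derivative exp (K * x) * (K * v x j + - (a x j - a x (j - 1)) / h)) (at x)"
      by (rule derivative_eq_intros v_deriv[OF x0] refl | simp add: algebra_simps)+
    ultimately show "\<exists>y. ((\<lambda>s. exp (K * s) * v s j) has_real_derivative y) (at x) \<and> 0 \<le> y" by blast
  next
    show "continuous_on {s..t} (\<lambda>s. exp (K * s) * v s j)"
      using s by (intro continuous_intros continuous_on_subset[OF v_cont]) auto
  qed
  then have "v s j \<le> 0" using v0 by (simp add: mult_le_0_iff)
  then show ?thesis using v_nonneg[OF s(1), of j] by simp
qed

text \<open>While cell \<open>j\<close> stays empty its derivative is 0, so nothing flows in, and
  positivity of \<open>\<phi>\<close> makes the left neighbour empty too. The time
  \<open>t / 2\<close> is interior to the interval of vanishing, as the two-sided derivative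
  requires.\<close>

lemma v_vanishing_left:
  assumes t: "0 < t" and v0: "v t j = 0"
  shows "v (t / 2) (j - 1) = 0"
proof -
  have z: "v s j = 0" if "0 \<le> s" "s \<le> t" for s by (rule v_vanishing_backward[OF t v0 that])
  have t2: "0 < t / 2" using t by simp
  have "((\<lambda>s. 0) has_real_derivative - (a (t / 2) j - a (t / 2) (j - 1)) / h) (at (t / 2))"
    by (rule has_field_derivative_transform_within_open[OF v_deriv[OF t2, of j], of "{0<..<t}"])
      (use t z in auto)
  then have "- (a (t / 2) j - a (t / 2) (j - 1)) / h = 0" by (rule DERIV_unique) simp
  moreover have "a (t / 2) j = 0" using z[of "t / 2"] t by (simp add: a_def)
  ultimately have "a (t / 2) (j - 1) = 0" using h_pos by simp
  then show ?thesis using a_eq_0_iff[of "t / 2" "j - 1"] t by simp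
qed

text \<open>Vacuum at one positive time spreads to all cells on the left and back to the initial
  time; without inflow these cells then stay empty. So at positive times a cell is either always
  occupied or always empty, which justifies dividing by \<open>v\<close> in the energy.\<close>

lemma v_vanishing:
  assumes t: "0 < t" and v0: "v t j = 0" and "i \<le> j" and s: "0 \<le> s"
  shows "v s i = 0"
proof -
  \<comment> \<open>Each step to the left halves the time, which thus stays positive for every
    \<open>n\<close>.\<close>
  have "\<exists>t'>0. v t' (j - int n) = 0" for n
  proof (induction n)
    case (Suc n)
    then obtain t' where "t' > 0" "v t' (j - int n) = 0" by blast
    from v_vanishing_left[OF this] \<open>t' > 0\<close> show ?case
      by (intro exI[of _ "t' / 2"]) (simp add: algebra_simps)
  qed (use t v0 in auto)
  then have init: "v 0 (j - int n) = 0" for n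
    using v_vanishing_backward[of _ "j - int n" 0] by fastforce
  have initle: "v 0 k = 0" if "k \<le> j" for k using init[of "nat (j - k)"] that by simp
  \<comment> \<open>Because of the upwinding the half-line \<open>{..j}\<close> evolves
    independently of the cells on its right, so the maximum principle applies to \<open>v\<close>
    cut off there.\<close>
  have "(if i \<le> j then v s i else 0) \<le> 0"
  proof (rule lattice_maximum_principle[where T = s and C = "\<phi> M / h" and X = "\<lambda>s i. if i \<le> j then v s i else 0"])
    show "continuous_on {0..s} (\<lambda>t. if k \<le> j then v t k else 0)" for k
      by (cases "k \<le> j") (auto intro!: continuous_on_subset[OF v_cont])
    show "\<exists>N. \<forall>t\<in>{0..s}. \<forall>k. N \<le> \<bar>k\<bar> \<longrightarrow> (if k \<le> j then v t k else 0) < \<epsilon>" if \<epsilon>: "0 < \<epsilon>" for \<epsilon>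
    proof -
      obtain N where N: "\<And>t k. t \<in> {0..s} \<Longrightarrow> N \<le> \<bar>k\<bar> \<Longrightarrow> v t k < \<epsilon>" using v_tail[OF \<epsilon>] by blast
      then show ?thesis using \<epsilon> by (intro exI[of _ N]) auto
    qed
    show "(if k \<le> j then v 0 k else 0) \<le> 0" for k using initle[of k] by simp
    fix t k assume tk: "0 < t" "t \<le> s" "0 < (if k \<le> j then v t k else 0)"
      and top: "\<And>l. (if l \<le> j then v t l else 0) \<le> (if k \<le> j then v t k else 0)"
    have kj: "k \<le> j" using tk by (auto split: if_splits)
    have "a t (k - 1) \<le> \<phi> M * v t (k - 1)" using a_le tk by simp
    also have "\<dots> \<le> \<phi> M * v t k"
      using top[of "k - 1"] kj phi_nonneg[OF M_nonneg] by (intro mult_left_mono) auto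
    finally have "- (a t k - a t (k - 1)) \<le> \<phi> M * v t k" using a_nonneg[of t k] tk by simp
    from divide_right_mono[OF this, of h]
    have "- (a t k - a t (k - 1)) / h \<le> \<phi> M / h * v t k" using h_pos by simp
    then show "\<exists>D. ((\<lambda>s. if k \<le> j then v s k else 0) has_real_derivative D) (at t) \<and>
        D \<le> \<phi> M / h * (if k \<le> j then v t k else 0)"
      using v_deriv[OF tk(1), of k] kj by auto
  qed (use s in auto)
  then show ?thesis using v_nonneg[OF s, of i] \<open>i \<le> j\<close> by simp
qed

text \<open>Mass leaves a window through its right end, which only helps, and enters through its
  left end, which is moved so far out that the inflow up to time \<open>t\<close> is at most
  \<open>\<eta>\<close>.\<close>

lemma mass_le:
  assumes t: "0 \<le> t"
  shows "(\<Sum>i\<in>{k..l}. h * v t i) \<le> m"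
proof (rule field_le_epsilon)
  fix \<eta> :: real assume "0 < \<eta>"
  define \<eta>' where "\<eta>' = \<eta> / (1 + t)"
  have \<eta>': "0 < \<eta>'" "\<eta>' * t \<le> \<eta>" using \<open>0 < \<eta>\<close> t by (auto simp: \<eta>'_def field_simps)
  define c where "c = \<phi> M + 1"
  have c: "0 < c" using phi_nonneg[OF M_nonneg] by (simp add: c_def)
  obtain N where N: "\<And>s i. s \<in> {0..t} \<Longrightarrow> N \<le> \<bar>i\<bar> \<Longrightarrow> v s i < \<eta>' / c"
    using v_tail[of "\<eta>' / c" t] \<eta>' c by (metis divide_pos_pos)
  define k' where "k' = min (min k l) (- \<bar>N\<bar>)"
  have small: "a s (k' - 1) \<le> \<eta>'" if "0 < s" "s < t" for s
  proof -
    have "a s (k' - 1) \<le> \<phi> M * v s (k' - 1)" using a_le that by simp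
    also have "\<dots> \<le> c * (\<eta>' / c)"
    proof (intro mult_mono)
      have "N \<le> \<bar>k' - 1\<bar>" by (auto simp: k'_def)
      then show "v s (k' - 1) \<le> \<eta>' / c" using N[of s "k' - 1"] that by simp
    qed (use that v_nonneg[of s "k' - 1"] c in \<open>auto simp: c_def\<close>)
    finally show ?thesis using c by simp
  qed
  have "(\<Sum>i\<in>{k'..l}. h * v t i) \<le> (\<Sum>i\<in>{k'..l}. h * v 0 i) + \<eta>' * t"
  proof (rule growth_le[OF t, of "\<lambda>t. \<Sum>i\<in>{k'..l}. h * v t i"])
    show "continuous_on {0..t} (\<lambda>t. \<Sum>i\<in>{k'..l}. h * v t i)"
      by (intro continuous_intros continuous_on_subset[OF v_cont]) auto
    fix s assume s: "0 < s" "s < t"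
    have "((\<lambda>t. \<Sum>i\<in>{k'..l}. h * v t i) has_real_derivative (\<Sum>i\<in>{k'..l}. h * (- (a s i - a s (i - 1)) / h))) (at s)"
      by (intro DERIV_sum DERIV_cmult v_deriv s)
    moreover have "(\<Sum>i\<in>{k'..l}. h * (- (a s i - a s (i - 1)) / h)) = - (\<Sum>i\<in>{k'..l}. a s i - a s (i - 1))"
      using h_pos by (simp add: sum_negf[symmetric])
    moreover have "\<dots> = - (a s l - a s (k' - 1))"
      by (subst sum_int_telescope) (auto simp: k'_def)
    ultimately show "\<exists>D. ((\<lambda>t. \<Sum>i\<in>{k'..l}. h * v t i) has_real_derivative D) (at s) \<and> D \<le> \<eta>'"
      using small[OF s] a_nonneg[of s l] s by (intro exI[of _ "- (a s l - a s (k' - 1))"]) auto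
  qed
  moreover have "(\<Sum>i\<in>{k..l}. h * v t i) \<le> (\<Sum>i\<in>{k'..l}. h * v t i)"
    using h_pos v_nonneg[OF t] by (intro sum_mono2) (auto simp: k'_def)
  ultimately show "(\<Sum>i\<in>{k..l}. h * v t i) \<le> m + \<eta>"
    using mass_initial[of k' l] \<eta>' by (simp add: v_def)
qed

end

section \<open>Cumulated mass, and inequalities for increments and directions\<close>

definition lattice_sum :: "(int \<Rightarrow> 'a::ab_group_add) \<Rightarrow> int \<Rightarrow> 'a" where
  "lattice_sum b j = sum b {1..j} - sum b {j<..0}"

lemma lattice_sum_0 [simp]: "lattice_sum b 0 = 0"
  by (simp add: lattice_sum_def)

lemma lattice_sum_step: "lattice_sum b j - lattice_sum b (j - 1) = b j"
proof (cases "1 \<le> j")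
  case True
  then have "{1..j} = insert j {1..j - 1}" "{j<..0} = {}" "{j - 1<..0} = {}" by auto
  then show ?thesis by (simp add: lattice_sum_def)
next
  case False
  then have "{j - 1<..0} = insert j {j<..0}" "{1..j} = {}" "{1..j - 1} = {}" by auto
  then show ?thesis by (simp add: lattice_sum_def)
qed

lemma lattice_sum_telescope: "lattice_sum (\<lambda>i. f i - f (i - 1)) j = f j - f 0"
proof (induction j rule: int_induct[where k = 0])
  case (step1 i)
  have "lattice_sum (\<lambda>i. f i - f (i - 1)) (i + 1) = f (i + 1) - f i + lattice_sum (\<lambda>i. f i - f (i - 1)) i"
    using lattice_sum_step[of "\<lambda>i. f i - f (i - 1)" "i + 1"] by (simp add: diff_eq_eq)
  then show ?case using step1 by simp
next
  case (step2 i)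
  have "lattice_sum (\<lambda>i. f i - f (i - 1)) i - (f i - f (i - 1)) = lattice_sum (\<lambda>i. f i - f (i - 1)) (i - 1)"
    using lattice_sum_step[of "\<lambda>i. f i - f (i - 1)" i] by (simp add: diff_eq_eq add.commute)
  then show ?case using step2 by simp
qed simp

text \<open>The mean value inequality for \<open>G s - s *\<^sub>R F c\<close>, whose derivative has
  norm at most \<open>\<Lambda> * (y - x)\<close> on the interval.\<close>

lemma increment_linearization:
  fixes G F :: "real \<Rightarrow> 'a::real_normed_vector"
  assumes G: "\<And>x. (G has_vector_derivative F x) (at x)"
    and F: "\<And>x y. norm (F x - F y) \<le> \<Lambda> * \<bar>x - y\<bar>" and "0 \<le> \<Lambda>"
    and xy: "x \<le> y" and c: "c \<in> {x..y}"
  shows "norm (G y - G x - (y - x) *\<^sub>R F c) \<le> \<Lambda> * (y - x) * (y - x)"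
proof -
  have "norm ((G y - y *\<^sub>R F c) - (G x - x *\<^sub>R F c)) \<le> \<Lambda> * (y - x) * norm (y - x)"
  proof (rule differentiable_bound[where S = "{x..y}" and f' = "\<lambda>s k. k *\<^sub>R (F s - F c)"])
    fix s assume s: "s \<in> {x..y}"
    have "((\<lambda>s. G s - s *\<^sub>R F c) has_vector_derivative F s - F c) (at s)"
      by (auto intro!: derivative_eq_intros G)
    then show "((\<lambda>s. G s - s *\<^sub>R F c) has_derivative (\<lambda>k. k *\<^sub>R (F s - F c))) (at s within {x..y})"
      unfolding has_vector_derivative_def by (rule has_derivative_at_withinI)
    have "norm (F s - F c) \<le> \<Lambda> * (y - x)"
      using F[of s c] s c \<open>0 \<le> \<Lambda>\<close> by (smt (verit) atLeastAtMost_iff mult_left_mono)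
    then show "onorm (\<lambda>k. k *\<^sub>R (F s - F c)) \<le> \<Lambda> * (y - x)"
      by (intro onorm_le) (simp add: mult.commute mult_left_mono)
  qed (use xy in auto)
  then show ?thesis using xy by (simp add: algebra_simps)
qed

lemma norm_diff_square: "(norm (x - y))\<^sup>2 = (norm x)\<^sup>2 + (norm y)\<^sup>2 - 2 * (x \<bullet> y)" for x y :: "'a::real_inner"
  unfolding power2_norm_eq_inner by (simp add: inner_diff_left inner_diff_right inner_commute)

text \<open>With \<open>p = |x| * |y| \<ge> 1\<close> the square of the left side is
  \<open>2 * (p - (x, y)) / p\<close>, and \<open>2 * (p - (x, y))\<close> equals
  \<open>|x - y|^2 - (|x| - |y|)^2\<close>.\<close>

lemma sgn_diff_le:
  fixes x y :: "'a::real_inner"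
  assumes "1 \<le> norm x" "1 \<le> norm y"
  shows "norm (sgn x - sgn y) \<le> norm (x - y)"
proof -
  define p where "p = norm x * norm y"
  have nz: "x \<noteq> 0" "y \<noteq> 0" using assms by auto
  have p: "1 \<le> p" using mult_mono[of 1 "norm x" 1 "norm y"] assms by (simp add: p_def)
  have cs: "x \<bullet> y \<le> p" unfolding p_def by (rule norm_cauchy_schwarz)
  have "(norm (sgn x - sgn y))\<^sup>2 = 2 * (1 - (x \<bullet> y) / p)"
    using nz unfolding norm_diff_square by (simp add: norm_sgn sgn_div_norm p_def divide_inverse)
  also have "\<dots> \<le> p * (2 * (1 - (x \<bullet> y) / p))"
    using mult_right_mono[OF p, of "2 * (1 - (x \<bullet> y) / p)"] cs p by (simp add: field_simps)
  also have "\<dots> = 2 * (p - x \<bullet> y)" using p by (simp add: field_simps)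
  also have "\<dots> \<le> (norm (x - y))\<^sup>2"
    using zero_le_power2[of "norm x - norm y"]
    unfolding norm_diff_square p_def power2_diff by (simp add: algebra_simps)
  finally show ?thesis by (rule power2_le_imp_le) simp
qed

text \<open>Multiplication by \<open>|x| \<ge> 1\<close> turns the left side into
  \<open>|x| * |y| - (x, y)\<close>, which equals \<open>(|x - y|^2 - (|x| - |y|)^2) / 2\<close>.
  The bound is quadratic in \<open>x - y\<close>, like the dissipation that is to absorb it.\<close>

lemma direction_defect_le:
  fixes x y :: "'a::real_inner"
  assumes "1 \<le> norm x"
  shows "norm y - (x \<bullet> y) / norm x \<le> (norm (x - y))\<^sup>2 / 2"
proof -
  have cs: "x \<bullet> y \<le> norm x * norm y" by (rule norm_cauchy_schwarz)
  have "0 \<le> norm y - (x \<bullet> y) / norm x"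
    using divide_right_mono[OF cs, of "norm x"] assms by (auto split: if_splits)
  from mult_right_mono[OF assms this]
  have "norm y - (x \<bullet> y) / norm x \<le> norm x * (norm y - (x \<bullet> y) / norm x)" by simp
  also have "\<dots> = norm x * norm y - x \<bullet> y" using assms by (simp add: field_simps)
  also have "\<dots> \<le> (norm (x - y))\<^sup>2 / 2"
    using zero_le_power2[of "norm x - norm y"]
    unfolding norm_diff_square power2_diff by simp
  finally show ?thesis .
qed

context cone_scheme
begin

text \<open>A sum counted from site 0 also grows by the flux out of cell 0. Subtracting the time
  integral of this flux leaves \<open>- a t j\<close> as the derivative at every site, so this is
  the Lagrangian coordinate of the right end of cell \<open>j\<close>.\<close>

definition mass :: "real \<Rightarrow> int \<Rightarrow> real" where
  "mass t j = lattice_sum (\<lambda>i. h * v t i) j - integral {0..t} (\<lambda>s. a s 0)"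

lemma mass_step: "mass t j - mass t (j - 1) = h * v t j"
  using lattice_sum_step[of "\<lambda>i. h * v t i" j] by (simp add: mass_def)

lemma mass_mono: "0 \<le> t \<Longrightarrow> mass t (j - 1) \<le> mass t j"
  using mass_step[of t j] v_nonneg[of t j] h_pos by (smt (verit) mult_nonneg_nonneg)

lemma mass_increment_le:
  assumes "0 \<le> t"
  shows "0 \<le> mass t (j + int k) - mass t j \<and> mass t (j + int k) - mass t j \<le> real k * h * M"
proof (induction k)
  case (Suc k)
  have "mass t (j + int (Suc k)) - mass t (j + int k) = h * v t (j + int (Suc k))"
    using mass_step[of t "j + int (Suc k)"] by (simp add: algebra_simps)
  moreover have "0 \<le> h * v t (j + int (Suc k))" "h * v t (j + int (Suc k)) \<le> h * M"
    using v_nonneg[OF assms] v_le[OF assms] h_pos by (auto intro: mult_left_mono)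
  ultimately show ?case using Suc by (simp add: algebra_simps)
qed simp

lemma mass_deriv:
  assumes "0 < t"
  shows "((\<lambda>s. mass s j) has_real_derivative - a t j) (at t)"
proof -
  have 1: "((\<lambda>s. lattice_sum (\<lambda>i. h * v s i) j) has_real_derivative
      lattice_sum (\<lambda>i. h * (- (a t i - a t (i - 1)) / h)) j) (at t)"
    unfolding lattice_sum_def by (intro DERIV_diff DERIV_sum DERIV_cmult v_deriv assms)
  have "(\<lambda>i. h * (- (a t i - a t (i - 1)) / h)) = (\<lambda>i. - a t i - (- a t (i - 1)))"
    using h_pos by (auto simp: fun_eq_iff)
  then have 2: "lattice_sum (\<lambda>i. h * (- (a t i - a t (i - 1)) / h)) j = - a t j + a t 0"
    using lattice_sum_telescope[of "\<lambda>i. - a t i" j] by simp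
  have "((\<lambda>s. integral {0..s} (\<lambda>s. a s 0)) has_real_derivative a t 0) (at t within {0..t+1})"
    using assms by (intro integral_has_real_derivative continuous_on_subset[OF a_cont]) auto
  then have 3: "((\<lambda>s. integral {0..s} (\<lambda>s. a s 0)) has_real_derivative a t 0) (at t)"
    using assms by (simp add: at_within_Icc_at)
  show ?thesis unfolding mass_def using DERIV_diff[OF 1 3] 2 by simp
qed

lemma mass_cont: "continuous_on {0..} (\<lambda>t. mass t j)"
proof -
  have "continuous_on {0..T} (\<lambda>t. integral {0..t} (\<lambda>s. a s 0))" for T
    by (intro indefinite_integral_continuous_1 integrable_continuous_real continuous_on_subset[OF a_cont]) auto
  then have I: "continuous_on {0..} (\<lambda>t. integral {0..t} (\<lambda>s. a s 0))"
    unfolding continuous_on_eq_continuous_within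
  proof (intro ballI)
    fix t :: real assume *: "\<And>T. \<forall>x\<in>{0..T}. continuous (at x within {0..T}) (\<lambda>t. integral {0..t} (\<lambda>s. a s 0))"
      and t: "t \<in> {0..}"
    have "at t within {0..t + 1} = at t within {0..}"
      using t by (intro at_within_nhd[of _ "{..<t + 1}"]) auto
    then show "continuous (at t within {0..}) (\<lambda>t. integral {0..t} (\<lambda>s. a s 0))"
      using *[of "t + 1"] t by force
  qed
  show ?thesis unfolding mass_def lattice_sum_def by (intro continuous_intros v_cont I)
qed

end

section \<open>Energy of the deviation from a transported profile\<close>

locale profile_scheme = cone_scheme \<phi> h u M \<delta> L m e
  for \<phi> h and u :: "real \<Rightarrow> int \<Rightarrow> 'a::real_inner" and M \<delta> L m e +
  fixes F G :: "real \<Rightarrow> 'a" and \<Lambda> B :: real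
  assumes G_deriv: "\<And>x. (G has_vector_derivative F x) (at x)"
    and F_lipschitz: "\<And>x y. norm (F x - F y) \<le> \<Lambda> * \<bar>x - y\<bar>"
    and F_bound: "\<And>x. norm (F x) \<le> B"
    and Lambda_nonneg: "0 \<le> \<Lambda>"
begin

text \<open>The increment of \<open>G\<close> over the mass of the cell, divided by that mass, is
  the mean of \<open>F\<close>; in vacuum division by zero makes it 0.\<close>

definition z :: "real \<Rightarrow> int \<Rightarrow> 'a" where
  "z t j = (G (mass t j) - G (mass t (j - 1))) /\<^sub>R (h * v t j)"
definition d :: "real \<Rightarrow> int \<Rightarrow> 'a" where "d t j = u t j /\<^sub>R v t j - z t j"
text \<open>The error in transporting the profile: the upwind flux carries the mean over the cell,
  exact transport the value of \<open>F\<close> at the right end of the cell.\<close>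

definition rho :: "real \<Rightarrow> int \<Rightarrow> 'a" where "rho t j = a t j *\<^sub>R (z t j - F (mass t j))"
definition E :: "real \<Rightarrow> int \<Rightarrow> real" where "E t j = h * (v t j * (norm (d t j))\<^sup>2)"
text \<open>The flux of energy that emerges from \<open>energy_identity\<close>.\<close>

definition fl :: "real \<Rightarrow> int \<Rightarrow> real" where
  "fl t j = a t j * (norm (d t j))\<^sup>2 + 2 * (d t j \<bullet> rho t j)"

lemma B_nonneg: "0 \<le> B" using F_bound[of 0] norm_ge_zero order_trans by blast

lemma z_minus_F:
  assumes "0 \<le> t" "0 < v t j" "c \<in> {mass t (j - 1)..mass t j}"
  shows "norm (z t j - F c) \<le> \<Lambda> * h * v t j"
proof -
  define l where "l = h * v t j"
  have l: "0 < l" "mass t j - mass t (j - 1) = l" using assms h_pos mass_step by (auto simp: l_def)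
  have "norm (G (mass t j) - G (mass t (j - 1)) - (mass t j - mass t (j - 1)) *\<^sub>R F c)
      \<le> \<Lambda> * (mass t j - mass t (j - 1)) * (mass t j - mass t (j - 1))"
    by (rule increment_linearization[OF G_deriv F_lipschitz Lambda_nonneg mass_mono[OF assms(1)] assms(3)])
  then have 1: "norm (G (mass t j) - G (mass t (j - 1)) - l *\<^sub>R F c) \<le> \<Lambda> * l * l" by (simp add: l)
  have "z t j - F c = (G (mass t j) - G (mass t (j - 1)) - l *\<^sub>R F c) /\<^sub>R l"
    unfolding z_def l_def[symmetric] using l by (simp add: scaleR_diff_right)
  then have "norm (z t j - F c) = norm (G (mass t j) - G (mass t (j - 1)) - l *\<^sub>R F c) / l"
    using l by (simp add: divide_inverse mult.commute)
  also have "\<dots> \<le> (\<Lambda> * l * l) / l" using l 1 by (intro divide_right_mono) auto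
  also have "\<dots> = \<Lambda> * l" using l(1) by simp
  finally show ?thesis by (simp add: l_def mult.assoc)
qed

lemma z_bound:
  assumes t: "0 \<le> t"
  shows "norm (z t j) \<le> B"
proof (cases "v t j = 0")
  case True
  then show ?thesis by (simp add: z_def B_nonneg)
next
  case False
  define l where "l = h * v t j"
  have l: "0 < l" "mass t j - mass t (j - 1) = l"
    using False v_nonneg[OF t, of j] h_pos mass_step by (auto simp: l_def)
  have "norm (G (mass t j) - G (mass t (j - 1))) \<le> B * norm (mass t j - mass t (j - 1))"
  proof (rule differentiable_bound[where S = UNIV and f' = "\<lambda>s k. k *\<^sub>R F s"])
    show "(G has_derivative (\<lambda>k. k *\<^sub>R F s)) (at s within UNIV)" for s
      using G_deriv[of s] by (simp add: has_vector_derivative_def)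
    show "onorm (\<lambda>k. k *\<^sub>R F s) \<le> B" for s
    proof (rule onorm_le)
      fix k :: real
      show "norm (k *\<^sub>R F s) \<le> B * norm k"
        using mult_right_mono[OF F_bound[of s], of "\<bar>k\<bar>"] by (simp add: mult.commute)
    qed
  qed auto
  then have "norm (G (mass t j) - G (mass t (j - 1))) \<le> B * l" using l by simp
  then have "norm (G (mass t j) - G (mass t (j - 1))) / l \<le> B"
    using l(1) by (simp add: divide_le_eq)
  then show ?thesis unfolding z_def l_def[symmetric] using l(1) by (simp add: divide_inverse mult.commute)
qed

lemma norm_ratio_ge_1:
  assumes "0 \<le> t" "0 < v t j"
  shows "1 \<le> norm (u t j /\<^sub>R v t j)"
  using assms v_le_r[of t j] by (simp add: r_def field_simps)

lemma norm_ratio_le: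
  assumes t: "0 \<le> t"
  shows "norm (u t j /\<^sub>R v t j) \<le> 1 / \<delta>"
proof (cases "v t j = 0")
  case True
  then show ?thesis using delta_pos by simp
next
  case False
  then have "0 < v t j" using v_nonneg[OF t, of j] by simp
  then show ?thesis using v_ge[OF t, of j] delta_pos by (simp add: r_def field_simps)
qed

lemma d_bound: "0 \<le> t \<Longrightarrow> norm (d t j) \<le> 1 / \<delta> + B"
  unfolding d_def using norm_ratio_le z_bound by (intro norm_triangle_le_diff add_mono)

lemma v_pos_or_zero: "0 \<le> t \<Longrightarrow> 0 < v t j \<or> v t j = 0" using v_nonneg[of t j] by auto

lemma rho_bound:
  assumes t: "0 \<le> t"
  shows "norm (rho t j) \<le> a t j * (\<Lambda> * h * v t j)"
  using v_pos_or_zero[OF t, of j]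
proof
  assume "0 < v t j"
  then show ?thesis unfolding rho_def norm_scaleR
    using z_minus_F[OF t, of j "mass t j"] mass_mono[OF t] a_nonneg[OF t] by (auto intro: mult_left_mono)
next
  assume "v t j = 0"
  then show ?thesis by (simp add: rho_def a_def)
qed

lemma flux_decomposition:
  assumes t: "0 \<le> t"
  shows "\<phi> (r t j) *\<^sub>R u t j - a t j *\<^sub>R F (mass t j) = a t j *\<^sub>R d t j + rho t j"
  using v_pos_or_zero[OF t, of j]
proof
  assume "0 < v t j"
  then have "\<phi> (r t j) *\<^sub>R u t j = a t j *\<^sub>R (u t j /\<^sub>R v t j)" by (simp add: a_def)
  then show ?thesis by (simp add: rho_def d_def scaleR_diff_right)
next
  assume "v t j = 0"
  then show ?thesis using u_eq_0_iff[OF t, of j] by (simp add: a_def rho_def)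
qed

text \<open>This is \<open>v *\<^sub>R d\<close> freed of the division by \<open>v\<close>. Since
  \<open>G (mass t j)\<close> has the time derivative \<open>- a *\<^sub>R F\<close>, it obeys a
  conservation law with flux \<open>a *\<^sub>R d + rho\<close>.\<close>

definition w :: "real \<Rightarrow> int \<Rightarrow> 'a" where
  "w t j = u t j - (G (mass t j) - G (mass t (j - 1))) /\<^sub>R h"

lemma w_eq:
  assumes "0 < v t j"
  shows "w t j = v t j *\<^sub>R d t j"
proof -
  have "v t j * inverse (h * v t j) = inverse h" "v t j * inverse (v t j) = 1"
    using assms h_pos by (simp_all add: field_simps)
  then show ?thesis
    unfolding w_def d_def z_def scaleR_diff_right[of "v t j"] scaleR_scaleR by simp
qed

lemma G_mass_deriv:
  assumes "0 < t"
  shows "((\<lambda>s. G (mass s j)) has_vector_derivative - a t j *\<^sub>R F (mass t j)) (at t)"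
  using vector_diff_chain_at[OF mass_deriv[OF assms, of j, unfolded has_real_derivative_iff_has_vector_derivative]
      G_deriv] by (simp add: o_def)

lemma w_deriv:
  assumes t: "0 < t"
  shows "((\<lambda>s. w s j) has_vector_derivative
    - ((a t j *\<^sub>R d t j + rho t j) - (a t (j - 1) *\<^sub>R d t (j - 1) + rho t (j - 1))) /\<^sub>R h) (at t)"
proof -
  have t': "0 \<le> t" using t by simp
  have "((\<lambda>s. (G (mass s j) - G (mass s (j - 1))) /\<^sub>R h) has_vector_derivative
      ((- a t j *\<^sub>R F (mass t j)) - (- a t (j - 1) *\<^sub>R F (mass t (j - 1)))) /\<^sub>R h) (at t)"
    by (rule bounded_linear.has_vector_derivative[OF bounded_linear_scaleR_right
          has_vector_derivative_diff[OF G_mass_deriv[OF t] G_mass_deriv[OF t]]])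
  from has_vector_derivative_diff[OF u_deriv[OF t, of j] this]
  show ?thesis unfolding w_def flux_decomposition[OF t', symmetric] D_minus_def r_def
    by (rule has_vector_derivative_eq_rhs) (simp add: algebra_simps)
qed

lemma E_eq_w: "0 < v t j \<Longrightarrow> E t j = h * (w t j \<bullet> w t j) / v t j"
  by (simp add: w_eq E_def power2_norm_eq_inner)

lemma E_zero: "v t j = 0 \<Longrightarrow> E t j = 0" by (simp add: E_def)

text \<open>Completing the square: an upwind flux difference tested with \<open>d1\<close> is a
  difference of energy fluxes, minus a dissipation whose coefficient \<open>a0\<close> belongs to
  the left neighbour, plus a cross term with the transport error \<open>R0\<close>.\<close>

lemma energy_identity:
  fixes d1 d0 R1 R0 :: "'b::real_inner"
  shows "2 * (d1 \<bullet> - ((a1 *\<^sub>R d1 + R1) - (a0 *\<^sub>R d0 + R0))) + (norm d1)\<^sup>2 * (a1 - a0)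
     = - ((a1 * (norm d1)\<^sup>2 + 2 * (d1 \<bullet> R1)) - (a0 * (norm d0)\<^sup>2 + 2 * (d0 \<bullet> R0)))
       - a0 * (norm (d1 - d0))\<^sup>2 + 2 * ((d1 - d0) \<bullet> R0)"
  unfolding power2_norm_eq_inner
  by (simp add: inner_diff_left inner_diff_right inner_add_right inner_commute algebra_simps)

lemma E_deriv_pos:
  assumes t: "0 < t" and vpos: "0 < v t j"
  shows "((\<lambda>s. E s j) has_real_derivative
     2 * (d t j \<bullet> - ((a t j *\<^sub>R d t j + rho t j) - (a t (j - 1) *\<^sub>R d t (j - 1) + rho t (j - 1))))
       + (norm (d t j))\<^sup>2 * (a t j - a t (j - 1))) (at t)"
proof -
  define W where "W = - ((a t j *\<^sub>R d t j + rho t j) - (a t (j - 1) *\<^sub>R d t (j - 1) + rho t (j - 1))) /\<^sub>R h"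
  have w': "((\<lambda>s. w s j) has_vector_derivative W) (at t)" unfolding W_def by (rule w_deriv[OF t])
  have ww: "((\<lambda>s. w s j \<bullet> w s j) has_real_derivative 2 * (w t j \<bullet> W)) (at t)"
    using has_derivative_inner[OF w'[unfolded has_vector_derivative_def] w'[unfolded has_vector_derivative_def]]
    unfolding has_field_derivative_def
    by (rule has_derivative_eq_rhs) (auto simp: inner_commute algebra_simps fun_eq_iff)
  have 1: "((\<lambda>s. h * (w s j \<bullet> w s j) / v s j) has_real_derivative
      ((h * (2 * (w t j \<bullet> W))) * v t j - (h * (w t j \<bullet> w t j)) * (- (a t j - a t (j - 1)) / h)) / (v t j * v t j)) (at t)"
    using vpos by (intro DERIV_divide DERIV_cmult ww v_deriv t) auto
  have "((h * (2 * (w t j \<bullet> W))) * v t j - (h * (w t j \<bullet> w t j)) * (- (a t j - a t (j - 1)) / h)) / (v t j * v t j)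
     = 2 * (d t j \<bullet> (h *\<^sub>R W)) + (norm (d t j))\<^sup>2 * (a t j - a t (j - 1))"
    using vpos h_pos unfolding w_eq[OF vpos] power2_norm_eq_inner by (simp add: field_simps)
  also have "h *\<^sub>R W = - ((a t j *\<^sub>R d t j + rho t j) - (a t (j - 1) *\<^sub>R d t (j - 1) + rho t (j - 1)))"
    using h_pos unfolding W_def by simp
  finally have 2: "((\<lambda>s. h * (w s j \<bullet> w s j) / v s j) has_real_derivative
     2 * (d t j \<bullet> - ((a t j *\<^sub>R d t j + rho t j) - (a t (j - 1) *\<^sub>R d t (j - 1) + rho t (j - 1))))
       + (norm (d t j))\<^sup>2 * (a t j - a t (j - 1))) (at t)" using 1 by simp
  \<comment> \<open>The quotient formula for \<open>E\<close> must hold in a whole neighbourhood of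
    \<open>t\<close>; an occupied cell is occupied at all positive times.\<close>
  have "0 < v s j" if s: "0 < s" for s
    using v_vanishing[OF s, of j j t] vpos t v_pos_or_zero[of s j] s by auto
  then show ?thesis
    by (intro has_field_derivative_transform_within_open[OF 2, of "{0<..}"]) (use t in \<open>auto simp: E_eq_w\<close>)
qed

text \<open>Of order \<open>h^2\<close> for a fixed profile. It is summed against \<open>v\<close>,
  whose sum is at most \<open>m / h\<close>, and so contributes a term of order
  \<open>h\<close>.\<close>

definition c1 :: real where "c1 = \<phi> M * M\<^sup>2 * \<Lambda>\<^sup>2 * h\<^sup>2"

lemma c1_nonneg: "0 \<le> c1" unfolding c1_def using phi_nonneg[OF M_nonneg] by simp

lemma a_le_M: "0 \<le> t \<Longrightarrow> a t j \<le> \<phi> M * M"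
  using a_le[of t j] v_le[of t j] phi_nonneg[OF M_nonneg] by (meson mult_left_mono order_trans)

text \<open>Young's inequality spends half of the dissipation. What remains is quadratic in
  \<open>\<Lambda> * h * v\<close>; the bound \<open>a * v \<le> \<phi> M * M^2\<close> removes one
  factor \<open>v\<close> and keeps the other for summation.\<close>

lemma cross_term_le:
  assumes t: "0 \<le> t"
  shows "2 * ((d t j - d t (j - 1)) \<bullet> rho t (j - 1))
    \<le> a t (j - 1) * (norm (d t j - d t (j - 1)))\<^sup>2 / 2 + 2 * c1 * v t (j - 1)"
proof -
  let ?n = "norm (d t j - d t (j - 1))" and ?a = "a t (j - 1)" and ?v = "v t (j - 1)"
  let ?q = "\<Lambda> * h * ?v"
  have a: "0 \<le> ?a" and v: "0 \<le> ?v" using a_nonneg[OF t] v_nonneg[OF t] by auto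
  have "(d t j - d t (j - 1)) \<bullet> rho t (j - 1) \<le> ?n * norm (rho t (j - 1))" by (rule norm_cauchy_schwarz)
  also have "\<dots> \<le> ?n * (?a * ?q)" by (intro mult_left_mono rho_bound t) auto
  finally have 1: "2 * ((d t j - d t (j - 1)) \<bullet> rho t (j - 1)) \<le> ?a * (2 * ?n * ?q)" by (simp add: mult_ac)
  have "2 * ?n * ?q \<le> ?n\<^sup>2 / 2 + 2 * ?q\<^sup>2"
    using zero_le_power2[of "?n - 2 * ?q"] unfolding power2_diff by (simp add: power2_eq_square)
  from mult_left_mono[OF this a] have 2: "?a * (2 * ?n * ?q) \<le> ?a * ?n\<^sup>2 / 2 + 2 * (?a * ?q\<^sup>2)"
    by (simp add: algebra_simps)
  have "?a * ?v \<le> (\<phi> M * M) * M"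
    using a v a_le_M[OF t] v_le[OF t] phi_nonneg[OF M_nonneg] M_nonneg by (intro mult_mono) auto
  then have "?a * ?v * (\<Lambda>\<^sup>2 * h\<^sup>2 * ?v) \<le> (\<phi> M * M) * M * (\<Lambda>\<^sup>2 * h\<^sup>2 * ?v)"
    using v by (intro mult_right_mono) auto
  then have "?a * ?q\<^sup>2 \<le> c1 * ?v" by (simp add: c1_def power2_eq_square mult_ac)
  then show ?thesis using 1 2 by linarith
qed

lemma E_deriv_le:
  assumes t: "0 < t"
  obtains D where "((\<lambda>s. E s j) has_real_derivative D) (at t)"
    "D \<le> - (fl t j - fl t (j - 1)) - a t (j - 1) * (norm (d t j - d t (j - 1)))\<^sup>2 / 2 + 2 * c1 * v t (j - 1)"
proof -
  have t': "0 \<le> t" using t by simp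
  consider "0 < v t j" | "v t j = 0" using v_pos_or_zero[OF t'] by blast
  then show thesis
  proof cases
    case 1
    show thesis
      by (rule that[OF E_deriv_pos[OF t 1]], unfold energy_identity fl_def)
        (use cross_term_le[OF t', of j] in linarith)
  next
    case 2
    \<comment> \<open>The left neighbour is empty as well, so every term of the claimed bound
      vanishes.\<close>
    have z: "v s j = 0" "v s (j - 1) = 0" if "0 \<le> s" for s
      using v_vanishing[OF t 2 _ that] by auto
    have "((\<lambda>s. 0::real) has_real_derivative 0) (at t)" by (rule DERIV_const)
    then have "((\<lambda>s. E s j) has_real_derivative 0) (at t)"
      by (rule has_field_derivative_transform_within_open[where S = "{0<..}"])
        (use t z in \<open>auto simp: E_zero\<close>)
    then show thesis
      by (rule that) (use z[OF t'] in \<open>simp add: fl_def rho_def a_def\<close>)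
  qed
qed

lemma E_nonneg: "0 \<le> t \<Longrightarrow> 0 \<le> E t j" using h_pos v_nonneg[of t j] by (simp add: E_def)

text \<open>Positive times are covered by differentiability. At time 0 a cell may be empty and fill
  at once; nothing is known then about the limit of \<open>d\<close>, but \<open>d\<close> is
  bounded, so \<open>E\<close> is at most a multiple of \<open>v\<close> and tends to 0.\<close>

lemma E_cont: "continuous_on {0..} (\<lambda>t. E t j)"
  unfolding continuous_on_eq_continuous_within
proof
  fix t :: real assume "t \<in> {0..}"
  then consider "0 < t" | "t = 0" by force
  then show "continuous (at t within {0..}) (\<lambda>t. E t j)"
  proof cases
    case 1
    obtain D where "((\<lambda>s. E s j) has_real_derivative D) (at t)" using E_deriv_le[OF 1] by blast
    then show ?thesis by (rule continuous_at_imp_continuous_at_within[OF DERIV_isCont])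
  next
    case 2
    show ?thesis
    proof (cases "v 0 j = 0")
      case True
      define K where "K = h * (1 / \<delta> + B)\<^sup>2"
      have le: "E s j \<le> K * v s j" if "0 \<le> s" for s
      proof -
        have "(norm (d s j))\<^sup>2 \<le> (1 / \<delta> + B)\<^sup>2" by (intro power_mono d_bound that) auto
        then have "h * v s j * (norm (d s j))\<^sup>2 \<le> h * v s j * (1 / \<delta> + B)\<^sup>2"
          using h_pos v_nonneg[OF that] by (intro mult_left_mono) auto
        then show ?thesis by (simp add: E_def K_def mult_ac)
      qed
      have "((\<lambda>s. v s j) \<longlongrightarrow> v 0 j) (at 0 within {0..})"
        using v_cont[of j] unfolding continuous_on_def by simp
      from tendsto_mult[OF tendsto_const[of K] this]
      have lim: "((\<lambda>s. K * v s j) \<longlongrightarrow> 0) (at 0 within {0..})" by (simp add: True)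
      have "((\<lambda>s. E s j) \<longlongrightarrow> 0) (at 0 within {0..})"
      proof (rule tendsto_sandwich[OF _ _ tendsto_const lim])
        show "\<forall>\<^sub>F s in at 0 within {0..}. 0 \<le> E s j"
          by (simp add: eventually_at_filter E_nonneg)
        show "\<forall>\<^sub>F s in at 0 within {0..}. E s j \<le> K * v s j"
          by (simp add: eventually_at_filter le)
      qed
      then show ?thesis using 2 True by (simp add: continuous_within E_zero)
    next
      case False
      have pos: "0 < v s j" if s: "0 \<le> s" for s
      proof -
        have "v s j \<noteq> 0" using v_vanishing[of s j j 0] s False by (cases "s = 0") auto
        then show ?thesis using v_nonneg[OF s, of j] by simp
      qed
      have "continuous_on {0..} (\<lambda>s. G (mass s i))" for i
        by (rule continuous_on_compose2[OF _ mass_cont, of UNIV G])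
          (auto intro!: continuous_at_imp_continuous_on has_vector_derivative_continuous[OF G_deriv])
      then have "continuous_on {0..} (\<lambda>s. h * (w s j \<bullet> w s j) / v s j)"
        unfolding w_def by (intro continuous_intros u_cont v_cont) (use pos in \<open>simp_all add: less_imp_neq[symmetric]\<close>)
      then have "continuous_on {0..} (\<lambda>s. E s j)"
        by (rule continuous_on_eq) (simp add: E_eq_w pos)
      then show ?thesis using 2 by (simp add: continuous_on_eq_continuous_within)
    qed
  qed
qed

end

section \<open>L1 contraction with the defects paid by the energy\<close>

lemma smooth_abs_dissipation:
  fixes y \<Gamma> \<Gamma>' Q L \<eta> :: real
  assumes "\<bar>\<Gamma>\<bar> \<le> L * \<bar>y\<bar>" "0 \<le> \<Gamma> * y" "0 < \<eta>" "0 \<le> L"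
  shows "y / sqrt (y\<^sup>2 + \<eta>\<^sup>2) * (- (\<Gamma> - \<Gamma>') + Q) \<le> - \<bar>\<Gamma>\<bar> + \<bar>\<Gamma>'\<bar> + L * \<eta> + \<bar>Q\<bar>"
proof -
  \<comment> \<open>\<open>y / p\<close> is the derivative of the smoothed absolute value. It has
    modulus at most 1, which settles the terms \<open>\<Gamma>'\<close> and \<open>Q\<close>;
    against \<open>\<Gamma>\<close>, which has the sign of \<open>y\<close>, it loses only
    \<open>|\<Gamma>| * (1 - |y| / p)\<close>, at most \<open>L * \<eta>\<close>.\<close>
  define p where "p = sqrt (y\<^sup>2 + \<eta>\<^sup>2)"
  have "0 < y\<^sup>2 + \<eta>\<^sup>2" using assms(3) by (simp add: add_nonneg_pos)
  then have p: "0 < p" by (simp add: p_def)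
  have yp: "\<bar>y\<bar> \<le> p" unfolding p_def by (rule real_le_rsqrt) simp
  have py: "p \<le> \<bar>y\<bar> + \<eta>" unfolding p_def using sqrt_sum_squares_le_sum_abs[of y \<eta>] assms(3) by simp
  have yr: "\<bar>y / p\<bar> \<le> 1" using yp p by (simp add: abs_divide)
  have "\<bar>\<Gamma>\<bar> * \<bar>y\<bar> = \<bar>\<Gamma> * y\<bar>" by (rule abs_mult[symmetric])
  also have "\<dots> = \<Gamma> * y" using assms(2) by (rule abs_of_nonneg)
  finally have "\<bar>\<Gamma>\<bar> * \<bar>y\<bar> / p = \<Gamma> * y / p" by (rule arg_cong)
  then have e: "y / p * \<Gamma> = \<bar>\<Gamma>\<bar> * (\<bar>y\<bar> / p)" by (simp only: times_divide_eq_left times_divide_eq_right mult.commute)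
  have "\<bar>\<Gamma>\<bar> - \<bar>\<Gamma>\<bar> * (\<bar>y\<bar> / p) = \<bar>\<Gamma>\<bar> / p * (p - \<bar>y\<bar>)" using p by (simp add: field_simps)
  also have "\<dots> \<le> L * \<eta>"
  proof (rule mult_mono)
    have "L * \<bar>y\<bar> \<le> L * p" using yp assms(4) by (rule mult_left_mono)
    then have "\<bar>\<Gamma>\<bar> \<le> L * p" using assms(1) by linarith
    then show "\<bar>\<Gamma>\<bar> / p \<le> L" using p by (simp add: divide_le_eq)
    show "p - \<bar>y\<bar> \<le> \<eta>" "0 \<le> p - \<bar>y\<bar>" using yp py by linarith+
  qed (rule assms(4))
  finally have 1: "- (y / p * \<Gamma>) \<le> - \<bar>\<Gamma>\<bar> + L * \<eta>" using e by linarith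
  have "y / p * (\<Gamma>' + Q) \<le> \<bar>y / p\<bar> * \<bar>\<Gamma>' + Q\<bar>" unfolding abs_mult[symmetric] by (rule abs_ge_self)
  also have "\<dots> \<le> 1 * \<bar>\<Gamma>' + Q\<bar>" using yr by (intro mult_right_mono) auto
  also have "1 * \<bar>\<Gamma>' + Q\<bar> \<le> \<bar>\<Gamma>'\<bar> + \<bar>Q\<bar>" using abs_triangle_ineq by simp
  finally have 2: "y / p * (\<Gamma>' + Q) \<le> \<bar>\<Gamma>'\<bar> + \<bar>Q\<bar>" .
  have "y / p * (- (\<Gamma> - \<Gamma>') + Q) = - (y / p * \<Gamma>) + y / p * (\<Gamma>' + Q)" by (simp add: algebra_simps)
  then show ?thesis using 1 2 unfolding p_def by linarith
qed

lemma sum_int_shift_le: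
  fixes f :: "int \<Rightarrow> real"
  assumes "\<And>i. 0 \<le> f i"
  shows "(\<Sum>j\<in>{a..b}. f (j + int k)) \<le> (\<Sum>i\<in>{a..b + int k}. f i)"
proof -
  have "(\<Sum>j\<in>{a..b}. f (j + int k)) = (\<Sum>i\<in>{a + int k..b + int k}. f i)"
    by (rule sum.reindex_bij_witness[of _ "\<lambda>i. i - int k" "\<lambda>i. i + int k"]) auto
  also have "\<dots> \<le> (\<Sum>i\<in>{a..b + int k}. f i)" using assms by (intro sum_mono2) auto
  finally show ?thesis .
qed

lemma le_of_le_add_mult:
  fixes A X c :: real
  assumes "\<And>\<eta>. 0 < \<eta> \<Longrightarrow> A \<le> X + \<eta> * c" "0 \<le> c"
  shows "A \<le> X"
proof (rule field_le_epsilon)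
  fix e :: real assume e: "0 < e"
  have "A \<le> X + e / (c + 1) * c" using assms e by (intro assms(1)) auto
  also have "e / (c + 1) * c \<le> e" using assms(2) e by (simp add: field_simps)
  finally show "A \<le> X + e" by simp
qed

context cone_scheme
begin

lemma m_nonneg: "0 \<le> m" using mass_initial[of 1 0] by simp

lemma sum_v_le: "0 \<le> t \<Longrightarrow> (\<Sum>i\<in>{k..l}. v t i) \<le> m / h"
  using mass_le[of t k l] h_pos by (simp add: sum_distrib_left[symmetric] field_simps)

lemma sum_v_pred_le: "0 \<le> t \<Longrightarrow> (\<Sum>i\<in>{k..l}. v t (i - 1)) \<le> m / h"
proof -
  assume t: "0 \<le> t"
  have "(\<Sum>i\<in>{k..l}. v t (i - 1)) = (\<Sum>i\<in>{k - 1..l - 1}. v t i)"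
    by (rule sum.reindex_bij_witness[of _ "\<lambda>i. i + 1" "\<lambda>i. i - 1"]) auto
  then show ?thesis using sum_v_le[OF t] by simp
qed

lemma r_le_v: "0 \<le> t \<Longrightarrow> r t j \<le> v t j / \<delta>"
  using v_ge[of t j] delta_pos by (simp add: field_simps)

end

context profile_scheme
begin

text \<open>The two cells share the end point \<open>mass t (j - 1)\<close>, and both means are
  close to the value of \<open>F\<close> there.\<close>

lemma z_step_le:
  assumes t: "0 \<le> t" and "0 < v t j" "0 < v t (j - 1)"
  shows "norm (z t j - z t (j - 1)) \<le> \<Lambda> * h * (v t j + v t (j - 1))"
proof -
  let ?F = "F (mass t (j - 1))"
  have "norm (z t j - ?F) \<le> \<Lambda> * h * v t j" "norm (z t (j - 1) - ?F) \<le> \<Lambda> * h * v t (j - 1)"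
    using assms mass_mono[OF t, of j] mass_mono[OF t, of "j - 1"] by (auto intro!: z_minus_F)
  moreover have "z t j - z t (j - 1) = (z t j - ?F) - (z t (j - 1) - ?F)" by simp
  ultimately show ?thesis
    using norm_triangle_ineq4[of "z t j - ?F" "z t (j - 1) - ?F"] by (simp add: distrib_left)
qed

text \<open>The dissipation controls jumps of \<open>d\<close>, while the defect of \<open>r\<close>
  involves jumps of \<open>u / v\<close>. They differ by jumps of the means \<open>z\<close>, which
  are of order \<open>h\<close> and enter squared.\<close>

lemma direction_step_le:
  assumes t: "0 \<le> t" and v1: "0 < v t j" and v0: "0 < v t (j - 1)"
  shows "a t (j - 1) * ((norm (u t j /\<^sub>R v t j - u t (j - 1) /\<^sub>R v t (j - 1)))\<^sup>2 / 2)
    \<le> a t (j - 1) * (norm (d t j - d t (j - 1)))\<^sup>2 + 2 * c1 * (v t j + v t (j - 1))"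
proof -
  let ?a = "a t (j - 1)" and ?s = "v t j + v t (j - 1)"
  define p where "p = d t j - d t (j - 1)"
  define q where "q = z t j - z t (j - 1)"
  have "u t j /\<^sub>R v t j - u t (j - 1) /\<^sub>R v t (j - 1) = p + q" by (simp add: p_def q_def d_def)
  moreover have "(norm (p + q))\<^sup>2 \<le> 2 * (norm p)\<^sup>2 + 2 * (norm q)\<^sup>2"
  proof -
    have "(norm (p + q))\<^sup>2 \<le> (norm p + norm q)\<^sup>2" by (intro power_mono norm_triangle_ineq) auto
    also have "\<dots> \<le> 2 * (norm p)\<^sup>2 + 2 * (norm q)\<^sup>2"
      using zero_le_power2[of "norm p - norm q"] by (simp add: power2_sum power2_diff)
    finally show ?thesis .
  qed
  ultimately have "(norm (u t j /\<^sub>R v t j - u t (j - 1) /\<^sub>R v t (j - 1)))\<^sup>2 / 2 \<le> (norm p)\<^sup>2 + (norm q)\<^sup>2" by simp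
  from mult_left_mono[OF this a_nonneg[OF t, of "j - 1"]]
  have 1: "?a * ((norm (u t j /\<^sub>R v t j - u t (j - 1) /\<^sub>R v t (j - 1)))\<^sup>2 / 2) \<le> ?a * (norm p)\<^sup>2 + ?a * (norm q)\<^sup>2"
    by (simp add: distrib_left)
  have "(norm q)\<^sup>2 \<le> (\<Lambda> * h * ?s)\<^sup>2"
    unfolding q_def by (intro power_mono z_step_le assms) auto
  also have "\<dots> = \<Lambda>\<^sup>2 * h\<^sup>2 * ?s * ?s" by (simp add: power2_eq_square mult_ac)
  also have "\<dots> \<le> \<Lambda>\<^sup>2 * h\<^sup>2 * ?s * (2 * M)"
    using v_le[OF t, of j] v_le[OF t, of "j - 1"] v1 v0 by (intro mult_left_mono) auto
  finally have "?a * (norm q)\<^sup>2 \<le> (\<phi> M * M) * (\<Lambda>\<^sup>2 * h\<^sup>2 * ?s * (2 * M))"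
    using a_nonneg[OF t] a_le_M[OF t] phi_nonneg[OF M_nonneg] M_nonneg by (intro mult_mono) auto
  also have "\<dots> = 2 * c1 * ?s" by (simp add: c1_def power2_eq_square mult_ac)
  finally show ?thesis using 1 by (simp add: p_def)
qed

text \<open>The defect \<open>q\<close> arises because only the component of the inflowing vector
  along \<open>u t j\<close> adds to the length. The loss is nonnegative by Cauchy-Schwarz and
  quadratic in the change of direction, hence bounded by the dissipation and terms with
  \<open>c1\<close>.\<close>

lemma r_deriv:
  assumes t: "0 < t"
  obtains q where "((\<lambda>s. r s j) has_real_derivative (- (g t j - g t (j - 1)) - q) / h) (at t)"
    "0 \<le> q" "q \<le> a t (j - 1) * (norm (d t j - d t (j - 1)))\<^sup>2 + 2 * c1 * (v t j + v t (j - 1))"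
proof -
  have t': "0 \<le> t" using t by simp
  have rhs: "0 \<le> a t (j - 1) * (norm (d t j - d t (j - 1)))\<^sup>2 + 2 * c1 * (v t j + v t (j - 1))"
    using a_nonneg[OF t'] v_nonneg[OF t'] c1_nonneg by (intro add_nonneg_nonneg mult_nonneg_nonneg) auto
  consider "0 < v t j" | "v t j = 0" using v_pos_or_zero[OF t'] by blast
  then show thesis
  proof cases
    case 2
    have z: "r s j = 0" "r s (j - 1) = 0" if "0 \<le> s" for s
      using v_vanishing[OF t 2 _ that] u_eq_0_iff[OF that] by (auto simp: r_def)
    have "((\<lambda>s. 0::real) has_real_derivative 0) (at t)" by (rule DERIV_const)
    then have "((\<lambda>s. r s j) has_real_derivative 0) (at t)"
      by (rule has_field_derivative_transform_within_open[where S = "{0<..}"]) (use t z in auto)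
    then show thesis using that[of 0] rhs z[OF t'] by (simp add: g_def)
  next
    case 1
    have nz: "u t j \<noteq> 0" using 1 u_eq_0_iff[OF t'] by auto
    define q where "q = \<phi> (r t (j - 1)) * (r t (j - 1) - (u t j \<bullet> u t (j - 1)) / r t j)"
    have rpos: "0 < r t j" using nz by (simp add: r_def)
    have D: "((\<lambda>s. r s j) has_real_derivative (- (g t j - g t (j - 1)) - q) / h) (at t)"
      using norm_u_deriv[OF t nz] unfolding r_def[symmetric]
      by (rule DERIV_cong) (simp add: g_def q_def algebra_simps)
    have "(u t j \<bullet> u t (j - 1)) / r t j \<le> (r t j * r t (j - 1)) / r t j"
      unfolding r_def by (intro divide_right_mono norm_cauchy_schwarz) auto
    then have q0: "0 \<le> q" unfolding q_def using rpos by (intro mult_nonneg_nonneg phi_r_nonneg) auto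
    have "q \<le> a t (j - 1) * (norm (d t j - d t (j - 1)))\<^sup>2 + 2 * c1 * (v t j + v t (j - 1))"
    proof (cases "v t (j - 1) = 0")
      case True
      then have "u t (j - 1) = 0" using u_eq_0_iff[OF t'] by simp
      then have "q = 0" by (simp add: q_def r_def)
      then show ?thesis using rhs by simp
    next
      case False
      then have v0: "0 < v t (j - 1)" using v_pos_or_zero[OF t', of "j - 1"] by simp
      define x where "x = u t j /\<^sub>R v t j"
      define y where "y = u t (j - 1) /\<^sub>R v t (j - 1)"
      have nx: "norm x = r t j / v t j" and ny: "norm y = r t (j - 1) / v t (j - 1)"
        using 1 v0 by (auto simp: x_def y_def r_def divide_inverse mult.commute)
      have xy: "x \<bullet> y = (u t j \<bullet> u t (j - 1)) / (v t j * v t (j - 1))"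
        by (simp add: x_def y_def divide_inverse mult_ac)
      \<comment> \<open>Scaling the left vector by its density turns the factor
        \<open>\<phi>\<close> into the mass flux; the expression does not depend on the length of
        the right vector.\<close>
      have "q = a t (j - 1) * (norm y - (x \<bullet> y) / norm x)"
        unfolding nx ny xy q_def a_def using 1 v0 rpos by (simp add: field_simps)
      also have "\<dots> \<le> a t (j - 1) * ((norm (x - y))\<^sup>2 / 2)"
        using norm_ratio_ge_1[OF t' 1]
        by (intro mult_left_mono direction_defect_le a_nonneg t') (simp add: x_def)
      also have "\<dots> \<le> a t (j - 1) * (norm (d t j - d t (j - 1)))\<^sup>2 + 2 * c1 * (v t j + v t (j - 1))"
        unfolding x_def y_def by (rule direction_step_le[OF t' 1 v0])
      finally show ?thesis .
    qed
    then show thesis using that D q0 by blast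
  qed
qed

definition cf :: real where
  "cf = \<phi> M * ((1 / \<delta> + B)\<^sup>2 + 2 * (1 / \<delta> + B) * (\<Lambda> * h * M))"

lemma cf_nonneg: "0 \<le> cf"
  unfolding cf_def using phi_nonneg[OF M_nonneg] delta_pos B_nonneg Lambda_nonneg h_pos M_nonneg
  by (intro mult_nonneg_nonneg add_nonneg_nonneg) auto

lemma fl_bound:
  assumes t: "0 \<le> t"
  shows "\<bar>fl t j\<bar> \<le> cf * v t j"
proof -
  let ?D = "1 / \<delta> + B"
  have D: "0 \<le> ?D" using delta_pos B_nonneg by simp
  have dD: "norm (d t j) \<le> ?D" by (rule d_bound[OF t])
  have a: "0 \<le> a t j" "a t j \<le> \<phi> M * v t j" using a_nonneg[OF t] a_le[OF t] by auto
  have "(norm (d t j))\<^sup>2 \<le> ?D\<^sup>2" by (intro power_mono dD) auto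
  then have 1: "a t j * (norm (d t j))\<^sup>2 \<le> (\<phi> M * v t j) * ?D\<^sup>2"
    using a by (intro mult_mono) auto
  have "\<Lambda> * h * v t j \<le> \<Lambda> * h * M" using v_le[OF t] Lambda_nonneg h_pos by (intro mult_left_mono) auto
  from mult_mono[OF a(2) this]
  have "a t j * (\<Lambda> * h * v t j) \<le> (\<phi> M * v t j) * (\<Lambda> * h * M)"
    using a v_nonneg[OF t, of j] Lambda_nonneg h_pos by simp
  then have rh: "norm (rho t j) \<le> (\<phi> M * v t j) * (\<Lambda> * h * M)" using rho_bound[OF t, of j] by linarith
  have "\<bar>d t j \<bullet> rho t j\<bar> \<le> norm (d t j) * norm (rho t j)" by (rule Cauchy_Schwarz_ineq2)
  also have "\<dots> \<le> ?D * ((\<phi> M * v t j) * (\<Lambda> * h * M))" by (intro mult_mono dD rh D) auto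
  finally have 2: "\<bar>d t j \<bullet> rho t j\<bar> \<le> ?D * ((\<phi> M * v t j) * (\<Lambda> * h * M))" .
  have "\<bar>fl t j\<bar> \<le> a t j * (norm (d t j))\<^sup>2 + 2 * \<bar>d t j \<bullet> rho t j\<bar>"
  proof -
    have "0 \<le> a t j * (norm (d t j))\<^sup>2" using a(1) by simp
    then show ?thesis unfolding fl_def by linarith
  qed
  then have "\<bar>fl t j\<bar> \<le> (\<phi> M * v t j) * ?D\<^sup>2 + 2 * (?D * ((\<phi> M * v t j) * (\<Lambda> * h * M)))"
    using 1 2 by linarith
  also have "\<dots> = cf * v t j" by (simp add: cf_def algebra_simps)
  finally show ?thesis .
qed

text \<open>Boundary terms per unit of density near the ends of the window:
  \<open>2 * L / \<delta>\<close> for the scalar flux at the left end, and \<open>8 * cf\<close> for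
  four times the energy flux at both ends.\<close>

definition cb :: real where "cb = 2 * L / \<delta> + 8 * cf"

text \<open>The monotone scheme contracts the distance between \<open>r\<close> and its translate by
  \<open>k\<close> cells, up to the defects. Each defect occurs twice, once in \<open>r\<close> and
  once in the translate, and is at most twice the dissipation of the energy plus small terms; hence
  the factor 4. The window of the energy is longer by \<open>k\<close> cells to contain the
  translated defects.\<close>

lemma contraction_balance:
  fixes N :: int and k :: nat
  assumes t: "0 \<le> t" and N: "int k \<le> N"
    and small: "\<And>s j. s \<in> {0..t} \<Longrightarrow> N - int k \<le> \<bar>j\<bar> \<Longrightarrow> v s j \<le> \<kappa>"
  shows "(\<Sum>j\<in>{-N..N}. h * \<bar>r t (j + int k) - r t j\<bar>) + 4 * (\<Sum>i\<in>{-N..N + int k}. E t i)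
    \<le> (\<Sum>j\<in>{-N..N}. h * \<bar>r 0 (j + int k) - r 0 j\<bar>) + 4 * (\<Sum>i\<in>{-N..N + int k}. E 0 i)
      + t * (cb * \<kappa> + 16 * c1 * m / h)"
proof -
  let ?A = "{-N..N}" and ?W = "{-N..N + int k}"
  define y where "y s j = r s (j + int k) - r s j" for s j
  define \<Gamma> where "\<Gamma> s j = g s (j + int k) - g s j" for s j
  define S where "S = real (card ?A)"
  have \<Gamma>: "\<bar>\<Gamma> s j\<bar> \<le> L * \<bar>y s j\<bar>" "0 \<le> \<Gamma> s j * y s j" if s0: "0 \<le> s" for s j
  proof -
    show "\<bar>\<Gamma> s j\<bar> \<le> L * \<bar>y s j\<bar>"
      unfolding \<Gamma>_def y_def g_def by (rule flux_lipschitz) (simp_all add: r_nonneg r_le s0)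
    have mono: "g s i \<le> g s l" if "r s i \<le> r s l" for i l
      unfolding g_def using that r_nonneg[of s i] r_nonneg[of s l] r_le[OF s0, of l]
      by (intro mult_mono phi_mono) (simp_all add: phi_r_nonneg)
    show "0 \<le> \<Gamma> s j * y s j"
    proof (cases "r s j \<le> r s (j + int k)")
      case True
      from mono[OF this] True show ?thesis unfolding \<Gamma>_def y_def by (intro mult_nonneg_nonneg) simp_all
    next
      case False
      then have "r s (j + int k) \<le> r s j" by simp
      from mono[OF this] this show ?thesis unfolding \<Gamma>_def y_def by (intro mult_nonpos_nonpos) simp_all
    qed
  qed
  \<comment> \<open>Smoothing the absolute value makes it differentiable. The loss
    \<open>S * (L * \<eta>)\<close> grows with the window, but \<open>\<eta>\<close> will tend to 0
    while the window is fixed.\<close>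
  have balance: "(\<Sum>j\<in>?A. h * sqrt ((y t j)\<^sup>2 + \<eta>\<^sup>2)) + 4 * (\<Sum>i\<in>?W. E t i)
      \<le> (\<Sum>j\<in>?A. h * sqrt ((y 0 j)\<^sup>2 + \<eta>\<^sup>2)) + 4 * (\<Sum>i\<in>?W. E 0 i)
        + (cb * \<kappa> + 16 * c1 * m / h + S * (L * \<eta>)) * t" if \<eta>: "0 < \<eta>" for \<eta>
  proof (rule growth_le[OF t, of "\<lambda>s. (\<Sum>j\<in>?A. h * sqrt ((y s j)\<^sup>2 + \<eta>\<^sup>2)) + 4 * (\<Sum>i\<in>?W. E s i)"])
    show "continuous_on {0..t} (\<lambda>s. (\<Sum>j\<in>?A. h * sqrt ((y s j)\<^sup>2 + \<eta>\<^sup>2)) + 4 * (\<Sum>i\<in>?W. E s i))"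
      unfolding y_def
      by (intro continuous_intros continuous_on_subset[OF r_cont] continuous_on_subset[OF E_cont]) auto
    fix s assume s: "0 < s" "s < t"
    have s': "0 \<le> s" "s \<in> {0..t}" using s by auto
    have "\<forall>j. \<exists>q. ((\<lambda>s. r s j) has_real_derivative (- (g s j - g s (j - 1)) - q) / h) (at s) \<and>
        0 \<le> q \<and> q \<le> a s (j - 1) * (norm (d s j - d s (j - 1)))\<^sup>2 + 2 * c1 * (v s j + v s (j - 1))"
      by (rule allI, rule r_deriv[OF s(1)]) blast
    from choice[OF this] obtain q where q: "\<And>j. ((\<lambda>s. r s j) has_real_derivative (- (g s j - g s (j - 1)) - q j) / h) (at s)"
      "\<And>j. 0 \<le> q j" "\<And>j. q j \<le> a s (j - 1) * (norm (d s j - d s (j - 1)))\<^sup>2 + 2 * c1 * (v s j + v s (j - 1))"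
      by blast
    have "\<forall>j. \<exists>D. ((\<lambda>s. E s j) has_real_derivative D) (at s) \<and>
        D \<le> - (fl s j - fl s (j - 1)) - a s (j - 1) * (norm (d s j - d s (j - 1)))\<^sup>2 / 2 + 2 * c1 * v s (j - 1)"
      by (rule allI, rule E_deriv_le[OF s(1)]) blast
    from choice[OF this] obtain D where D: "\<And>j. ((\<lambda>s. E s j) has_real_derivative D j) (at s)"
      "\<And>j. D j \<le> - (fl s j - fl s (j - 1)) - a s (j - 1) * (norm (d s j - d s (j - 1)))\<^sup>2 / 2 + 2 * c1 * v s (j - 1)"
      by blast
    define Q where "Q j = q j - q (j + int k)" for j
    define Y where "Y j = (- (\<Gamma> s j - \<Gamma> s (j - 1)) + Q j) / h" for j
    have y': "((\<lambda>s. y s j) has_real_derivative Y j) (at s)" for j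
      unfolding y_def using DERIV_diff[OF q(1)[of "j + int k"] q(1)[of j]]
      by (rule DERIV_cong) (simp add: Y_def \<Gamma>_def Q_def diff_divide_distrib[symmetric] algebra_simps)
    have abs': "((\<lambda>s. h * sqrt ((y s j)\<^sup>2 + \<eta>\<^sup>2)) has_real_derivative
        y s j / sqrt ((y s j)\<^sup>2 + \<eta>\<^sup>2) * (- (\<Gamma> s j - \<Gamma> s (j - 1)) + Q j)) (at s)" for j
    proof -
      have hY: "h * Y j = - (\<Gamma> s j - \<Gamma> s (j - 1)) + Q j" using h_pos by (simp add: Y_def)
      have pos: "0 < (y s j)\<^sup>2 + \<eta>\<^sup>2" using \<eta> by (simp add: add_nonneg_pos)
      have "((\<lambda>s. (y s j)\<^sup>2 + \<eta>\<^sup>2) has_real_derivative 2 * y s j * Y j) (at s)"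
        by (auto intro!: derivative_eq_intros y')
      from DERIV_cmult[OF DERIV_chain2[OF DERIV_real_sqrt[OF pos] this], of h]
      moreover have "h * (inverse p / 2 * (2 * y s j * Y j)) = y s j / p * (h * Y j)" if "0 < p" for p
        using that by (simp add: field_simps)
      ultimately show ?thesis unfolding hY[symmetric] using pos by (metis real_sqrt_gt_zero)
    qed
    have absle: "y s j / sqrt ((y s j)\<^sup>2 + \<eta>\<^sup>2) * (- (\<Gamma> s j - \<Gamma> s (j - 1)) + Q j)
        \<le> - (\<bar>\<Gamma> s j\<bar> - \<bar>\<Gamma> s (j - 1)\<bar>) + L * \<eta> + (q j + q (j + int k))" for j
      using smooth_abs_dissipation[OF \<Gamma>[OF s'(1)] \<eta> L_nonneg, of j "\<Gamma> s (j - 1)" "Q j"] q(2)[of j] q(2)[of "j + int k"]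
      unfolding Q_def by linarith
    define R where "R = (\<Sum>j\<in>?A. y s j / sqrt ((y s j)\<^sup>2 + \<eta>\<^sup>2) * (- (\<Gamma> s j - \<Gamma> s (j - 1)) + Q j)) + 4 * (\<Sum>i\<in>?W. D i)"
    have deriv: "((\<lambda>s. (\<Sum>j\<in>?A. h * sqrt ((y s j)\<^sup>2 + \<eta>\<^sup>2)) + 4 * (\<Sum>i\<in>?W. E s i)) has_real_derivative R) (at s)"
      unfolding R_def by (intro DERIV_add DERIV_sum DERIV_cmult abs' D)
    have vk: "v s j \<le> \<kappa>" if "N - int k \<le> \<bar>j\<bar>" for j using small[OF s'(2) that] .
    have "(\<Sum>j\<in>?A. y s j / sqrt ((y s j)\<^sup>2 + \<eta>\<^sup>2) * (- (\<Gamma> s j - \<Gamma> s (j - 1)) + Q j))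
        \<le> (\<Sum>j\<in>?A. - (\<bar>\<Gamma> s j\<bar> - \<bar>\<Gamma> s (j - 1)\<bar>) + L * \<eta> + (q j + q (j + int k)))"
      by (intro sum_mono absle)
    also have "\<dots> = - (\<Sum>j\<in>?A. \<bar>\<Gamma> s j\<bar> - \<bar>\<Gamma> s (j - 1)\<bar>) + S * (L * \<eta>) + ((\<Sum>j\<in>?A. q j) + (\<Sum>j\<in>?A. q (j + int k)))"
      unfolding S_def by (simp only: sum.distrib sum_negf sum_constant)
    \<comment> \<open>After telescoping, the term at the right end has a favourable sign and is
      dropped; the one at the left end is estimated in \<open>7\<close>.\<close>
    also have "(\<Sum>j\<in>?A. \<bar>\<Gamma> s j\<bar> - \<bar>\<Gamma> s (j - 1)\<bar>) = \<bar>\<Gamma> s N\<bar> - \<bar>\<Gamma> s (- N - 1)\<bar>"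
      using N by (intro sum_int_telescope) auto
    finally have 1: "(\<Sum>j\<in>?A. y s j / sqrt ((y s j)\<^sup>2 + \<eta>\<^sup>2) * (- (\<Gamma> s j - \<Gamma> s (j - 1)) + Q j))
        \<le> \<bar>\<Gamma> s (- N - 1)\<bar> + S * (L * \<eta>) + ((\<Sum>j\<in>?A. q j) + (\<Sum>j\<in>?A. q (j + int k)))" by linarith
    have 2: "(\<Sum>j\<in>?A. q j) \<le> (\<Sum>i\<in>?W. q i)" using q(2) by (intro sum_mono2) auto
    have 3: "(\<Sum>j\<in>?A. q (j + int k)) \<le> (\<Sum>i\<in>?W. q i)" by (rule sum_int_shift_le[OF q(2)])
    \<comment> \<open>The dissipation cancels exactly. Of \<open>c1\<close> there remain 4 at
      \<open>v s i\<close> from \<open>q\<close>, and 4 from \<open>q\<close> plus 8 from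
      \<open>D\<close> at \<open>v s (i - 1)\<close>: 16 in all.\<close>
    have "2 * q i + 4 * D i \<le> - 4 * (fl s i - fl s (i - 1)) + c1 * 4 * v s i + c1 * 12 * v s (i - 1)" for i
      using q(3)[of i] D(2)[of i] by (simp add: distrib_left)
    then have "(\<Sum>i\<in>?W. 2 * q i + 4 * D i)
        \<le> (\<Sum>i\<in>?W. - 4 * (fl s i - fl s (i - 1)) + c1 * 4 * v s i + c1 * 12 * v s (i - 1))"
      by (intro sum_mono)
    also have "\<dots> = - 4 * (\<Sum>i\<in>?W. fl s i - fl s (i - 1)) + c1 * 4 * (\<Sum>i\<in>?W. v s i) + c1 * 12 * (\<Sum>i\<in>?W. v s (i - 1))"
      by (simp only: sum.distrib sum_distrib_left)
    also have "(\<Sum>i\<in>?W. fl s i - fl s (i - 1)) = fl s (N + int k) - fl s (- N - 1)"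
      using N by (intro sum_int_telescope) auto
    finally have 4: "2 * (\<Sum>i\<in>?W. q i) + 4 * (\<Sum>i\<in>?W. D i) \<le> - 4 * (fl s (N + int k) - fl s (- N - 1))
        + c1 * 4 * (\<Sum>i\<in>?W. v s i) + c1 * 12 * (\<Sum>i\<in>?W. v s (i - 1))"
      by (simp only: sum.distrib sum_distrib_left)
    have 5: "c1 * 4 * (\<Sum>i\<in>?W. v s i) \<le> c1 * 4 * (m / h)" "c1 * 12 * (\<Sum>i\<in>?W. v s (i - 1)) \<le> c1 * 12 * (m / h)"
      by (rule mult_left_mono[OF sum_v_le[OF s'(1)]], simp add: c1_nonneg)
        (rule mult_left_mono[OF sum_v_pred_le[OF s'(1)]], simp add: c1_nonneg)
    have flb: "\<bar>fl s i\<bar> \<le> cf * \<kappa>" if "N - int k \<le> \<bar>i\<bar>" for i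
      using fl_bound[OF s'(1), of i] mult_left_mono[OF vk[OF that] cf_nonneg] by linarith
    have 6: "- 4 * (fl s (N + int k) - fl s (- N - 1)) \<le> 8 * cf * \<kappa>"
      using flb[of "N + int k"] flb[of "- N - 1"] N by (simp add: abs_le_iff)
    have rb: "r s i \<le> \<kappa> / \<delta>" if "N - int k \<le> \<bar>i\<bar>" for i
      using r_le_v[OF s'(1), of i] divide_right_mono[OF vk[OF that], of \<delta>] delta_pos by simp
    \<comment> \<open>The translate of the left boundary site is \<open>- N - 1 + int k\<close>;
      therefore smallness is assumed from \<open>N - int k\<close> on.\<close>
    have "\<bar>y s (- N - 1)\<bar> \<le> 2 * \<kappa> / \<delta>"
      unfolding y_def using rb[of "- N - 1"] rb[of "- N - 1 + int k"] r_nonneg[of s "- N - 1"] r_nonneg[of s "- N - 1 + int k"] N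
      by simp
    have "L * (2 * \<kappa> / \<delta>) = 2 * L / \<delta> * \<kappa>" by simp
    with mult_left_mono[OF \<open>\<bar>y s (- N - 1)\<bar> \<le> 2 * \<kappa> / \<delta>\<close> L_nonneg]
    have 7: "\<bar>\<Gamma> s (- N - 1)\<bar> \<le> 2 * L / \<delta> * \<kappa>"
      using \<Gamma>(1)[OF s'(1), of "- N - 1"] by linarith
    have "R \<le> cb * \<kappa> + 16 * c1 * m / h + S * (L * \<eta>)"
    proof -
      have "cb * \<kappa> = 2 * L / \<delta> * \<kappa> + 8 * cf * \<kappa>" by (simp add: cb_def distrib_right)
      moreover have "16 * c1 * m / h = c1 * 4 * (m / h) + c1 * 12 * (m / h)" by simp
      ultimately show ?thesis unfolding R_def using 1 2 3 4 5 6 7 by linarith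
    qed
    then show "\<exists>D. ((\<lambda>s. (\<Sum>j\<in>?A. h * sqrt ((y s j)\<^sup>2 + \<eta>\<^sup>2)) + 4 * (\<Sum>i\<in>?W. E s i)) has_real_derivative D) (at s)
        \<and> D \<le> cb * \<kappa> + 16 * c1 * m / h + S * (L * \<eta>)" using deriv by blast
  qed
  have "(\<Sum>j\<in>?A. h * \<bar>y t j\<bar>) + 4 * (\<Sum>i\<in>?W. E t i)
    \<le> ((\<Sum>j\<in>?A. h * \<bar>y 0 j\<bar>) + 4 * (\<Sum>i\<in>?W. E 0 i) + t * (cb * \<kappa> + 16 * c1 * m / h))"
  proof (rule le_of_le_add_mult)
    show "0 \<le> S * h + S * L * t" using h_pos L_nonneg t by (auto simp: S_def)
    fix \<eta> :: real assume \<eta>: "0 < \<eta>"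
    have "(\<Sum>j\<in>?A. h * \<bar>y t j\<bar>) \<le> (\<Sum>j\<in>?A. h * sqrt ((y t j)\<^sup>2 + \<eta>\<^sup>2))"
      using h_pos by (intro sum_mono mult_left_mono real_le_rsqrt) simp_all
    moreover have "(\<Sum>j\<in>?A. h * sqrt ((y 0 j)\<^sup>2 + \<eta>\<^sup>2)) \<le> (\<Sum>j\<in>?A. h * \<bar>y 0 j\<bar> + h * \<eta>)"
      using h_pos \<eta> unfolding distrib_left[symmetric]
      by (intro sum_mono mult_left_mono order_trans[OF sqrt_sum_squares_le_sum_abs]) auto
    moreover have "(\<Sum>j\<in>?A. h * \<bar>y 0 j\<bar> + h * \<eta>) = (\<Sum>j\<in>?A. h * \<bar>y 0 j\<bar>) + S * (h * \<eta>)"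
      unfolding S_def by (simp only: sum.distrib sum_constant)
    ultimately have calc: "(\<Sum>j\<in>?A. h * \<bar>y t j\<bar>) \<le> (\<Sum>j\<in>?A. h * sqrt ((y t j)\<^sup>2 + \<eta>\<^sup>2))"
      "(\<Sum>j\<in>?A. h * sqrt ((y 0 j)\<^sup>2 + \<eta>\<^sup>2)) \<le> (\<Sum>j\<in>?A. h * \<bar>y 0 j\<bar>) + S * (h * \<eta>)" by simp_all
    show "(\<Sum>j\<in>?A. h * \<bar>y t j\<bar>) + 4 * (\<Sum>i\<in>?W. E t i)
       \<le> (\<Sum>j\<in>?A. h * \<bar>y 0 j\<bar>) + 4 * (\<Sum>i\<in>?W. E 0 i) + t * (cb * \<kappa> + 16 * c1 * m / h) + \<eta> * (S * h + S * L * t)"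
    proof -
      have "(cb * \<kappa> + 16 * c1 * m / h + S * (L * \<eta>)) * t = t * (cb * \<kappa> + 16 * c1 * m / h) + \<eta> * (S * L * t)"
        "\<eta> * (S * h + S * L * t) = S * (h * \<eta>) + \<eta> * (S * L * t)" by algebra+
      then show ?thesis using calc balance[OF \<eta>] by linarith
    qed
  qed
  then show ?thesis by (simp add: y_def)
qed

end

subsection \<open>Lipschitz profiles\<close>

text \<open>Written with positive parts so that its antiderivative \<open>ramp_int\<close> has a
  closed form, differentiable everywhere and zero on the negative half-line.\<close>

definition ramp :: "real \<Rightarrow> real" where "ramp x = max 0 x - max 0 (x - 1)"
definition ramp_int :: "real \<Rightarrow> real" where "ramp_int x = (max 0 x)\<^sup>2 / 2 - (max 0 (x - 1))\<^sup>2 / 2"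

lemma has_real_derivative_pos_part_square:
  "((\<lambda>x. (max 0 x)\<^sup>2 / 2) has_real_derivative max 0 x) (at (x::real))"
proof -
  consider "x < 0" | "x > 0" | "x = 0" by linarith
  then show ?thesis
  proof cases
    case 1
    have "((\<lambda>x. 0::real) has_real_derivative 0) (at x)" by (rule DERIV_const)
    then have "((\<lambda>x. (max 0 x)\<^sup>2 / 2) has_real_derivative 0) (at x)"
      by (rule has_field_derivative_transform_within_open[where S = "{..<0}"]) (use 1 in auto)
    then show ?thesis using 1 by simp
  next
    case 2
    have "((\<lambda>x. x\<^sup>2 / 2) has_real_derivative x) (at x)" by (auto intro!: derivative_eq_intros)
    then have "((\<lambda>x. (max 0 x)\<^sup>2 / 2) has_real_derivative x) (at x)"
      by (rule has_field_derivative_transform_within_open[where S = "{0<..}"]) (use 2 in auto)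
    then show ?thesis using 2 by simp
  next
    case 3
    have "((\<lambda>h. (max 0 h)\<^sup>2 / 2 / h) \<longlongrightarrow> 0) (at (0::real))"
    proof (rule Lim_null_comparison)
      show "\<forall>\<^sub>F h in at (0::real). norm ((max 0 h)\<^sup>2 / 2 / h) \<le> \<bar>h\<bar>"
        by (intro always_eventually allI) (auto simp: max_def power2_eq_square abs_mult)
      show "((\<lambda>h::real. \<bar>h\<bar>) \<longlongrightarrow> 0) (at 0)" by (intro tendsto_rabs_zero tendsto_ident_at)
    qed
    then show ?thesis using 3 by (simp add: has_field_derivative_iff)
  qed
qed

lemma has_real_derivative_ramp_int: "(ramp_int has_real_derivative ramp x) (at x)"
proof -
  have "((\<lambda>x. (max 0 (x - 1))\<^sup>2 / 2) has_real_derivative max 0 (x - 1) * 1) (at x)"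
    by (rule DERIV_chain2[OF has_real_derivative_pos_part_square]) (auto intro!: derivative_eq_intros)
  from DERIV_diff[OF has_real_derivative_pos_part_square this]
  show ?thesis unfolding ramp_def ramp_int_def by simp
qed

lemma ramp_nonneg: "0 \<le> ramp x" and ramp_le_1: "ramp x \<le> 1" and ramp_lipschitz: "\<bar>ramp x - ramp y\<bar> \<le> \<bar>x - y\<bar>"
  by (auto simp: ramp_def max_def)

lemma ramp_int_increment:
  assumes "x \<le> y"
  shows "ramp_int x \<le> ramp_int y" "ramp_int y - ramp_int x \<le> y - x"
proof -
  show "ramp_int x \<le> ramp_int y"
    by (rule DERIV_nonneg_imp_nondecreasing[OF assms]) (use has_real_derivative_ramp_int ramp_nonneg in blast)
  have "y - ramp_int y \<ge> x - ramp_int x"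
  proof (rule DERIV_nonneg_imp_nondecreasing[OF assms])
    fix s
    have "((\<lambda>s. s - ramp_int s) has_real_derivative 1 - ramp s) (at s)"
      by (intro DERIV_diff DERIV_ident has_real_derivative_ramp_int)
    then show "\<exists>D. ((\<lambda>s. s - ramp_int s) has_real_derivative D) (at s) \<and> 0 \<le> D"
      using ramp_le_1[of s] by (intro exI[of _ "1 - ramp s"]) auto
  qed
  then show "ramp_int y - ramp_int x \<le> y - x" by simp
qed

lemma ramp_int_nonpos: "x \<le> 0 \<Longrightarrow> ramp_int x = 0"
  by (simp add: ramp_int_def max_def)

text \<open>For positive \<open>x\<close> this is the area between the unit step and the ramp up to
  \<open>x\<close>, at most the length of the ramp.\<close>

lemma ramp_int_defect_le: "x - ramp_int x \<le> 1"
proof (cases "1 \<le> x")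
  case True
  then show ?thesis by (simp add: ramp_int_def max_def power2_eq_square field_simps)
next
  case False
  have "0 \<le> ramp_int x" using ramp_int_increment(1)[of "min 0 x" x] ramp_int_nonpos[of "min 0 x"] by simp
  then show ?thesis using False by simp
qed

text \<open>The jumps of a step function of the cumulated mass are spread over intervals of length \<open>\<epsilon>\<close>.\<close>

lemma lipschitz_profile:
  fixes \<tau> :: "int \<Rightarrow> 'a::real_normed_vector" and \<mu> :: "int \<Rightarrow> real"
  assumes ab: "a \<le> b" and mono: "\<And>j. \<mu> (j - 1) \<le> \<mu> j"
    and TV: "(\<Sum>i\<in>{a + 1..b}. norm (\<tau> i - \<tau> (i - 1))) \<le> V"
    and bound: "norm (\<tau> a) \<le> c" and \<epsilon>: "0 < \<epsilon>"
  obtains F G where "\<And>x. (G has_vector_derivative F x) (at x)"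
    "\<And>x y. norm (F x - F y) \<le> V / \<epsilon> * \<bar>x - y\<bar>" "\<And>x. norm (F x) \<le> c + V"
    "\<And>j. j \<in> {a..b} \<Longrightarrow> norm ((\<mu> j - \<mu> (j - 1)) *\<^sub>R \<tau> j - (G (\<mu> j) - G (\<mu> (j - 1)))) \<le> V * (\<mu> j - \<mu> (j - 1))"
    "(\<Sum>j\<in>{a..b}. norm ((\<mu> j - \<mu> (j - 1)) *\<^sub>R \<tau> j - (G (\<mu> j) - G (\<mu> (j - 1))))) \<le> V * \<epsilon>"
proof -
  let ?I = "{a + 1..b}"
  define \<Delta> where "\<Delta> i = \<tau> i - \<tau> (i - 1)" for i
  \<comment> \<open>Jump \<open>i\<close> sits at \<open>\<mu> (i - 1)\<close>, the left end of cell
    \<open>i\<close>; its ramp starts there and takes up the mass \<epsilon> to the right.\<close>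
  define X where "X i x = (x - \<mu> (i - 1)) / \<epsilon>" for i x
  define F where "F x = \<tau> a + (\<Sum>i\<in>?I. ramp (X i x) *\<^sub>R \<Delta> i)" for x
  define G where "G x = x *\<^sub>R \<tau> a + (\<Sum>i\<in>?I. (\<epsilon> * ramp_int (X i x)) *\<^sub>R \<Delta> i)" for x
  have TV': "(\<Sum>i\<in>?I. norm (\<Delta> i)) \<le> V" using TV by (simp add: \<Delta>_def)
  have muge: "\<mu> i \<le> \<mu> j" if "i \<le> j" for i j
  proof -
    have "\<mu> i \<le> \<mu> (i + int n)" for n
      by (induction n) (use mono[of "i + int (Suc n)" for n] in \<open>force simp: algebra_simps intro: order_trans\<close>)+
    from this[of "nat (j - i)"] that show ?thesis by simp
  qed
  have G': "(G has_vector_derivative F x) (at x)" for x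
  proof -
    have "((\<lambda>x. \<epsilon> * ramp_int (X i x)) has_real_derivative \<epsilon> * (ramp (X i x) * (1 / \<epsilon>))) (at x)" for i
      unfolding X_def using \<epsilon>
      by (intro DERIV_cmult DERIV_chain2[OF has_real_derivative_ramp_int]) (auto intro!: derivative_eq_intros)
    then have "((\<lambda>x. \<epsilon> * ramp_int (X i x)) has_real_derivative ramp (X i x)) (at x)" for i
      using \<epsilon> by simp
    from has_vector_derivative_scaleR[OF this has_vector_derivative_const]
    have 1: "((\<lambda>x. (\<epsilon> * ramp_int (X i x)) *\<^sub>R \<Delta> i) has_vector_derivative ramp (X i x) *\<^sub>R \<Delta> i) (at x)" for i
      by simp
    have 2: "((\<lambda>x. x *\<^sub>R \<tau> a) has_vector_derivative \<tau> a) (at x)"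
      using has_vector_derivative_scaleR[OF DERIV_ident has_vector_derivative_const[of "\<tau> a"]] by simp
    show ?thesis unfolding G_def F_def
      by (intro has_vector_derivative_add 2 has_vector_derivative_sum 1)
  qed
  have Flip: "norm (F x - F y) \<le> V / \<epsilon> * \<bar>x - y\<bar>" for x y
  proof -
    have "F x - F y = (\<Sum>i\<in>?I. (ramp (X i x) - ramp (X i y)) *\<^sub>R \<Delta> i)"
      by (simp add: F_def sum_subtractf scaleR_diff_left)
    also have "norm \<dots> \<le> (\<Sum>i\<in>?I. \<bar>x - y\<bar> / \<epsilon> * norm (\<Delta> i))"
    proof (rule sum_norm_le)
      fix i
      have "\<bar>ramp (X i x) - ramp (X i y)\<bar> \<le> \<bar>X i x - X i y\<bar>" by (rule ramp_lipschitz)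
      also have "X i x - X i y = (x - y) / \<epsilon>" by (simp add: X_def diff_divide_distrib)
      also have "\<bar>(x - y) / \<epsilon>\<bar> = \<bar>x - y\<bar> / \<epsilon>" using \<epsilon> by (simp add: abs_divide)
      finally have "\<bar>ramp (X i x) - ramp (X i y)\<bar> \<le> \<bar>x - y\<bar> / \<epsilon>" .
      from mult_right_mono[OF this norm_ge_zero[of "\<Delta> i"]]
      show "norm ((ramp (X i x) - ramp (X i y)) *\<^sub>R \<Delta> i) \<le> \<bar>x - y\<bar> / \<epsilon> * norm (\<Delta> i)"
        unfolding norm_scaleR real_norm_def .
    qed
    also have "\<dots> = \<bar>x - y\<bar> / \<epsilon> * (\<Sum>i\<in>?I. norm (\<Delta> i))" by (rule sum_distrib_left[symmetric])
    also have "\<dots> \<le> \<bar>x - y\<bar> / \<epsilon> * V" using \<epsilon> TV' by (intro mult_left_mono) auto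
    finally show ?thesis by (simp add: mult.commute)
  qed
  have Fb: "norm (F x) \<le> c + V" for x
  proof -
    have "norm (\<Sum>i\<in>?I. ramp (X i x) *\<^sub>R \<Delta> i) \<le> (\<Sum>i\<in>?I. norm (\<Delta> i))"
      by (rule sum_norm_le) (use ramp_nonneg ramp_le_1 in \<open>auto intro!: mult_left_le_one_le\<close>)
    then show ?thesis unfolding F_def
      using bound TV' norm_triangle_ineq[of "\<tau> a" "\<Sum>i\<in>?I. ramp (X i x) *\<^sub>R \<Delta> i"] by linarith
  qed
  \<comment> \<open>The integral over cell \<open>j\<close> of the part of jump \<open>i\<close>
    that its ramp has not yet made up. It is nonnegative and at most the mass of the cell, which
    gives the bound for a single cell; summed over \<open>j\<close> it is at most \<epsilon>, which
    gives the total bound.\<close>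
  define C where "C i j = (if i \<le> j then \<mu> j - \<mu> (j - 1) else 0) - \<epsilon> * (ramp_int (X i (\<mu> j)) - ramp_int (X i (\<mu> (j - 1))))" for i j
  have err: "(\<mu> j - \<mu> (j - 1)) *\<^sub>R \<tau> j - (G (\<mu> j) - G (\<mu> (j - 1))) = (\<Sum>i\<in>?I. C i j *\<^sub>R \<Delta> i)"
    if j: "j \<in> {a..b}" for j
  proof -
    have "(\<Sum>i\<in>?I. (if i \<le> j then 1 else 0) *\<^sub>R \<Delta> i) = (\<Sum>i\<in>{a + 1..j}. \<Delta> i)"
      using j by (intro sum.mono_neutral_cong_right) auto
    also have "\<dots> = \<tau> j - \<tau> a" unfolding \<Delta>_def using j by (subst sum_int_telescope) auto
    finally have tau: "\<tau> j = \<tau> a + (\<Sum>i\<in>?I. (if i \<le> j then 1 else 0) *\<^sub>R \<Delta> i)" by simp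
    have "C i j *\<^sub>R \<Delta> i = (\<mu> j - \<mu> (j - 1)) *\<^sub>R ((if i \<le> j then 1 else 0) *\<^sub>R \<Delta> i)
        - ((\<epsilon> * ramp_int (X i (\<mu> j))) *\<^sub>R \<Delta> i - (\<epsilon> * ramp_int (X i (\<mu> (j - 1)))) *\<^sub>R \<Delta> i)" for i
      by (simp add: C_def algebra_simps)
    then have "(\<Sum>i\<in>?I. C i j *\<^sub>R \<Delta> i) = (\<mu> j - \<mu> (j - 1)) *\<^sub>R (\<Sum>i\<in>?I. (if i \<le> j then 1 else 0) *\<^sub>R \<Delta> i)
        - ((\<Sum>i\<in>?I. (\<epsilon> * ramp_int (X i (\<mu> j))) *\<^sub>R \<Delta> i) - (\<Sum>i\<in>?I. (\<epsilon> * ramp_int (X i (\<mu> (j - 1)))) *\<^sub>R \<Delta> i))"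
      by (simp only: sum_subtractf scaleR_sum_right)
    then show ?thesis unfolding G_def by (subst tau) (simp add: algebra_simps)
  qed
  have Cpos: "0 \<le> C i j" and Cle: "C i j \<le> \<mu> j - \<mu> (j - 1)"
    and Ceq: "C i j = (if i \<le> j then \<epsilon> * (X i (\<mu> j) - ramp_int (X i (\<mu> j))) - \<epsilon> * (X i (\<mu> (j - 1)) - ramp_int (X i (\<mu> (j - 1)))) else 0)" for i j
  proof -
    have Xm: "X i (\<mu> (j - 1)) \<le> X i (\<mu> j)" unfolding X_def using mono[of j] \<epsilon> by (intro divide_right_mono) auto
    have Xd: "\<epsilon> * (X i (\<mu> j) - X i (\<mu> (j - 1))) = \<mu> j - \<mu> (j - 1)" using \<epsilon> by (simp add: X_def field_simps)
    have z: "C i j = 0" if "\<not> i \<le> j"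
    proof -
      have "X i (\<mu> j) \<le> 0" "X i (\<mu> (j - 1)) \<le> 0"
        using muge[of j "i - 1"] muge[of "j - 1" "i - 1"] that \<epsilon> by (auto simp: X_def divide_le_0_iff)
      then show ?thesis using that by (simp add: C_def ramp_int_nonpos)
    qed
    have e: "C i j = \<epsilon> * ((X i (\<mu> j) - X i (\<mu> (j - 1))) - (ramp_int (X i (\<mu> j)) - ramp_int (X i (\<mu> (j - 1)))))" if "i \<le> j"
      using that Xd by (simp add: C_def right_diff_distrib)
    show "0 \<le> C i j"
      using z e ramp_int_increment(2)[OF Xm] \<epsilon> by (cases "i \<le> j") auto
    have "C i j \<le> \<epsilon> * (X i (\<mu> j) - X i (\<mu> (j - 1)))" if "i \<le> j"
      unfolding e[OF that] using ramp_int_increment(1)[OF Xm] \<epsilon> by (intro mult_left_mono) auto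
    then show "C i j \<le> \<mu> j - \<mu> (j - 1)" using z mono[of j] Xd by (cases "i \<le> j") auto
    show "C i j = (if i \<le> j then \<epsilon> * (X i (\<mu> j) - ramp_int (X i (\<mu> j))) - \<epsilon> * (X i (\<mu> (j - 1)) - ramp_int (X i (\<mu> (j - 1)))) else 0)"
      using z e by (cases "i \<le> j") (auto simp: algebra_simps)
  qed
  have Csum: "(\<Sum>j\<in>{a..b}. C i j) \<le> \<epsilon>" if i: "i \<in> ?I" for i
  proof -
    \<comment> \<open>An antiderivative of the missing part of the jump, evaluated at the cell ends,
      so that the sum over \<open>j\<close> telescopes.\<close>
    define q where "q j = \<epsilon> * (X i (\<mu> j) - ramp_int (X i (\<mu> j)))" for j
    have "(\<Sum>j\<in>{a..b}. C i j) = (\<Sum>j\<in>{i..b}. q j - q (j - 1))"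
      using i unfolding Ceq q_def by (intro sum.mono_neutral_cong_right) auto
    also have "\<dots> = q b - q (i - 1)" using i by (intro sum_int_telescope) auto
    also have "q (i - 1) = 0" by (simp add: q_def X_def ramp_int_nonpos)
    also have "q b \<le> \<epsilon> * 1" unfolding q_def using \<epsilon> by (intro mult_left_mono ramp_int_defect_le) auto
    finally show ?thesis by simp
  qed
  have normerr: "norm (\<Sum>i\<in>?I. C i j *\<^sub>R \<Delta> i) \<le> (\<Sum>i\<in>?I. C i j * norm (\<Delta> i))" for j
    by (rule sum_norm_le) (simp add: Cpos)
  show thesis
  proof (rule that[OF G' Flip Fb])
    fix j assume j: "j \<in> {a..b}"
    have "(\<Sum>i\<in>?I. C i j * norm (\<Delta> i)) \<le> (\<Sum>i\<in>?I. (\<mu> j - \<mu> (j - 1)) * norm (\<Delta> i))"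
      by (intro sum_mono mult_right_mono Cle) auto
    also have "\<dots> \<le> (\<mu> j - \<mu> (j - 1)) * V"
      unfolding sum_distrib_left[symmetric] using mono[of j] TV' by (intro mult_left_mono) auto
    finally show "norm ((\<mu> j - \<mu> (j - 1)) *\<^sub>R \<tau> j - (G (\<mu> j) - G (\<mu> (j - 1)))) \<le> V * (\<mu> j - \<mu> (j - 1))"
      unfolding err[OF j] using normerr[of j] by (simp add: mult.commute)
  next
    have "(\<Sum>j\<in>{a..b}. norm ((\<mu> j - \<mu> (j - 1)) *\<^sub>R \<tau> j - (G (\<mu> j) - G (\<mu> (j - 1)))))
        \<le> (\<Sum>j\<in>{a..b}. \<Sum>i\<in>?I. C i j * norm (\<Delta> i))"
      by (rule sum_mono) (simp only: err normerr)
    also have "\<dots> = (\<Sum>i\<in>?I. \<Sum>j\<in>{a..b}. C i j * norm (\<Delta> i))" by (rule sum.swap)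
    also have "\<dots> \<le> (\<Sum>i\<in>?I. \<epsilon> * norm (\<Delta> i))"
      unfolding sum_distrib_right[symmetric] by (intro sum_mono mult_right_mono Csum) auto
    also have "\<dots> \<le> \<epsilon> * V" unfolding sum_distrib_left[symmetric] using TV' \<epsilon> by (intro mult_left_mono) auto
    finally show "(\<Sum>j\<in>{a..b}. norm ((\<mu> j - \<mu> (j - 1)) *\<^sub>R \<tau> j - (G (\<mu> j) - G (\<mu> (j - 1))))) \<le> V * \<epsilon>"
      by (simp add: mult.commute)
  qed
qed

section \<open>Translation estimates uniform in time\<close>

context profile_scheme
begin

text \<open>The difference of two vectors splits into lengths and directions. The directions are
  weighted with the smaller length, which is at most \<open>v / \<delta>\<close> at either site, so
  each deviation meets the density of its own cell and Young's inequality with weight \<kappa>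
  produces energies. The rest of the change of direction is that of the profile over
  \<open>k\<close> cells, at most \<open>\<Lambda> * k * h * M\<close>, and an error of
  \<open>\<Lambda> * h * M\<close> for each of the two means.\<close>

lemma u_translation_le:
  fixes N :: int and k :: nat
  assumes t: "0 \<le> t" and \<kappa>: "0 < \<kappa>"
  shows "(\<Sum>j\<in>{-N..N}. h * norm (u t (j + int k) - u t j))
    \<le> (\<Sum>j\<in>{-N..N}. h * \<bar>r t (j + int k) - r t j\<bar>)
      + (\<kappa> * m + (\<Sum>i\<in>{-N..N + int k}. E t i) / \<kappa>) / \<delta> + \<Lambda> * h * M * (real k + 2) * m / \<delta>"
proof -
  let ?A = "{-N..N}" and ?W = "{-N..N + int k}"
  define K where "K = \<Lambda> * h * M * (real k + 2)"
  have K: "0 \<le> K" using Lambda_nonneg h_pos M_nonneg by (simp add: K_def)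
  define Z where "Z i = (\<kappa> * (h * v t i) + E t i / \<kappa>) / 2" for i
  have Z0: "0 \<le> Z i" for i
    unfolding Z_def using \<kappa> h_pos v_nonneg[OF t, of i] E_nonneg[OF t, of i] by simp
  have vd: "h * (v t i * norm (d t i)) \<le> Z i" for i
  proof -
    have "norm (d t i) \<le> (\<kappa> + (norm (d t i))\<^sup>2 / \<kappa>) / 2"
      using zero_le_power2[of "\<kappa> - norm (d t i)"] \<kappa> unfolding power2_diff by (simp add: field_simps power2_eq_square)
    from mult_left_mono[OF this, of "h * v t i"]
    have "h * v t i * norm (d t i) \<le> h * v t i * ((\<kappa> + (norm (d t i))\<^sup>2 / \<kappa>) / 2)"
      using h_pos v_nonneg[OF t, of i] by simp
    also have "\<dots> = Z i" unfolding Z_def E_def by (simp add: distrib_left mult_ac)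
    finally show ?thesis by (simp add: mult_ac)
  qed
  have step: "h * norm (u t (j + int k) - u t j)
      \<le> h * \<bar>r t (j + int k) - r t j\<bar> + (Z (j + int k) + Z j) / \<delta> + K / \<delta> * (h * v t j)" for j
  proof -
    define i where "i = j + int k"
    have rhs: "0 \<le> (Z i + Z j) / \<delta> + K / \<delta> * (h * v t j)"
      using Z0 K delta_pos h_pos v_nonneg[OF t, of j] by (intro add_nonneg_nonneg divide_nonneg_pos mult_nonneg_nonneg) auto
    show ?thesis
    proof (cases "u t i = 0 \<or> u t j = 0")
      case True
      then have "norm (u t i - u t j) = \<bar>r t i - r t j\<bar>" by (auto simp: r_def)
      then show ?thesis using rhs unfolding i_def by simp
    next
      case False
      then have vi: "0 < v t i" and vj: "0 < v t j"
        using u_eq_0_iff[OF t, of i] u_eq_0_iff[OF t, of j] v_pos_or_zero[OF t, of i] v_pos_or_zero[OF t, of j] by auto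
      define x where "x = u t i /\<^sub>R v t i"
      define y where "y = u t j /\<^sub>R v t j"
      have sx: "u t i = r t i *\<^sub>R sgn x" and sy: "u t j = r t j *\<^sub>R sgn y"
      proof -
        have "norm w *\<^sub>R sgn w = w" for w :: 'a by (cases "w = 0") (simp_all add: sgn_div_norm)
        then show "u t i = r t i *\<^sub>R sgn x" "u t j = r t j *\<^sub>R sgn y"
          using vi vj by (simp_all add: x_def y_def r_def sgn_scaleR)
      qed
      have "u t i - u t j = (r t i - r t j) *\<^sub>R sgn x + r t j *\<^sub>R (sgn x - sgn y)"
        unfolding sx sy by (simp add: algebra_simps)
      then have 1: "norm (u t i - u t j) \<le> \<bar>r t i - r t j\<bar> * norm (sgn x) + r t j * norm (sgn x - sgn y)"
        using norm_triangle_ineq[of "(r t i - r t j) *\<^sub>R sgn x" "r t j *\<^sub>R (sgn x - sgn y)"] r_nonneg[of t j] by simp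
      have "u t i - u t j = (r t i - r t j) *\<^sub>R sgn y + r t i *\<^sub>R (sgn x - sgn y)"
        unfolding sx sy by (simp add: algebra_simps)
      then have 2: "norm (u t i - u t j) \<le> \<bar>r t i - r t j\<bar> * norm (sgn y) + r t i * norm (sgn x - sgn y)"
        using norm_triangle_ineq[of "(r t i - r t j) *\<^sub>R sgn y" "r t i *\<^sub>R (sgn x - sgn y)"] r_nonneg[of t i] by simp
      have ns: "norm (sgn x) \<le> 1" "norm (sgn y) \<le> 1" by (simp_all add: norm_sgn)
      define \<rho> where "\<rho> = min (r t i) (r t j)"
      have \<rho>0: "0 \<le> \<rho>" by (simp add: \<rho>_def r_nonneg)
      have 3: "norm (u t i - u t j) \<le> \<bar>r t i - r t j\<bar> + \<rho> * norm (sgn x - sgn y)"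
      proof -
        have "norm (u t i - u t j) \<le> \<bar>r t i - r t j\<bar> + r t j * norm (sgn x - sgn y)"
          by (rule order_trans[OF 1], rule add_right_mono)
            (use mult_left_mono[OF ns(1) abs_ge_zero[of "r t i - r t j"]] in simp)
        moreover have "norm (u t i - u t j) \<le> \<bar>r t i - r t j\<bar> + r t i * norm (sgn x - sgn y)"
          by (rule order_trans[OF 2], rule add_right_mono)
            (use mult_left_mono[OF ns(2) abs_ge_zero[of "r t i - r t j"]] in simp)
        ultimately show ?thesis unfolding \<rho>_def min_def by (cases "r t i \<le> r t j") simp_all
      qed
      have "norm (sgn x - sgn y) \<le> norm (x - y)"
        unfolding x_def y_def by (intro sgn_diff_le norm_ratio_ge_1 t vi vj)
      also have "x - y = d t i - d t j + (z t i - F (mass t i)) + (F (mass t i) - F (mass t j)) - (z t j - F (mass t j))"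
        by (simp add: d_def x_def y_def)
      also have "norm \<dots> \<le> norm (d t i) + norm (d t j) + norm (z t i - F (mass t i))
          + norm (F (mass t i) - F (mass t j)) + norm (z t j - F (mass t j))"
        by (intro order_trans[OF norm_triangle_ineq4] order_trans[OF norm_triangle_ineq] add_mono order_refl)
      also have "\<dots> \<le> norm (d t i) + norm (d t j) + K"
      proof -
        have LhM: "\<Lambda> * h * v t l \<le> \<Lambda> * h * M" for l
          using v_le[OF t, of l] Lambda_nonneg h_pos by (intro mult_left_mono) auto
        have "norm (z t i - F (mass t i)) \<le> \<Lambda> * h * M" "norm (z t j - F (mass t j)) \<le> \<Lambda> * h * M"
          using z_minus_F[OF t vi, of "mass t i"] z_minus_F[OF t vj, of "mass t j"] mass_mono[OF t, of i] mass_mono[OF t, of j]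
            LhM[of i] LhM[of j] by auto
        moreover have "norm (F (mass t i) - F (mass t j)) \<le> \<Lambda> * (real k * h * M)"
        proof -
          have "\<bar>mass t i - mass t j\<bar> \<le> real k * h * M"
            using mass_increment_le[OF t, of j k] by (simp add: i_def)
          then show ?thesis using F_lipschitz[of "mass t i" "mass t j"] Lambda_nonneg
            by (meson mult_left_mono order_trans)
        qed
        moreover have "K = \<Lambda> * h * M + \<Lambda> * (real k * h * M) + \<Lambda> * h * M" by (simp add: K_def algebra_simps)
        ultimately show ?thesis by linarith
      qed
      finally have "\<rho> * norm (sgn x - sgn y) \<le> \<rho> * (norm (d t i) + norm (d t j) + K)"
        using \<rho>0 by (rule mult_left_mono)
      also have "\<dots> = \<rho> * norm (d t i) + \<rho> * norm (d t j) + \<rho> * K" by (simp add: distrib_left)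
      also have "\<dots> \<le> v t i / \<delta> * norm (d t i) + v t j / \<delta> * norm (d t j) + v t j / \<delta> * K"
      proof -
        have "\<rho> \<le> v t i / \<delta>" "\<rho> \<le> v t j / \<delta>"
          using r_le_v[OF t, of i] r_le_v[OF t, of j] by (auto simp: \<rho>_def)
        then show ?thesis using K by (intro add_mono mult_right_mono) auto
      qed
      finally have "norm (u t i - u t j) \<le> \<bar>r t i - r t j\<bar>
          + (v t i / \<delta> * norm (d t i) + v t j / \<delta> * norm (d t j) + v t j / \<delta> * K)" using 3 by linarith
      from mult_left_mono[OF this, of h]
      have "h * norm (u t i - u t j) \<le> h * \<bar>r t i - r t j\<bar>
          + (h * (v t i * norm (d t i)) + h * (v t j * norm (d t j))) / \<delta> + K / \<delta> * (h * v t j)"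
        using h_pos by (simp add: distrib_left add_divide_distrib mult_ac)
      also have "\<dots> \<le> h * \<bar>r t i - r t j\<bar> + (Z i + Z j) / \<delta> + K / \<delta> * (h * v t j)"
        using vd[of i] vd[of j] delta_pos by (intro add_mono divide_right_mono) auto
      finally show ?thesis by (simp add: i_def)
    qed
  qed
  have "(\<Sum>j\<in>?A. h * norm (u t (j + int k) - u t j))
      \<le> (\<Sum>j\<in>?A. h * \<bar>r t (j + int k) - r t j\<bar> + (Z (j + int k) + Z j) / \<delta> + K / \<delta> * (h * v t j))"
    by (intro sum_mono step)
  also have "\<dots> = (\<Sum>j\<in>?A. h * \<bar>r t (j + int k) - r t j\<bar>) + ((\<Sum>j\<in>?A. Z (j + int k)) + (\<Sum>j\<in>?A. Z j)) / \<delta>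
      + K / \<delta> * (\<Sum>j\<in>?A. h * v t j)"
    by (simp only: sum.distrib sum_divide_distrib[symmetric] sum_distrib_left[symmetric, of "K / \<delta>"])
  also have "\<dots> \<le> (\<Sum>j\<in>?A. h * \<bar>r t (j + int k) - r t j\<bar>) + ((\<Sum>i\<in>?W. Z i) + (\<Sum>i\<in>?W. Z i)) / \<delta> + K / \<delta> * m"
  proof (intro add_mono divide_right_mono mult_left_mono order_refl)
    show "(\<Sum>j\<in>?A. Z (j + int k)) \<le> (\<Sum>i\<in>?W. Z i)" by (rule sum_int_shift_le[OF Z0])
    show "(\<Sum>j\<in>?A. Z j) \<le> (\<Sum>i\<in>?W. Z i)" using Z0 by (intro sum_mono2) auto
    show "(\<Sum>j\<in>?A. h * v t j) \<le> m" by (rule mass_le[OF t])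
  qed (use delta_pos K in auto)
  also have "(\<Sum>i\<in>?W. Z i) + (\<Sum>i\<in>?W. Z i) = \<kappa> * (\<Sum>i\<in>?W. h * v t i) + (\<Sum>i\<in>?W. E t i) / \<kappa>"
    unfolding Z_def by (simp add: sum_divide_distrib[symmetric] sum.distrib sum_distrib_left)
  also have "(\<Sum>j\<in>?A. h * \<bar>r t (j + int k) - r t j\<bar>) + (\<kappa> * (\<Sum>i\<in>?W. h * v t i) + (\<Sum>i\<in>?W. E t i) / \<kappa>) / \<delta> + K / \<delta> * m
     \<le> (\<Sum>j\<in>?A. h * \<bar>r t (j + int k) - r t j\<bar>) + (\<kappa> * m + (\<Sum>i\<in>?W. E t i) / \<kappa>) / \<delta> + K / \<delta> * m"
    using mass_le[OF t, of "-N" "N + int k"] \<kappa> delta_pos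
    by (intro add_mono divide_right_mono mult_left_mono order_refl) auto
  finally show ?thesis by (simp add: K_def)
qed

end

context cone_scheme
begin

text \<open>The bound tends to \<open>\<omega>\<close> if first \<open>h\<close> and \<open>k * h\<close>, then \<open>\<epsilon>\<close> tend to \<open>0\<close>, apart from the terms with
  \<open>\<kappa>\<close>, which are small for a suitable \<open>\<kappa>\<close>.\<close>

lemma translation_estimate:
  fixes \<tau> :: "int \<Rightarrow> 'a" and J :: int and k :: nat
  assumes tau: "\<And>j. v 0 j \<noteq> 0 \<Longrightarrow> \<tau> j = u 0 j /\<^sub>R v 0 j"
    and TV: "\<And>a b. (\<Sum>i\<in>{a..b}. norm (\<tau> i - \<tau> (i - 1))) \<le> V"
    and bound: "\<And>j. norm (\<tau> j) \<le> c"
    and t: "0 \<le> t" and \<epsilon>: "0 < \<epsilon>" and \<kappa>: "0 < \<kappa>"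
    and init: "\<And>N. (\<Sum>j\<in>{-N..N}. h * norm (u 0 (j + int k) - u 0 j)) \<le> \<omega>"
    and R: "R = \<omega> + 4 * V\<^sup>2 * \<epsilon> + t * (16 * \<phi> M * M\<^sup>2 * (V / \<epsilon>)\<^sup>2 * h * m)"
  shows "(\<Sum>j\<in>{-J..J}. h * norm (u t (j + int k) - u t j))
    \<le> R + (\<kappa> * m + R / \<kappa>) / \<delta> + V / \<epsilon> * h * M * (real k + 2) * m / \<delta>"
proof -
  define \<Lambda> where "\<Lambda> = V / \<epsilon>"
  have V: "0 \<le> V" using TV[of 1 0] by simp
  have \<Lambda>: "0 \<le> \<Lambda>" using V \<epsilon> by (simp add: \<Lambda>_def)
  define B where "B = c + V"
  \<comment> \<open>This is \<open>cb\<close> of the scheme with profile, written out in advance: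
    the profile depends on the window and so on \<open>\<eta>\<close>, whereas the constant
    multiplying \<open>\<eta>\<close> must not.\<close>
  define K where "K = 2 * L / \<delta> + 8 * (\<phi> M * ((1 / \<delta> + B)\<^sup>2 + 2 * (1 / \<delta> + B) * (\<Lambda> * h * M)))"
  have B: "0 \<le> B" using V order_trans[OF norm_ge_zero bound[of 0]] by (simp add: B_def)
  have K: "0 \<le> K" unfolding K_def
    using L_nonneg delta_pos phi_nonneg[OF M_nonneg] B \<Lambda> h_pos M_nonneg
    by (intro add_nonneg_nonneg mult_nonneg_nonneg divide_nonneg_pos) auto
  show ?thesis
  proof (rule le_of_le_add_mult)
    show "0 \<le> t * K * (1 + 1 / (\<kappa> * \<delta>))" using t K \<kappa> delta_pos by simp
    fix \<eta> :: real assume \<eta>: "0 < \<eta>"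
    obtain N0 where N0: "\<And>s j. s \<in> {0..t} \<Longrightarrow> N0 \<le> \<bar>j\<bar> \<Longrightarrow> v s j < \<eta>" using v_tail[OF \<eta>] by blast
    \<comment> \<open>Large enough for the density to be below \<open>\<eta>\<close> from
      \<open>N - int k\<close> on, and for the window to contain \<open>{-J..J}\<close>.\<close>
    define N where "N = \<bar>N0\<bar> + \<bar>J\<bar> + int k"
    let ?A = "{-N..N}" and ?W = "{-N..N + int k}"
    obtain F G where FG: "\<And>x. (G has_vector_derivative F x) (at x)"
      "\<And>x y. norm (F x - F y) \<le> V / \<epsilon> * \<bar>x - y\<bar>" "\<And>x. norm (F x) \<le> c + V"
      "\<And>j. j \<in> ?W \<Longrightarrow> norm ((mass 0 j - mass 0 (j - 1)) *\<^sub>R \<tau> j - (G (mass 0 j) - G (mass 0 (j - 1))))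
          \<le> V * (mass 0 j - mass 0 (j - 1))"
      "(\<Sum>j\<in>?W. norm ((mass 0 j - mass 0 (j - 1)) *\<^sub>R \<tau> j - (G (mass 0 j) - G (mass 0 (j - 1))))) \<le> V * \<epsilon>"
    proof (rule lipschitz_profile[of "-N" "N + int k" "mass 0" \<tau> V c \<epsilon>])
      show "- N \<le> N + int k" by (simp add: N_def)
      show "mass 0 (j - 1) \<le> mass 0 j" for j by (rule mass_mono) simp
    qed (use TV bound \<epsilon> in blast)+
    interpret profile_scheme \<phi> h u M \<delta> L m e F G \<Lambda> B
      by unfold_locales (use FG \<Lambda> in \<open>simp_all add: \<Lambda>_def B_def\<close>)
    \<comment> \<open>In occupied cells this is \<open>h * v * d\<close> at time 0. The profile
      bounds it by \<open>V\<close> times the mass of the cell, so \<open>d\<close> is at most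
      \<open>V\<close>, and its sum by \<open>V * \<epsilon>\<close>; together they bound the
      initial energy by \<open>V^2 * \<epsilon>\<close>.\<close>
    define err where "err j = (mass 0 j - mass 0 (j - 1)) *\<^sub>R \<tau> j - (G (mass 0 j) - G (mass 0 (j - 1)))" for j
    have E0: "E 0 j \<le> V * norm (err j)" if j: "j \<in> ?W" for j
    proof (cases "v 0 j = 0")
      case True
      then show ?thesis using V by (simp add: E_zero)
    next
      case False
      then have "0 < v 0 j" using v_pos_or_zero[of 0 j] by simp
      then have hv: "0 < h * v 0 j" using h_pos by simp
      have "(h * v 0 j) *\<^sub>R z 0 j = G (mass 0 j) - G (mass 0 (j - 1))"
      proof -
        have "h * v 0 j * inverse (h * v 0 j) = 1" by (rule right_inverse[OF less_imp_neq[OF hv, symmetric]])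
        then show ?thesis unfolding z_def scaleR_scaleR by simp
      qed
      then have err: "err j = (h * v 0 j) *\<^sub>R d 0 j"
        unfolding err_def mass_step d_def tau[OF False] by (simp add: scaleR_diff_right)
      then have ne: "norm (err j) = (h * v 0 j) * norm (d 0 j)" using hv by simp
      have "(h * v 0 j) * norm (d 0 j) \<le> V * (h * v 0 j)"
        using FG(4)[OF j, folded err_def] unfolding ne mass_step .
      then have "(h * v 0 j) * norm (d 0 j) \<le> (h * v 0 j) * V" by (simp only: mult.commute)
      then have "norm (d 0 j) \<le> V" using hv by (simp only: mult_le_cancel_left_pos)
      then have "norm (err j) * norm (d 0 j) \<le> norm (err j) * V" by (intro mult_left_mono) auto
      moreover have "E 0 j = norm (err j) * norm (d 0 j)"
        unfolding E_def ne by (simp add: power2_eq_square mult_ac)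
      ultimately show ?thesis by (simp add: mult.commute)
    qed
    have "(\<Sum>i\<in>?W. E 0 i) \<le> (\<Sum>j\<in>?W. V * norm (err j))" by (intro sum_mono E0)
    also have "\<dots> \<le> V * (V * \<epsilon>)"
      unfolding sum_distrib_left[symmetric] err_def by (intro mult_left_mono FG(5) V)
    finally have sumE0: "(\<Sum>i\<in>?W. E 0 i) \<le> V\<^sup>2 * \<epsilon>" by (simp add: power2_eq_square mult_ac)
    have "(\<Sum>j\<in>?A. h * \<bar>r 0 (j + int k) - r 0 j\<bar>) \<le> (\<Sum>j\<in>?A. h * norm (u 0 (j + int k) - u 0 j))"
      unfolding r_def using h_pos by (intro sum_mono mult_left_mono norm_triangle_ineq3) auto
    also have "\<dots> \<le> \<omega>" by (rule init)
    finally have r0: "(\<Sum>j\<in>?A. h * \<bar>r 0 (j + int k) - r 0 j\<bar>) \<le> \<omega>" .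
    have cbK: "cb = K" by (simp add: cb_def cf_def K_def)
    have "v s j \<le> \<eta>" if "s \<in> {0..t}" "N - int k \<le> \<bar>j\<bar>" for s j
      using N0[of s j] that by (force simp: N_def)
    then have bal: "(\<Sum>j\<in>?A. h * \<bar>r t (j + int k) - r t j\<bar>) + 4 * (\<Sum>i\<in>?W. E t i)
        \<le> (\<Sum>j\<in>?A. h * \<bar>r 0 (j + int k) - r 0 j\<bar>) + 4 * (\<Sum>i\<in>?W. E 0 i) + t * (cb * \<eta> + 16 * c1 * m / h)"
      by (intro contraction_balance t) (auto simp: N_def)
    have "16 * c1 * m / h = 16 * \<phi> M * M\<^sup>2 * (V / \<epsilon>)\<^sup>2 * h * m"
      unfolding c1_def using h_pos by (simp add: \<Lambda>_def power2_eq_square)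
    then have bal': "(\<Sum>j\<in>?A. h * \<bar>r t (j + int k) - r t j\<bar>) + 4 * (\<Sum>i\<in>?W. E t i) \<le> R + t * K * \<eta>"
      using bal r0 sumE0 unfolding R cbK by (simp add: algebra_simps)
    have sE: "0 \<le> (\<Sum>i\<in>?W. E t i)" using E_nonneg[OF t] by (intro sum_nonneg)
    have sr: "0 \<le> (\<Sum>j\<in>?A. h * \<bar>r t (j + int k) - r t j\<bar>)" using h_pos by (intro sum_nonneg) auto
    have 1: "(\<Sum>j\<in>?A. h * \<bar>r t (j + int k) - r t j\<bar>) \<le> R + t * K * \<eta>" using bal' sE by linarith
    have 2: "(\<Sum>i\<in>?W. E t i) / \<kappa> \<le> (R + t * K * \<eta>) / \<kappa>" using bal' sE sr \<kappa> by (intro divide_right_mono) linarith+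
    have "(\<Sum>j\<in>{-J..J}. h * norm (u t (j + int k) - u t j)) \<le> (\<Sum>j\<in>?A. h * norm (u t (j + int k) - u t j))"
      using h_pos by (intro sum_mono2) (auto simp: N_def)
    also have "\<dots> \<le> (\<Sum>j\<in>?A. h * \<bar>r t (j + int k) - r t j\<bar>) + (\<kappa> * m + (\<Sum>i\<in>?W. E t i) / \<kappa>) / \<delta>
        + \<Lambda> * h * M * (real k + 2) * m / \<delta>" by (rule u_translation_le[OF t \<kappa>])
    also have "\<dots> \<le> (R + t * K * \<eta>) + (\<kappa> * m + (R + t * K * \<eta>) / \<kappa>) / \<delta> + \<Lambda> * h * M * (real k + 2) * m / \<delta>"
      using delta_pos by (intro add_mono order_refl 1 divide_right_mono[OF add_left_mono[OF 2]]) simp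
    also have "\<dots> = R + (\<kappa> * m + R / \<kappa>) / \<delta> + \<Lambda> * h * M * (real k + 2) * m / \<delta> + \<eta> * (t * K * (1 + 1 / (\<kappa> * \<delta>)))"
      using \<kappa> delta_pos by (simp add: field_simps)
    finally show "(\<Sum>j\<in>{-J..J}. h * norm (u t (j + int k) - u t j)) \<le> R + (\<kappa> * m + R / \<kappa>) / \<delta>
        + V / \<epsilon> * h * M * (real k + 2) * m / \<delta> + \<eta> * (t * K * (1 + 1 / (\<kappa> * \<delta>)))"
      unfolding \<Lambda>_def .
  qed
qed

end

subsection \<open>Step functions and lattice averages\<close>

definition cell_index :: "real \<Rightarrow> real \<Rightarrow> int" where "cell_index h x = \<lfloor>x / h + 1 / 2\<rfloor>"

lemma in_cell_iff:
  assumes "0 < h"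
  shows "x \<in> cell h j \<longleftrightarrow> cell_index h x = j"
  using assms by (auto simp: cell_def cell_index_def floor_eq_iff field_simps)

lemma step_fun_eq:
  assumes "0 < h"
  shows "step_fun h v x = v (cell_index h x)"
proof -
  have "step_fun h v x = (\<Sum>\<^sub>\<infinity>j\<in>{cell_index h x}. indicator (cell h j) x *\<^sub>R v j)"
    unfolding step_fun_def by (rule infsum_cong_neutral) (auto simp: indicator_def in_cell_iff[OF assms])
  then show ?thesis by (simp add: indicator_def in_cell_iff[OF assms])
qed

lemma cell_index_measurable [measurable]: "cell_index h \<in> measurable borel (count_space UNIV)"
  unfolding cell_index_def by measurable

lemma cell_index_diff_le:
  assumes "0 < h"
  shows "real_of_int \<bar>cell_index h x - cell_index h y\<bar> \<le> \<bar>x - y\<bar> / h + 1"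
proof -
  have "\<bar>x / h - y / h\<bar> = \<bar>x - y\<bar> / h" using assms by (simp add: diff_divide_distrib[symmetric] abs_divide)
  then show ?thesis unfolding cell_index_def by linarith
qed

lemma emeasure_cell: "0 < h \<Longrightarrow> emeasure lborel (cell h j) = ennreal h"
  by (simp add: cell_def)

text \<open>Monotone convergence along growing windows, since the lattice estimates come as bounds
  for finite windows.\<close>

lemma nn_integral_step_le:
  assumes h: "0 < h" and b: "\<And>j. 0 \<le> b j" and le: "\<And>J::int. (\<Sum>j\<in>{-J..J}. h * b j) \<le> e"
  shows "(\<integral>\<^sup>+x. ennreal (b (cell_index h x)) \<partial>lborel) \<le> ennreal e"
proof -
  define f where "f n x = (\<Sum>j\<in>{-int n..int n}. ennreal (b j) * indicator (cell h j) x)" for n and x :: real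
  have f_eq: "f n x = (if \<bar>cell_index h x\<bar> \<le> int n then ennreal (b (cell_index h x)) else 0)" for n x
  proof -
    have "f n x = (\<Sum>j\<in>{-int n..int n}. if j = cell_index h x then ennreal (b (cell_index h x)) else 0)"
      unfolding f_def by (intro sum.cong) (auto simp: indicator_def in_cell_iff[OF h])
    also have "\<dots> = (if \<bar>cell_index h x\<bar> \<le> int n then ennreal (b (cell_index h x)) else 0)"
      by (subst sum.delta) auto
    finally show ?thesis .
  qed
  have cells: "cell h j \<in> sets borel" for j by (simp add: cell_def)
  have "(\<integral>\<^sup>+x. f n x \<partial>lborel) \<le> ennreal e" for n
  proof -
    have "(\<integral>\<^sup>+x. f n x \<partial>lborel) = (\<Sum>j\<in>{-int n..int n}. ennreal (b j) * ennreal h)"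
      unfolding f_def using cells
      by (subst nn_integral_sum) (auto simp: nn_integral_cmult_indicator emeasure_cell[OF h])
    also have "\<dots> = ennreal (\<Sum>j\<in>{-int n..int n}. h * b j)"
      using b h by (subst sum_ennreal[symmetric]) (auto simp: ennreal_mult mult.commute)
    finally show ?thesis using le[of "int n"] by (simp add: ennreal_leI)
  qed
  moreover have "(\<integral>\<^sup>+x. (SUP n. f n x) \<partial>lborel) = (SUP n. \<integral>\<^sup>+x. f n x \<partial>lborel)"
  proof (rule nn_integral_monotone_convergence_SUP)
    show "incseq f" unfolding f_eq[abs_def] by (auto simp: incseq_def le_fun_def)
    show "f n \<in> borel_measurable lborel" for n unfolding f_def[abs_def] using cells by measurable
  qed
  moreover have "(SUP n. f n x) = ennreal (b (cell_index h x))" for x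
  proof (rule antisym)
    show "(SUP n. f n x) \<le> ennreal (b (cell_index h x))" by (rule SUP_least) (simp add: f_eq)
    have "f (nat \<bar>cell_index h x\<bar>) x = ennreal (b (cell_index h x))" by (simp add: f_eq)
    then show "ennreal (b (cell_index h x)) \<le> (SUP n. f n x)" by (metis SUP_upper UNIV_I)
  qed
  ultimately show ?thesis by (simp add: SUP_le_iff)
qed

definition lattice_avg :: "nat \<Rightarrow> (int \<Rightarrow> 'a::real_normed_vector) \<Rightarrow> int \<Rightarrow> 'a" where
  "lattice_avg K v j = (\<Sum>i<K. v (j + int i)) /\<^sub>R real K"

lemma norm_lattice_avg_le:
  assumes "\<And>i. norm (v i) \<le> M" "0 < K"
  shows "norm (lattice_avg K v j) \<le> M"
proof -
  have "norm (\<Sum>i<K. v (j + int i)) \<le> (\<Sum>i<K. M)" by (rule sum_norm_le) (rule assms)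
  then show ?thesis using assms(2) by (simp add: lattice_avg_def field_simps)
qed

text \<open>Moving the block by one cell exchanges only the two values at its ends, so the average
  changes by at most \<open>2 * M / K\<close>.\<close>

lemma lattice_avg_shift:
  assumes M: "\<And>i. norm (v i) \<le> M" and K: "0 < K"
  shows "norm (lattice_avg K v i - lattice_avg K v j) \<le> real_of_int \<bar>i - j\<bar> * (2 * M / real K)"
proof -
  define c where "c = 2 * M / real K"
  have step: "norm (lattice_avg K v (j + 1) - lattice_avg K v j) \<le> c" for j
  proof -
    have "(\<Sum>i<K. v (j + 1 + int i)) - (\<Sum>i<K. v (j + int i)) = (\<Sum>i<K. v (j + int (Suc i)) - v (j + int i))"
      unfolding sum_subtractf[symmetric] by (intro sum.cong) (auto simp: algebra_simps)
    also have "\<dots> = v (j + int K) - v j" using sum_lessThan_telescope[of "\<lambda>i. v (j + int i)" K] by simp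
    finally have "lattice_avg K v (j + 1) - lattice_avg K v j = (v (j + int K) - v j) /\<^sub>R real K"
      unfolding lattice_avg_def scaleR_diff_right[symmetric] by simp
    moreover have "norm (v (j + int K) - v j) \<le> 2 * M"
      using norm_triangle_ineq4[of "v (j + int K)" "v j"] M[of j] M[of "j + int K"] by linarith
    ultimately show ?thesis using K by (simp add: c_def divide_inverse mult.commute mult_left_mono)
  qed
  have up: "norm (lattice_avg K v (j + int n) - lattice_avg K v j) \<le> real n * c" for n j
  proof (induction n)
    case (Suc n)
    have "norm (lattice_avg K v (j + int (Suc n)) - lattice_avg K v j)
        \<le> norm (lattice_avg K v (j + int n + 1) - lattice_avg K v (j + int n))
          + norm (lattice_avg K v (j + int n) - lattice_avg K v j)"
      using norm_triangle_ineq[of "lattice_avg K v (j + int n + 1) - lattice_avg K v (j + int n)"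
          "lattice_avg K v (j + int n) - lattice_avg K v j"] by (simp add: algebra_simps)
    then show ?case using step[of "j + int n"] Suc by (simp add: distrib_right)
  qed simp
  show ?thesis
  proof (cases "j \<le> i")
    case True
    then show ?thesis using up[of j "nat (i - j)"] by (simp add: c_def)
  next
    case False
    then show ?thesis using up[of i "nat (j - i)"] by (simp add: c_def norm_minus_commute)
  qed
qed

lemma sum_lattice_avg_dist_le:
  assumes h: "0 < h" and K: "0 < K"
    and le: "\<And>n. n < K \<Longrightarrow> (\<Sum>j\<in>A. h * norm (v (j + int n) - v j)) \<le> e"
  shows "(\<Sum>j\<in>A. h * norm (v j - lattice_avg K v j)) \<le> e"
proof -
  have "h * norm (v j - lattice_avg K v j) \<le> (\<Sum>n<K. h * norm (v (j + int n) - v j)) / real K" for j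
  proof -
    have "(\<Sum>n<K. v j - v (j + int n)) /\<^sub>R real K = v j - lattice_avg K v j"
      using K unfolding lattice_avg_def sum_subtractf scaleR_diff_right sum_constant_scaleR by simp
    then have "norm (v j - lattice_avg K v j) = norm (\<Sum>n<K. v j - v (j + int n)) / real K"
      by (metis divide_inverse inverse_nonnegative_iff_nonnegative mult.commute norm_scaleR abs_of_nonneg of_nat_0_le_iff)
    also have "\<dots> \<le> (\<Sum>n<K. norm (v (j + int n) - v j)) / real K"
      by (intro divide_right_mono sum_norm_le) (auto simp: norm_minus_commute)
    finally have "norm (v j - lattice_avg K v j) \<le> (\<Sum>n<K. norm (v (j + int n) - v j)) / real K" .
    from mult_left_mono[OF this, of h] show ?thesis using h by (simp add: sum_distrib_left[symmetric])
  qed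
  then have "(\<Sum>j\<in>A. h * norm (v j - lattice_avg K v j)) \<le> (\<Sum>j\<in>A. (\<Sum>n<K. h * norm (v (j + int n) - v j)) / real K)"
    by (intro sum_mono)
  also have "\<dots> = (\<Sum>n<K. \<Sum>j\<in>A. h * norm (v (j + int n) - v j)) / real K"
    unfolding sum_divide_distrib[symmetric] by (subst sum.swap) (rule refl)
  also have "\<dots> \<le> (\<Sum>n<K. e) / real K" using le by (intro divide_right_mono sum_mono) auto
  also have "\<dots> = e" using K by simp
  finally show ?thesis .
qed

text \<open>The hypothesis on the total of a block is what conservation provides, with a bound
  independent of the length of the block; this length is at least \<open>\<eta>\<close>.\<close>

lemma lattice_avg_time_lipschitz:
  assumes K: "0 < K" and le: "norm (\<Sum>i<K. h *\<^sub>R (v (j + int i) - w (j + int i))) \<le> c"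
    and h: "0 < h" and \<eta>: "0 < \<eta>" "\<eta> \<le> real K * h"
  shows "norm (lattice_avg K v j - lattice_avg K w j) \<le> c / \<eta>"
proof -
  have "lattice_avg K v j - lattice_avg K w j = (\<Sum>i<K. v (j + int i) - w (j + int i)) /\<^sub>R real K"
    by (simp add: lattice_avg_def sum_subtractf scaleR_diff_right)
  also have "\<dots> = (\<Sum>i<K. h *\<^sub>R (v (j + int i) - w (j + int i))) /\<^sub>R (real K * h)"
    using h by (simp add: scaleR_sum_right[symmetric])
  finally have "norm (lattice_avg K v j - lattice_avg K w j) =
      norm (\<Sum>i<K. h *\<^sub>R (v (j + int i) - w (j + int i))) / (real K * h)"
    using h by (simp add: divide_inverse mult.commute)
  also have "\<dots> \<le> c / \<eta>" using le \<eta> order_trans[OF norm_ge_zero le] by (intro frac_le) auto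
  finally show ?thesis .
qed

subsection \<open>Compactness\<close>

lemma step_measurable:
  fixes v :: "real \<Rightarrow> int \<Rightarrow> 'a::{real_normed_vector, second_countable_topology}"
  assumes cont: "\<And>j. continuous_on {0..T} (\<lambda>t. v t j)"
  shows "(\<lambda>p. if snd p \<in> {0..T} then v (snd p) (cell_index h (fst p)) else 0) \<in> borel_measurable (borel :: (real \<times> real) measure)"
proof -
  have fst: "(fst :: real \<times> real \<Rightarrow> real) \<in> borel_measurable borel" and snd: "(snd :: real \<times> real \<Rightarrow> real) \<in> borel_measurable borel"
    by (auto intro!: borel_measurable_continuous_onI continuous_on_fst continuous_on_snd continuous_on_id)
  have 1: "(\<lambda>p::real \<times> real. if snd p \<in> {0..T} then v (snd p) j else 0) \<in> borel_measurable borel" for j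
  proof -
    have "(\<lambda>t. if t \<in> {0..T} then v t j else 0) \<in> borel_measurable borel"
      by (rule borel_measurable_continuous_on_if) (auto simp: cont)
    from measurable_compose[OF snd this] show ?thesis by simp
  qed
  show ?thesis
    by (rule measurable_compose_countable[OF 1 measurable_compose[OF fst cell_index_measurable]])
qed

lemma std_normal_density_le_1: "std_normal_density x \<le> 1"
proof -
  have "1 \<le> sqrt (2 * pi)" using pi_gt3 by (intro real_le_rsqrt) simp
  then have "1 / sqrt (2 * pi) * exp (- x\<^sup>2 / 2) \<le> 1 * 1" by (intro mult_mono) auto
  then show ?thesis by (simp add: std_normal_density_def)
qed

text \<open>The averages over \<open>K\<close> cells, with \<open>K * h \<approx> \<eta>\<close>, are asymptotically equicontinuous in space-time
  for fixed \<open>\<eta>\<close>, so the Arzela-Ascoli argument applies to them. By the translation estimate they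
  are uniformly close to the step functions in \<open>L\<^sup>1\<close>.\<close>

theorem lattice_compactness:
  fixes U :: "nat \<Rightarrow> real \<Rightarrow> int \<Rightarrow> 'a::euclidean_space" and h :: "nat \<Rightarrow> real"
  assumes h: "\<And>k. 0 < h k" "h \<longlonglongrightarrow> 0" and T: "0 < T" and c: "0 \<le> c"
    and bound: "\<And>k t j. t \<in> {0..T} \<Longrightarrow> norm (U k t j) \<le> M"
    and cont: "\<And>k j. continuous_on {0..T} (\<lambda>t. U k t j)"
    and time: "\<And>k s t j n. s \<in> {0..T} \<Longrightarrow> t \<in> {0..T} \<Longrightarrow>
      norm (\<Sum>i<n. h k *\<^sub>R (U k s (j + int i) - U k t (j + int i))) \<le> c * \<bar>s - t\<bar>"
    and space: "\<And>e. 0 < e \<Longrightarrow> \<exists>\<eta>>0. \<exists>k0. \<forall>k\<ge>k0. \<forall>n. real n * h k \<le> \<eta> \<longrightarrow>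
      (\<forall>t\<in>{0..T}. \<forall>J. (\<Sum>j\<in>{-J..J}. h k * norm (U k t (j + int n) - U k t j)) \<le> e)"
  obtains \<rho> u where "strict_mono (\<rho> :: nat \<Rightarrow> nat)"
    "u \<in> borel_measurable (borel :: (real \<times> real) measure)" "\<And>p. norm (u p) \<le> M"
    "AE p in lborel. snd p \<in> {0..T} \<longrightarrow>
      (\<lambda>k. U (\<rho> k) (snd p) (cell_index (h (\<rho> k)) (fst p))) \<longlonglongrightarrow> u p"
proof -
  have M: "0 \<le> M" using order_trans[OF norm_ge_zero bound[of 0 0 0]] T by simp
  define \<eta> where "\<eta> p = 1 / real (Suc p)" for p
  have \<eta>: "0 < \<eta> p" for p by (simp add: \<eta>_def)
  \<comment> \<open>Rounding up gives at least one cell and a block length between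
    \<open>\<eta> p\<close> and \<open>\<eta> p + h k\<close>.\<close>
  define K where "K p k = nat \<lceil>\<eta> p / h k\<rceil>" for p k
  have Kc: "real (K p k) = of_int \<lceil>\<eta> p / h k\<rceil>" for p k
    unfolding K_def using divide_pos_pos[OF \<eta>[of p] h(1)[of k]] by (simp add: ceiling_le_iff)
  have K0: "0 < K p k" for p k
    unfolding K_def using divide_pos_pos[OF \<eta>[of p] h(1)[of k]] by simp
  have Kl: "\<eta> p \<le> real (K p k) * h k" for p k
  proof -
    have "\<eta> p / h k \<le> real (K p k)" unfolding Kc by linarith
    then show ?thesis using h(1)[of k] by (simp add: divide_le_eq)
  qed
  have Ku: "real (K p k) * h k \<le> \<eta> p + h k" for p k
  proof -
    have "real (K p k) \<le> \<eta> p / h k + 1" unfolding Kc by linarith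
    from mult_right_mono[OF this, of "h k"] have "real (K p k) * h k \<le> (\<eta> p / h k + 1) * h k"
      using h(1)[of k] by simp
    also have "\<dots> = \<eta> p + h k" using h(1)[of k] by (simp add: field_simps)
    finally show ?thesis .
  qed
  define A where "A p k x t = lattice_avg (K p k) (U k t) (cell_index (h k) x)" for p k x t
  have Ab: "norm (A p k x t) \<le> M" if "t \<in> {0..T}" for p k x t
    unfolding A_def by (rule norm_lattice_avg_le[OF bound[OF that] K0])
  define H where "H p = 2 * M / \<eta> p + c / \<eta> p + 1" for p
  have H: "0 < H p" for p
  proof -
    have "0 \<le> 2 * M / \<eta> p" "0 \<le> c / \<eta> p" using M c \<eta>[of p] by auto
    then show ?thesis unfolding H_def by linarith
  qed
  \<comment> \<open>The summand \<open>h k\<close> pays for the jumps between cells, since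
    arbitrarily close points may have different cell indices.\<close>
  have equi: "norm (A p k x t - A p k y s) \<le> H p * (\<bar>x - y\<bar> + h k + \<bar>t - s\<bar>)"
    if t: "t \<in> {0..T}" and s: "s \<in> {0..T}" for p k x y t s
  proof -
    let ?i = "cell_index (h k) x" and ?j = "cell_index (h k) y"
    have "norm (A p k x t - lattice_avg (K p k) (U k t) ?j) \<le> real_of_int \<bar>?i - ?j\<bar> * (2 * M / real (K p k))"
      unfolding A_def by (rule lattice_avg_shift[OF bound[OF t] K0])
    also have "\<dots> \<le> (\<bar>x - y\<bar> / h k + 1) * (2 * M * (h k / \<eta> p))"
    proof (intro mult_mono cell_index_diff_le h(1))
      have "1 / real (K p k) \<le> h k / \<eta> p" using Kl[of p k] K0[of p k] \<eta>[of p] by (simp add: field_simps)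
      from mult_left_mono[OF this, of "2 * M"] show "2 * M / real (K p k) \<le> 2 * M * (h k / \<eta> p)" using M by simp
    qed (use M h(1)[of k] in auto)
    also have "\<dots> = 2 * M / \<eta> p * (\<bar>x - y\<bar> + h k)" using h(1)[of k] \<eta>[of p] by (simp add: field_simps)
    finally have 1: "norm (A p k x t - lattice_avg (K p k) (U k t) ?j) \<le> 2 * M / \<eta> p * (\<bar>x - y\<bar> + h k)" .
    have 2: "norm (lattice_avg (K p k) (U k t) ?j - A p k y s) \<le> c * \<bar>t - s\<bar> / \<eta> p"
      unfolding A_def by (rule lattice_avg_time_lipschitz[OF K0 time[OF t s] h(1) \<eta> Kl])
    have "norm (A p k x t - A p k y s) \<le> 2 * M / \<eta> p * (\<bar>x - y\<bar> + h k) + c * \<bar>t - s\<bar> / \<eta> p"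
      using norm_triangle_ineq[of "A p k x t - lattice_avg (K p k) (U k t) ?j" "lattice_avg (K p k) (U k t) ?j - A p k y s"] 1 2 by simp
    also have "\<dots> = 2 * M / \<eta> p * (\<bar>x - y\<bar> + h k) + c / \<eta> p * \<bar>t - s\<bar>" by simp
    also have "\<dots> \<le> H p * (\<bar>x - y\<bar> + h k) + H p * \<bar>t - s\<bar>"
    proof -
      have "0 \<le> 2 * M / \<eta> p" "0 \<le> c / \<eta> p" using M c \<eta>[of p] by auto
      then have "2 * M / \<eta> p \<le> H p" "c / \<eta> p \<le> H p" unfolding H_def by linarith+
      then show ?thesis using h(1)[of k] by (intro add_mono mult_right_mono) auto
    qed
    finally show ?thesis by (simp add: distrib_left)
  qed
  \<comment> \<open>One subsequence serves all block lengths and all rational points of the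
    strip.\<close>
  obtain \<sigma> where \<sigma>: "strict_mono (\<sigma> :: nat \<Rightarrow> nat)"
    and conv: "\<And>q. q \<in> UNIV \<times> \<rat> \<times> (\<rat> \<inter> {0..T}) \<Longrightarrow> \<exists>l. (\<lambda>n. case q of (p, x, t) \<Rightarrow> A p (\<sigma> n) x t) \<longlonglongrightarrow> l"
  proof (rule function_convergent_subsequence[of "UNIV \<times> \<rat> \<times> (\<rat> \<inter> {0..T})" "\<lambda>n q. case q of (p, x, t) \<Rightarrow> A p n x t" M])
    show "countable ((UNIV :: nat set) \<times> (\<rat> :: real set) \<times> (\<rat> \<inter> {0..T}))"
      by (intro countable_SIGMA countable_Int1 countable_rat) auto
  qed (use Ab in auto)
  have h\<sigma>: "(\<lambda>n. h (\<sigma> n)) \<longlonglongrightarrow> 0" using LIMSEQ_subseq_LIMSEQ[OF h(2) \<sigma>] by (simp add: o_def)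
  have rat: "\<exists>s\<in>\<rat> \<inter> {0..T}. \<bar>t - s\<bar> < d" if t: "t \<in> {0..T}" and d: "0 < d" for t d
  proof -
    have "max 0 (t - d) < min T (t + d)" using t d T by auto
    then obtain s where "s \<in> \<rat>" "max 0 (t - d) < s" "s < min T (t + d)" using Rats_dense_in_real by blast
    then show ?thesis by (intro bexI[of _ s]) auto
  qed
  have convergent: "convergent (\<lambda>n. A p (\<sigma> n) x t)" if t: "t \<in> {0..T}" for p x t
    unfolding Cauchy_convergent_iff[symmetric]
  proof (rule metric_CauchyI)
    fix e :: real assume e: "0 < e"
    define d where "d = e / (9 * H p)"
    have d: "0 < d" and Hd: "H p * (3 * d) = e / 3" using e H[of p] by (auto simp: d_def field_simps)
    obtain q where q: "q \<in> \<rat>" "\<bar>x - q\<bar> < d"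
      using Rats_dense_in_real[of "x - d" "x + d"] d by force
    obtain s where s: "s \<in> \<rat> \<inter> {0..T}" "\<bar>t - s\<bar> < d" using rat[OF t d] by blast
    have "Cauchy (\<lambda>n. A p (\<sigma> n) q s)"
    proof -
      have "\<exists>l. (\<lambda>n. A p (\<sigma> n) q s) \<longlonglongrightarrow> l" using conv[of "(p, q, s)"] q s by simp
      then show ?thesis by (elim exE) (rule LIMSEQ_imp_Cauchy)
    qed
    then obtain n1 where n1: "\<And>i j. i \<ge> n1 \<Longrightarrow> j \<ge> n1 \<Longrightarrow> norm (A p (\<sigma> i) q s - A p (\<sigma> j) q s) < e / 3"
      using metric_CauchyD[of "\<lambda>n. A p (\<sigma> n) q s" "e / 3"] e unfolding dist_norm by (meson divide_pos_pos zero_less_numeral)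
    obtain n2 where n2: "\<And>n. n \<ge> n2 \<Longrightarrow> h (\<sigma> n) < d"
      using order_tendstoD(2)[OF h\<sigma> d] unfolding eventually_sequentially by blast
    have close: "norm (A p (\<sigma> i) x t - A p (\<sigma> i) q s) \<le> e / 3" if "i \<ge> n2" for i
    proof -
      have "norm (A p (\<sigma> i) x t - A p (\<sigma> i) q s) \<le> H p * (\<bar>x - q\<bar> + h (\<sigma> i) + \<bar>t - s\<bar>)"
        using t s by (intro equi) auto
      also have "\<dots> \<le> H p * (3 * d)" using n2[OF that] q(2) s(2) H[of p] by (intro mult_left_mono) simp_all
      finally show ?thesis unfolding Hd .
    qed
    show "\<exists>N. \<forall>i\<ge>N. \<forall>j\<ge>N. dist (A p (\<sigma> i) x t) (A p (\<sigma> j) x t) < e"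
    proof (intro exI[of _ "max n1 n2"] allI impI)
      fix i j assume "max n1 n2 \<le> i" "max n1 n2 \<le> j"
      then have 1: "norm (A p (\<sigma> i) x t - A p (\<sigma> i) q s) \<le> e / 3" "norm (A p (\<sigma> j) x t - A p (\<sigma> j) q s) \<le> e / 3"
        "norm (A p (\<sigma> i) q s - A p (\<sigma> j) q s) < e / 3" using close[of i] close[of j] n1[of i j] by simp_all
      have "A p (\<sigma> i) x t - A p (\<sigma> j) x t = (A p (\<sigma> i) x t - A p (\<sigma> i) q s)
          + (A p (\<sigma> i) q s - A p (\<sigma> j) q s) - (A p (\<sigma> j) x t - A p (\<sigma> j) q s)" by simp
      also have "norm \<dots> \<le> norm (A p (\<sigma> i) x t - A p (\<sigma> i) q s) + norm (A p (\<sigma> i) q s - A p (\<sigma> j) q s)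
          + norm (A p (\<sigma> j) x t - A p (\<sigma> j) q s)"
        by (intro order_trans[OF norm_triangle_ineq4] add_mono norm_triangle_ineq order_refl)
      finally show "dist (A p (\<sigma> i) x t) (A p (\<sigma> j) x t) < e" using 1 by (simp add: dist_norm)
    qed
  qed
  define S where "S k p = (if snd p \<in> {0..T} then U (\<sigma> k) (snd p) (cell_index (h (\<sigma> k)) (fst p)) else 0)" for k and p :: "real \<times> real"
  define B where "B m k p = (if snd p \<in> {0..T} then A m (\<sigma> k) (fst p) (snd p) else 0)" for m k and p :: "real \<times> real"
  have Sm: "S k \<in> borel_measurable borel" for k
    unfolding S_def by (rule step_measurable[OF cont])
  have Bm: "B m k \<in> borel_measurable borel" for m k
    unfolding B_def A_def by (rule step_measurable) (unfold lattice_avg_def, intro continuous_intros cont)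
  have Sb: "norm (S k p) \<le> M" for k p using bound M by (simp add: S_def)
  have Bb: "norm (B m k p) \<le> M" for m k p using Ab M by (simp add: B_def)
  \<comment> \<open>The Gaussian weight turns the strip into a finite measure space with the null
    sets of Lebesgue measure, so all bounded measurable functions are integrable on it. Its values
    are at most 1, so the unweighted L1 bounds in \<open>x\<close> carry over.\<close>
  define W where "W p = ennreal (std_normal_density (fst p)) * indicator {0..T} (snd p)" for p :: "real \<times> real"
  define P where "P = density lborel W"
  have Wm: "W \<in> borel_measurable lborel"
  proof -
    have fst: "(fst :: real \<times> real \<Rightarrow> real) \<in> borel_measurable borel" and snd: "(snd :: real \<times> real \<Rightarrow> real) \<in> borel_measurable borel"
      by (auto intro!: borel_measurable_continuous_onI continuous_on_fst continuous_on_snd continuous_on_id)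
    have "(\<lambda>x. ennreal (std_normal_density x)) \<in> borel_measurable borel" by measurable
    from measurable_compose[OF fst this]
    have 1: "(\<lambda>p::real \<times> real. ennreal (std_normal_density (fst p))) \<in> borel_measurable borel" .
    have "(indicator {0..T} :: real \<Rightarrow> ennreal) \<in> borel_measurable borel" by measurable
    from measurable_compose[OF snd this]
    have "(\<lambda>p::real \<times> real. indicator {0..T} (snd p) :: ennreal) \<in> borel_measurable borel" .
    with 1 have "(\<lambda>p::real \<times> real. ennreal (std_normal_density (fst p)) * indicator {0..T} (snd p)) \<in> borel_measurable borel"
      by measurable
    then show ?thesis unfolding W_def by simp
  qed
  have nnP: "(\<integral>\<^sup>+p. f p \<partial>P) = (\<integral>\<^sup>+t. indicator {0..T} t * (\<integral>\<^sup>+x. ennreal (std_normal_density x) * f (x, t) \<partial>lborel) \<partial>lborel)"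
    if f: "f \<in> borel_measurable (borel :: (real \<times> real) measure)" for f
  proof -
    have Wf: "(\<lambda>p. W p * f p) \<in> borel_measurable (lborel \<Otimes>\<^sub>M lborel)"
      using Wm f unfolding lborel_prod by simp
    have "(\<integral>\<^sup>+p. f p \<partial>P) = (\<integral>\<^sup>+p. W p * f p \<partial>lborel)"
      unfolding P_def using Wm f by (intro nn_integral_density) auto
    also have "\<dots> = (\<integral>\<^sup>+t. (\<integral>\<^sup>+x. W (x, t) * f (x, t) \<partial>lborel) \<partial>lborel)"
      unfolding lborel_prod[symmetric] by (rule lborel_pair.nn_integral_snd[OF Wf, symmetric])
    also have "(\<lambda>t. \<integral>\<^sup>+x. W (x, t) * f (x, t) \<partial>lborel) = (\<lambda>t. indicator {0..T} t * (\<integral>\<^sup>+x. ennreal (std_normal_density x) * f (x, t) \<partial>lborel))"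
      by (auto simp: W_def fun_eq_iff split: split_indicator)
    finally show ?thesis .
  qed
  have I: "(\<integral>\<^sup>+x. ennreal (std_normal_density x) \<partial>lborel) = 1"
    using prob_space.emeasure_space_1[OF prob_space_normal_density[of 1 0]] by (simp add: emeasure_density)
  have "emeasure P (space P) = (\<integral>\<^sup>+p. 1 \<partial>P)" by simp
  also have "\<dots> = ennreal T" using nnP[of "\<lambda>_. 1"] T by (simp add: I)
  finally have "finite_measure P" by (intro finite_measureI) simp
  then interpret P: finite_measure P .
  have setsP: "sets P = sets borel" by (simp add: P_def)
  have measP: "f \<in> borel_measurable P" if "f \<in> borel_measurable borel" for f :: "real \<times> real \<Rightarrow> 'b::topological_space"
    using that by (simp add: P_def)
  have intP: "integrable P f" if "f \<in> borel_measurable borel" "\<And>p. norm (f p) \<le> b" for f :: "real \<times> real \<Rightarrow> 'a" and b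
    using that by (intro P.integrable_const_bound[of _ b] measP) auto
  have intPr: "integrable P f" if "f \<in> borel_measurable borel" "\<And>p. norm (f p) \<le> b" for f :: "real \<times> real \<Rightarrow> real" and b
    using that by (intro P.integrable_const_bound[of _ b] measP) auto
  have diffM: "norm (x - y) \<le> 2 * M" if "norm x \<le> M" "norm y \<le> M" for x y :: 'a
    using that norm_triangle_ineq4[of x y] by linarith
  have dist_int: "integrable P (\<lambda>p. norm (f p - g p))"
    if "f \<in> borel_measurable borel" "g \<in> borel_measurable borel" "\<And>p. norm (f p) \<le> M" "\<And>p. norm (g p) \<le> M"
    for f g :: "real \<times> real \<Rightarrow> 'a"
    using that by (intro intPr[of _ "2 * M"]) (auto intro!: diffM)
  have SB: "(\<integral>p. norm (S k p - B m k p) \<partial>P) \<le> T * e"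
    if e: "0 \<le> e" and le: "\<And>n t J. n < K m (\<sigma> k) \<Longrightarrow> t \<in> {0..T} \<Longrightarrow>
      (\<Sum>j\<in>{-J..J}. h (\<sigma> k) * norm (U (\<sigma> k) t (j + int n) - U (\<sigma> k) t j)) \<le> e" for k m e
  proof (rule integral_real_bounded)
    have "(\<integral>\<^sup>+p. ennreal (norm (S k p - B m k p)) \<partial>P)
       = (\<integral>\<^sup>+t. indicator {0..T} t * (\<integral>\<^sup>+x. ennreal (std_normal_density x) * ennreal (norm (S k (x, t) - B m k (x, t))) \<partial>lborel) \<partial>lborel)"
      using Sm Bm by (intro nnP) measurable
    also have "\<dots> \<le> (\<integral>\<^sup>+t. indicator {0..T} t * ennreal e \<partial>lborel)"
    proof (intro nn_integral_mono)
      fix t :: real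
      show "indicator {0..T} t * (\<integral>\<^sup>+x. ennreal (std_normal_density x) * ennreal (norm (S k (x, t) - B m k (x, t))) \<partial>lborel)
          \<le> indicator {0..T} t * ennreal e"
      proof (cases "t \<in> {0..T}")
        case True
        let ?b = "\<lambda>j. norm (U (\<sigma> k) t j - lattice_avg (K m (\<sigma> k)) (U (\<sigma> k) t) j)"
        have "(\<integral>\<^sup>+x. ennreal (std_normal_density x) * ennreal (norm (S k (x, t) - B m k (x, t))) \<partial>lborel)
            \<le> (\<integral>\<^sup>+x. ennreal (?b (cell_index (h (\<sigma> k)) x)) \<partial>lborel)"
        proof (intro nn_integral_mono)
          fix x
          have "ennreal (std_normal_density x) * ennreal (norm (S k (x, t) - B m k (x, t)))
              \<le> 1 * ennreal (norm (S k (x, t) - B m k (x, t)))"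
            using std_normal_density_le_1[of x] by (intro mult_right_mono) (auto simp: ennreal_le_1)
          then show "ennreal (std_normal_density x) * ennreal (norm (S k (x, t) - B m k (x, t)))
              \<le> ennreal (?b (cell_index (h (\<sigma> k)) x))" using True by (simp add: S_def B_def A_def)
        qed
        also have "\<dots> \<le> ennreal e"
          by (intro nn_integral_step_le h(1) sum_lattice_avg_dist_le K0 le True) auto
        finally show ?thesis using True by simp
      qed simp
    qed
    also have "\<dots> = ennreal (T * e)" using T e by (simp add: nn_integral_multc ennreal_mult)
    finally show "(\<integral>\<^sup>+p. ennreal (norm (S k p - B m k p)) \<partial>P) \<le> ennreal (T * e)" .
  qed (use T e in simp)
  have "\<exists>N. \<forall>i\<ge>N. \<forall>j\<ge>N. (\<integral>p. norm (S i p - S j p) \<partial>P) < e" if e: "0 < e" for e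
  proof -
    \<comment> \<open>Four errors below \<open>e / 4\<close> are to be added. Dividing by 5 makes
      the inequality strict, and \<open>T + 1\<close> compensates the length of the time
      interval.\<close>
    define e' where "e' = e / 5 / (T + 1)"
    have e'0: "0 < e'" using e T by (simp add: e'_def)
    have "T * e' \<le> (T + 1) * e'" using e'0 by (intro mult_right_mono) auto
    also have "\<dots> = e / 5" unfolding e'_def using T by (subst times_divide_eq_right, subst nonzero_mult_div_cancel_left) simp_all
    also have "\<dots> < e / 4" using e by simp
    finally have e': "0 < e'" "T * e' < e / 4" using e'0 by simp_all
    obtain \<eta>' k0 where \<eta>': "0 < \<eta>'" and k0: "\<And>k n t J. k \<ge> k0 \<Longrightarrow> real n * h k \<le> \<eta>' \<Longrightarrow> t \<in> {0..T} \<Longrightarrow>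
        (\<Sum>j\<in>{-J..J}. h k * norm (U k t (j + int n) - U k t j)) \<le> e'"
      using space[OF e'(1)] by blast
    obtain m where m: "\<eta> m < \<eta>' / 2"
      using reals_Archimedean[of "\<eta>' / 2"] \<eta>' by (auto simp: \<eta>_def inverse_eq_divide)
    obtain n1 where n1: "\<And>n. n \<ge> n1 \<Longrightarrow> h (\<sigma> n) < \<eta>' / 2"
      using order_tendstoD(2)[OF h\<sigma> half_gt_zero[OF \<eta>']] unfolding eventually_sequentially by blast
    have close: "(\<integral>p. norm (S k p - B m k p) \<partial>P) < e / 4" if k: "k \<ge> max k0 n1" for k
    proof -
      have "(\<integral>p. norm (S k p - B m k p) \<partial>P) \<le> T * e'"
      proof (rule SB)
        fix n t J assume n: "n < K m (\<sigma> k)" and t: "t \<in> {0..T}"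
        have "real n * h (\<sigma> k) \<le> real (K m (\<sigma> k)) * h (\<sigma> k)" using n h(1)[of "\<sigma> k"] by (intro mult_right_mono) auto
        also have "\<dots> \<le> \<eta>'" using Ku[of m "\<sigma> k"] m n1[of k] k by simp
        finally show "(\<Sum>j\<in>{-J..J}. h (\<sigma> k) * norm (U (\<sigma> k) t (j + int n) - U (\<sigma> k) t j)) \<le> e'"
          using k seq_suble[OF \<sigma>, of k] t by (intro k0) auto
      qed (use e' in simp)
      then show ?thesis using e' by simp
    qed
    \<comment> \<open>For fixed \<open>m\<close> the averages converge at every point, hence in
      \<open>L1\<close> of the finite measure by dominated convergence.\<close>
    define B' where "B' p = lim (\<lambda>k. B m k p)" for p
    have Blim: "(\<lambda>k. B m k p) \<longlonglongrightarrow> B' p" for p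
    proof -
      have "convergent (\<lambda>k. B m k p)"
        using convergent[of "snd p" m "fst p"] by (cases "snd p \<in> {0..T}") (auto simp: B_def convergent_const)
      then show ?thesis unfolding B'_def by (simp add: convergent_LIMSEQ_iff)
    qed
    have B'm: "B' \<in> borel_measurable borel" by (rule borel_measurable_LIMSEQ_metric[OF Bm Blim])
    have B'b: "norm (B' p) \<le> M" for p by (rule LIMSEQ_le_const2[OF tendsto_norm[OF Blim]]) (simp add: Bb)
    have "(\<lambda>k. \<integral>p. norm (B m k p - B' p) \<partial>P) \<longlonglongrightarrow> (\<integral>p. 0 \<partial>P)"
    proof (rule integral_dominated_convergence[where w = "\<lambda>_. 2 * M"])
      show "(\<lambda>p. norm (B m k p - B' p)) \<in> borel_measurable P" for k
        using Bm B'm by (intro measP) measurable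
      show "AE p in P. (\<lambda>k. norm (B m k p - B' p)) \<longlonglongrightarrow> 0"
        by (intro AE_I2 tendsto_norm_zero LIM_zero Blim)
      show "AE p in P. norm (norm (B m k p - B' p)) \<le> 2 * M" for k
        using diffM[OF Bb B'b] by simp
    qed auto
    then have "\<forall>\<^sub>F k in sequentially. (\<integral>p. norm (B m k p - B' p) \<partial>P) < e / 4"
      by (rule order_tendstoD(2)) (use e in simp)
    then obtain n2 where n2: "\<And>k. k \<ge> n2 \<Longrightarrow> (\<integral>p. norm (B m k p - B' p) \<partial>P) < e / 4"
      unfolding eventually_sequentially by blast
    show ?thesis
    proof (intro exI[of _ "max (max k0 n1) n2"] allI impI)
      fix i j assume i: "max (max k0 n1) n2 \<le> i" and j: "max (max k0 n1) n2 \<le> j"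
      let ?d = "\<lambda>k p. norm (S k p - B m k p) + norm (B m k p - B' p)"
      have di: "integrable P (?d k)" for k
        by (intro Bochner_Integration.integrable_add dist_int Sm Bm B'm Sb Bb B'b)
      have "norm (S i p - S j p) \<le> ?d i p + ?d j p" for p
      proof -
        have "S i p - S j p = ((S i p - B m i p) + (B m i p - B' p)) - ((S j p - B m j p) + (B m j p - B' p))" by simp
        also have "norm \<dots> \<le> ?d i p + ?d j p"
          by (intro order_trans[OF norm_triangle_ineq4] add_mono norm_triangle_ineq)
        finally show ?thesis .
      qed
      then have "(\<integral>p. norm (S i p - S j p) \<partial>P) \<le> (\<integral>p. ?d i p + ?d j p \<partial>P)"
        by (intro integral_mono dist_int Sm Sb Bochner_Integration.integrable_add[OF di di])
      also have "\<dots> = ((\<integral>p. norm (S i p - B m i p) \<partial>P) + (\<integral>p. norm (B m i p - B' p) \<partial>P))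
          + ((\<integral>p. norm (S j p - B m j p) \<partial>P) + (\<integral>p. norm (B m j p - B' p) \<partial>P))"
        by (subst Bochner_Integration.integral_add[OF di di])
          (simp add: Bochner_Integration.integral_add dist_int Sm Bm B'm Sb Bb B'b)
      also have "\<dots> < e" using close[of i] close[of j] n2[of i] n2[of j] i j by simp
      finally show "(\<integral>p. norm (S i p - S j p) \<partial>P) < e" .
    qed
  qed
  then obtain r where r: "strict_mono (r :: nat \<Rightarrow> nat)" and AEc: "AE p in P. Cauchy (\<lambda>i. S (r i) p)"
    by (rule cauchy_L1_AE_cauchy_subseq[OF intP[OF Sm Sb]]) blast+
  define u where "u p = (if Cauchy (\<lambda>i. S (r i) p) then lim (\<lambda>i. S (r i) p) else 0)" for p
  have um: "u \<in> borel_measurable borel"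
  proof -
    have "{p \<in> space borel. Cauchy (\<lambda>i. S (r i) p)} \<in> sets borel" by (rule sets_Collect_Cauchy[OF Sm])
    then show ?thesis unfolding u_def by (intro measurable_If borel_measurable_lim_metric Sm) auto
  qed
  have ulim: "(\<lambda>i. S (r i) p) \<longlonglongrightarrow> u p" if "Cauchy (\<lambda>i. S (r i) p)" for p
    using that by (simp add: u_def Cauchy_convergent_iff convergent_LIMSEQ_iff)
  have ub: "norm (u p) \<le> M" for p
  proof (cases "Cauchy (\<lambda>i. S (r i) p)")
    case True
    show ?thesis by (rule LIMSEQ_le_const2[OF tendsto_norm[OF ulim[OF True]]]) (simp add: Sb)
  qed (use M in \<open>simp add: u_def\<close>)
  have "AE p in lborel. 0 < W p \<longrightarrow> Cauchy (\<lambda>i. S (r i) p)"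
    using AEc unfolding P_def AE_density[OF Wm] .
  then have "AE p in lborel. snd p \<in> {0..T} \<longrightarrow> (\<lambda>k. U ((\<sigma> \<circ> r) k) (snd p) (cell_index (h ((\<sigma> \<circ> r) k)) (fst p))) \<longlonglongrightarrow> u p"
  proof eventually_elim
    case (elim p)
    show ?case
    proof
      assume p: "snd p \<in> {0..T}"
      then have "0 < W p" using normal_density_pos[of 1 0 "fst p"] by (simp add: W_def)
      with elim have "Cauchy (\<lambda>i. S (r i) p)" by blast
      from ulim[OF this] show "(\<lambda>k. U ((\<sigma> \<circ> r) k) (snd p) (cell_index (h ((\<sigma> \<circ> r) k)) (fst p))) \<longlonglongrightarrow> u p"
        using p by (simp add: S_def)
    qed
  qed
  with strict_mono_o[OF \<sigma> r] um ub show thesis by (rule that)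
qed

subsection \<open>Continuity of translations in the mean\<close>

text \<open>The initial function is only Lebesgue measurable; a Borel version, built from versions
  of the coordinates, allows translations and product measures to be handled with
  \<open>lborel\<close>.\<close>

lemma lebesgue_measurable_borel_version:
  fixes f :: "real \<Rightarrow> 'a::euclidean_space"
  assumes "f \<in> borel_measurable lebesgue"
  obtains g where "g \<in> borel_measurable borel" "AE x in lborel. f x = g x"
proof -
  have "\<forall>b. \<exists>g'. g' \<in> borel_measurable lborel \<and> (AE x in lborel. f x \<bullet> b = g' x)"
  proof
    fix b
    have "(\<lambda>x. f x \<bullet> b) \<in> borel_measurable lebesgue" using assms by (intro borel_measurable_inner) simp_all
    from completion_ex_borel_measurable_real[OF this]
    show "\<exists>g'. g' \<in> borel_measurable lborel \<and> (AE x in lborel. f x \<bullet> b = g' x)" by blast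
  qed
  from choice[OF this] obtain g' where g': "\<And>b. g' b \<in> borel_measurable lborel" "\<And>b. AE x in lborel. f x \<bullet> b = g' b x"
    by blast
  show thesis
  proof
    show "(\<lambda>x. \<Sum>b\<in>Basis. g' b x *\<^sub>R b) \<in> borel_measurable borel"
      using g'(1) by simp
    have "AE x in lborel. \<forall>b\<in>Basis. f x \<bullet> b = g' b x" using g'(2) by (simp add: AE_finite_all)
    then show "AE x in lborel. f x = (\<Sum>b\<in>Basis. g' b x *\<^sub>R b)"
    proof eventually_elim
      case (elim x)
      have "f x = (\<Sum>b\<in>Basis. (f x \<bullet> b) *\<^sub>R b)" by (rule euclidean_representation[symmetric])
      then show ?case using elim by simp
    qed
  qed
qed

lemma integrable_lborel_translate:
  fixes f :: "real \<Rightarrow> 'a::{banach, second_countable_topology}"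
  assumes "integrable lborel f"
  shows "integrable lborel (\<lambda>x. f (x + s))"
  using lborel_integrable_real_affine[OF assms, of 1 s] by (simp add: add.commute)

lemma integral_lborel_translate:
  fixes f :: "real \<Rightarrow> 'a::{banach, second_countable_topology}"
  shows "(\<integral>x. f (x + s) \<partial>lborel) = (\<integral>x. f x \<partial>lborel)"
  using lborel_integral_real_affine[of 1 f s] by (simp add: add.commute)

definition L1_translation_continuous :: "(real \<Rightarrow> 'a::{banach, second_countable_topology}) \<Rightarrow> bool" where
  "L1_translation_continuous f \<longleftrightarrow>
    (\<forall>e>0. \<exists>d>0. \<forall>s. \<bar>s\<bar> < d \<longrightarrow> (\<integral>x. norm (f (x + s) - f x) \<partial>lborel) \<le> e)"

text \<open>An \<open>e / 3\<close> argument: by translation invariance the shifted approximation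
  error has the same integral as the unshifted one. The factor 2 in \<open>le\<close> is that of the
  approximations supplied by \<open>integrable_induct\<close>.\<close>

lemma L1_translation_continuous_limit:
  fixes f :: "real \<Rightarrow> 'a::{banach, second_countable_topology}"
  assumes s: "\<And>i. integrable lborel (s i)" "\<And>i. L1_translation_continuous (s i)"
    and lim: "\<And>x. (\<lambda>i. s i x) \<longlonglongrightarrow> f x" and le: "\<And>i x. norm (s i x) \<le> 2 * norm (f x)"
    and f: "integrable lborel f"
  shows "L1_translation_continuous f"
  unfolding L1_translation_continuous_def
proof (intro allI impI)
  fix e :: real assume e: "0 < e"
  have "(\<lambda>i. \<integral>x. norm (s i x - f x) \<partial>lborel) \<longlonglongrightarrow> (\<integral>x. 0 \<partial>(lborel :: real measure))"
  proof (rule integral_dominated_convergence[where w = "\<lambda>x. 3 * norm (f x)"])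
    show "(\<lambda>x. norm (s i x - f x)) \<in> borel_measurable lborel" for i
      using s(1)[of i] f by measurable
    show "AE x in lborel. (\<lambda>i. norm (s i x - f x)) \<longlonglongrightarrow> 0"
      by (intro AE_I2 tendsto_norm_zero LIM_zero lim)
    show "AE x in lborel. norm (norm (s i x - f x)) \<le> 3 * norm (f x)" for i
    proof (intro AE_I2)
      fix x
      show "norm (norm (s i x - f x)) \<le> 3 * norm (f x)"
        using norm_triangle_ineq4[of "s i x" "f x"] le[of i x] by simp
    qed
  qed (use f in auto)
  then have "\<forall>\<^sub>F i in sequentially. (\<integral>x. norm (s i x - f x) \<partial>lborel) < e / 3"
    by (rule order_tendstoD(2)) (use e in simp)
  then obtain i where i: "(\<integral>x. norm (s i x - f x) \<partial>lborel) < e / 3"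
    unfolding eventually_sequentially by blast
  have "0 < e / 3" using e by simp
  then obtain d where d: "0 < d" "\<And>y. \<bar>y\<bar> < d \<Longrightarrow> (\<integral>x. norm (s i (x + y) - s i x) \<partial>lborel) \<le> e / 3"
    using s(2)[of i] unfolding L1_translation_continuous_def by blast
  have "(\<integral>x. norm (f (x + y) - f x) \<partial>lborel) \<le> e" if y: "\<bar>y\<bar> < d" for y
  proof -
    have I1: "integrable lborel (\<lambda>x. norm (s i x - f x))" using s(1) f by simp
    have I2: "integrable lborel (\<lambda>x. norm (s i (x + y) - f (x + y)))" by (rule integrable_lborel_translate[OF I1])
    have I3: "integrable lborel (\<lambda>x. norm (s i (x + y) - s i x))"
      using s(1) integrable_lborel_translate[OF s(1)] by simp
    have "(\<integral>x. norm (f (x + y) - f x) \<partial>lborel)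
      \<le> (\<integral>x. norm (s i (x + y) - f (x + y)) + norm (s i (x + y) - s i x) + norm (s i x - f x) \<partial>lborel)"
    proof (rule integral_mono)
      show "integrable lborel (\<lambda>x. norm (f (x + y) - f x))"
        using f integrable_lborel_translate[OF f] by simp
      fix x
      have "f (x + y) - f x = - (s i (x + y) - f (x + y)) + (s i (x + y) - s i x) + (s i x - f x)" by simp
      also have "norm \<dots> \<le> norm (- (s i (x + y) - f (x + y))) + norm (s i (x + y) - s i x) + norm (s i x - f x)"
        by (intro order_trans[OF norm_triangle_ineq] add_mono norm_triangle_ineq order_refl)
      finally show "norm (f (x + y) - f x) \<le> norm (s i (x + y) - f (x + y)) + norm (s i (x + y) - s i x) + norm (s i x - f x)"
        unfolding norm_minus_cancel .
    qed (intro Bochner_Integration.integrable_add I1 I2 I3)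
    also have "\<dots> = (\<integral>x. norm (s i (x + y) - f (x + y)) \<partial>lborel) + (\<integral>x. norm (s i (x + y) - s i x) \<partial>lborel)
        + (\<integral>x. norm (s i x - f x) \<partial>lborel)"
      by (simp only: Bochner_Integration.integral_add Bochner_Integration.integrable_add I1 I2 I3)
    also have "(\<integral>x. norm (s i (x + y) - f (x + y)) \<partial>lborel) = (\<integral>x. norm (s i x - f x) \<partial>lborel)"
      by (rule integral_lborel_translate)
    finally show ?thesis using i d(2)[OF y] by simp
  qed
  then show "\<exists>d>0. \<forall>s. \<bar>s\<bar> < d \<longrightarrow> (\<integral>x. norm (f (x + s) - f x) \<partial>lborel) \<le> e" using d(1) by blast
qed

text \<open>\<open>A\<close> is enclosed between a compact \<open>K\<close> and an open
  \<open>V\<close> of nearly the same measure. For shifts so short that they cannot lead from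
  \<open>K\<close> out of \<open>V\<close>, exactly one of a point and its translate can lie in
  \<open>A\<close> only if one of them lies in \<open>V - K\<close>.\<close>

lemma L1_translation_continuous_bounded_set:
  fixes c :: "'a::{banach, second_countable_topology}"
  assumes A: "A \<in> sets borel" "bounded A"
  shows "L1_translation_continuous (\<lambda>x::real. indicator A x *\<^sub>R c)"
  unfolding L1_translation_continuous_def
proof (intro allI impI)
  fix e :: real assume e: "0 < e"
  define \<epsilon> where "\<epsilon> = e / (4 * (norm c + 1))"
  have c1: "0 < norm c + 1" by (simp add: add_nonneg_pos)
  have \<epsilon>: "0 < \<epsilon>" using e c1 by (simp add: \<epsilon>_def)
  have A': "A \<in> sets lebesgue" using A by simp
  obtain K where K: "closed K" "K \<subseteq> A" "A - K \<in> lmeasurable" "emeasure lebesgue (A - K) < ennreal \<epsilon>"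
    by (rule sets_lebesgue_inner_closed[OF A' \<epsilon>])
  obtain V where V: "open V" "A \<subseteq> V" "V - A \<in> lmeasurable" "emeasure lebesgue (V - A) < ennreal \<epsilon>"
    by (rule sets_lebesgue_outer_open[OF A' \<epsilon>])
  have "compact K" using K A by (meson bounded_subset compact_eq_bounded_closed)
  then obtain d where d: "0 < d" "(\<Union>x\<in>K. ball x d) \<subseteq> V"
    by (rule compact_subset_open_imp_ball_epsilon_subset[of K V]) (use K V in auto)
  define D where "D = V - K"
  have Dm: "D \<in> sets borel" using K V by (simp add: D_def)
  have "emeasure lborel D \<le> emeasure lborel ((V - A) \<union> (A - K))"
    using K V A by (intro emeasure_mono) (auto simp: D_def)
  also have "\<dots> \<le> emeasure lborel (V - A) + emeasure lborel (A - K)"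
    using K V A by (intro emeasure_subadditive) auto
  also have "\<dots> \<le> ennreal \<epsilon> + ennreal \<epsilon>"
    using K(1,4) V(1,4) A by (intro add_mono) (simp_all add: less_imp_le)
  also have "\<dots> = ennreal (2 * \<epsilon>)" using \<epsilon> by (simp add: ennreal_plus[symmetric] del: ennreal_plus)
  finally have De: "emeasure lborel D \<le> ennreal (2 * \<epsilon>)" .
  have Dfin: "emeasure lborel D < \<infinity>" using De by (rule le_less_trans) simp
  have Dmeas: "measure lborel D \<le> 2 * \<epsilon>" using De \<epsilon> by (simp add: measure_def enn2real_leI)
  have ID: "integrable lborel (indicator D :: real \<Rightarrow> real)" using Dm Dfin by simp
  have "(\<integral>x. norm (indicator A (x + s) *\<^sub>R c - indicator A x *\<^sub>R c) \<partial>lborel) \<le> e" if s: "\<bar>s\<bar> < d" for s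
  proof -
    have in_V: "y \<in> V" if "x \<in> K" "\<bar>y - x\<bar> < d" for x y
    proof -
      have "y \<in> ball x d" using that(2) by (simp add: dist_real_def abs_minus_commute)
      then show ?thesis using d(2) that(1) by blast
    qed
    have "(\<integral>x. norm (indicator A (x + s) *\<^sub>R c - indicator A x *\<^sub>R c) \<partial>lborel)
       \<le> (\<integral>x. norm c * (indicator D x + indicator D (x + s)) \<partial>lborel)"
    proof (rule integral_mono_AE')
      show "integrable lborel (\<lambda>x. norm c * (indicator D x + indicator D (x + s)))"
        using ID integrable_lborel_translate[OF ID, of s] by (intro integrable_mult_right Bochner_Integration.integrable_add)
      show "AE x in lborel. norm (indicator A (x + s) *\<^sub>R c - indicator A x *\<^sub>R c) \<le> norm c * (indicator D x + indicator D (x + s))"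
      proof (intro AE_I2)
        fix x :: real
        have "x \<in> D \<or> x + s \<in> D" if "(x \<in> A) \<noteq> (x + s \<in> A)"
        proof -
          have "x \<in> K \<Longrightarrow> x + s \<in> V" "x + s \<in> K \<Longrightarrow> x \<in> V"
            using in_V[of x "x + s"] in_V[of "x + s" x] s by simp_all
          then show ?thesis using that K(2) V(2) unfolding D_def by blast
        qed
        then show "norm (indicator A (x + s) *\<^sub>R c - indicator A x *\<^sub>R c) \<le> norm c * (indicator D x + indicator D (x + s))"
          by (cases "x \<in> A"; cases "x + s \<in> A"; cases "x \<in> D"; cases "x + s \<in> D") simp_all
      qed
    qed auto
    also have "\<dots> = norm c * ((\<integral>x. indicator D x \<partial>lborel) + (\<integral>x. indicator D (x + s) \<partial>lborel))"
      using ID integrable_lborel_translate[OF ID, of s] by (simp add: Bochner_Integration.integral_add)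
    also have "(\<integral>x. indicator D (x + s) \<partial>lborel) = (\<integral>x. indicator D x \<partial>lborel :: real)"
      by (rule integral_lborel_translate)
    also have "norm c * ((\<integral>x. indicator D x \<partial>lborel) + (\<integral>x. indicator D x \<partial>lborel)) = norm c * (2 * measure lborel D)"
      by simp
    also have "\<dots> \<le> (norm c + 1) * (2 * (2 * \<epsilon>))" using Dmeas \<epsilon> by (intro mult_mono) auto
    also have "\<dots> = e" using c1 by (simp add: \<epsilon>_def field_simps)
    finally show ?thesis .
  qed
  then show "\<exists>d>0. \<forall>s. \<bar>s\<bar> < d \<longrightarrow> (\<integral>x. norm (indicator A (x + s) *\<^sub>R c - indicator A x *\<^sub>R c) \<partial>lborel) \<le> e"
    using d(1) by blast
qed

lemma integrable_imp_L1_translation_continuous: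
  fixes f :: "real \<Rightarrow> 'a::{banach, second_countable_topology}"
  assumes "integrable lborel f"
  shows "L1_translation_continuous f"
  using assms
proof (induction rule: integrable_induct)
  case (base A c)
  \<comment> \<open>A set of finite measure need not be bounded, but the approximation from inside
    by a compact set requires this; hence the truncation.\<close>
  let ?s = "\<lambda>(n::nat) x. indicator (A \<inter> {-real n..real n}) x *\<^sub>R c"
  have A: "A \<in> sets borel" using base by simp
  show ?case
  proof (rule L1_translation_continuous_limit[of ?s])
    have fin: "emeasure lborel (A \<inter> {-real n..real n}) < \<infinity>" for n
    proof -
      have "emeasure lborel (A \<inter> {-real n..real n}) \<le> emeasure lborel A" using A by (intro emeasure_mono) auto
      then show ?thesis using base(2) by (rule le_less_trans)
    qed
    show "integrable lborel (?s n)" for n using A fin by (intro integrable_scaleR_left integrable_real_indicator) auto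
    show "L1_translation_continuous (?s n)" for n
      using A by (intro L1_translation_continuous_bounded_set) (auto intro: bounded_subset[OF bounded_closed_interval])
    show "(\<lambda>n. ?s n x) \<longlonglongrightarrow> indicator A x *\<^sub>R c" for x
    proof (rule tendsto_eventually)
      obtain N where N: "\<bar>x\<bar> \<le> real N" using real_arch_simple by blast
      show "\<forall>\<^sub>F n in sequentially. ?s n x = indicator A x *\<^sub>R c"
        unfolding eventually_sequentially
      proof (intro exI[of _ N] allI impI)
        fix n assume "N \<le> n"
        then have "x \<in> {-real n..real n}" using N by auto
        then show "?s n x = indicator A x *\<^sub>R c" by (simp add: indicator_def)
      qed
    qed
    show "norm (?s n x) \<le> 2 * norm (indicator A x *\<^sub>R c)" for n x
      by (simp add: indicator_def)
    show "integrable lborel (\<lambda>x. indicator A x *\<^sub>R c)"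
      using base by (intro integrable_scaleR_left integrable_real_indicator) auto
  qed
next
  case (add f g)
  show ?case unfolding L1_translation_continuous_def
  proof (intro allI impI)
    fix e :: real assume "0 < e"
    then have e: "0 < e / 2" by simp
    obtain d1 where d1: "0 < d1" "\<And>s. \<bar>s\<bar> < d1 \<Longrightarrow> (\<integral>x. norm (f (x + s) - f x) \<partial>lborel) \<le> e / 2"
      using add(3) e unfolding L1_translation_continuous_def by blast
    obtain d2 where d2: "0 < d2" "\<And>s. \<bar>s\<bar> < d2 \<Longrightarrow> (\<integral>x. norm (g (x + s) - g x) \<partial>lborel) \<le> e / 2"
      using add(4) e unfolding L1_translation_continuous_def by blast
    have "(\<integral>x. norm (f (x + s) + g (x + s) - (f x + g x)) \<partial>lborel) \<le> e" if s: "\<bar>s\<bar> < min d1 d2" for s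
    proof -
      have I: "integrable lborel (\<lambda>x. norm (f (x + s) - f x))" "integrable lborel (\<lambda>x. norm (g (x + s) - g x))"
        using add(1,2) integrable_lborel_translate[OF add(1)] integrable_lborel_translate[OF add(2)] by simp_all
      have "(\<integral>x. norm (f (x + s) + g (x + s) - (f x + g x)) \<partial>lborel)
          \<le> (\<integral>x. norm (f (x + s) - f x) + norm (g (x + s) - g x) \<partial>lborel)"
      proof (rule integral_mono)
        show "integrable lborel (\<lambda>x. norm (f (x + s) + g (x + s) - (f x + g x)))"
          using add(1,2) integrable_lborel_translate[OF add(1)] integrable_lborel_translate[OF add(2)] by simp
      qed (use I in \<open>auto intro: norm_diff_triangle_ineq\<close>)
      also have "\<dots> = (\<integral>x. norm (f (x + s) - f x) \<partial>lborel) + (\<integral>x. norm (g (x + s) - g x) \<partial>lborel)"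
        by (rule Bochner_Integration.integral_add[OF I])
      finally show ?thesis using d1(2)[of s] d2(2)[of s] s by simp
    qed
    then show "\<exists>d>0. \<forall>s. \<bar>s\<bar> < d \<longrightarrow> (\<integral>x. norm (f (x + s) + g (x + s) - (f x + g x)) \<partial>lborel) \<le> e"
      using d1(1) d2(1) by (intro exI[of _ "min d1 d2"]) simp
  qed
next
  case (lim f s)
  then show ?case by (intro L1_translation_continuous_limit[of s f]) simp_all
qed

subsection \<open>Cell averages\<close>

definition cell_avg :: "real \<Rightarrow> (real \<Rightarrow> 'a::{banach, second_countable_topology}) \<Rightarrow> int \<Rightarrow> 'a" where
  "cell_avg h f j = (1 / h) *\<^sub>R (LINT x:cell h j|lborel. f x)"

lemma cell_borel [measurable]: "cell h j \<in> sets borel"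
  by (simp add: cell_def)

lemma integrable_cell:
  fixes f :: "real \<Rightarrow> 'a::{banach, second_countable_topology}"
  assumes "integrable lborel f"
  shows "integrable lborel (\<lambda>x. indicator (cell h j) x *\<^sub>R f x)"
  using integrable_mult_indicator[of "cell h j" lborel f] assms by simp

lemma cell_integral_scale:
  assumes "0 < h"
  shows "h *\<^sub>R cell_avg h f j = (LINT x:cell h j|lborel. f x)"
  using assms by (simp add: cell_avg_def)

lemma sum_norm_cell_integral_le:
  fixes f :: "real \<Rightarrow> 'a::{banach, second_countable_topology}"
  assumes h: "0 < h" and f: "integrable lborel f" and A: "finite A"
  shows "(\<Sum>j\<in>A. norm (LINT x:cell h j|lborel. f x)) \<le> (\<integral>x. norm (f x) \<partial>lborel)"
proof -
  have n: "integrable lborel (\<lambda>x. norm (f x))" using f by simp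
  have In: "integrable lborel (\<lambda>x. indicator (cell h j) x * norm (f x))" for j
    using integrable_cell[OF n, of h j] by simp
  have "(\<Sum>j\<in>A. norm (LINT x:cell h j|lborel. f x)) \<le> (\<Sum>j\<in>A. \<integral>x. indicator (cell h j) x * norm (f x) \<partial>lborel)"
  proof (rule sum_mono)
    fix j
    show "norm (LINT x:cell h j|lborel. f x) \<le> (\<integral>x. indicator (cell h j) x * norm (f x) \<partial>lborel)"
      using integral_norm_bound[of lborel "\<lambda>x. indicator (cell h j) x *\<^sub>R f x"]
      unfolding set_lebesgue_integral_def by simp
  qed
  also have "\<dots> = (\<integral>x. (\<Sum>j\<in>A. indicator (cell h j) x * norm (f x)) \<partial>lborel)"
    by (rule Bochner_Integration.integral_sum[symmetric]) (rule In)
  also have "\<dots> \<le> (\<integral>x. norm (f x) \<partial>lborel)"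
  proof (rule integral_mono)
    show "integrable lborel (\<lambda>x. \<Sum>j\<in>A. indicator (cell h j) x * norm (f x))"
      by (intro Bochner_Integration.integrable_sum In)
    fix x
    have "(\<Sum>j\<in>A. indicator (cell h j) x * norm (f x)) = (\<Sum>j\<in>A. if j = cell_index h x then norm (f x) else 0)"
      by (intro sum.cong) (auto simp: indicator_def in_cell_iff[OF h])
    also have "\<dots> \<le> norm (f x)" using A by (simp add: sum.delta)
    finally show "(\<Sum>j\<in>A. indicator (cell h j) x * norm (f x)) \<le> norm (f x)" .
  qed (rule n)
  finally show ?thesis .
qed

lemma sum_cell_avg_le:
  fixes f :: "real \<Rightarrow> 'a::{banach, second_countable_topology}"
  assumes h: "0 < h" and f: "integrable lborel f" and A: "finite A"
  shows "(\<Sum>j\<in>A. h * norm (cell_avg h f j)) \<le> (\<integral>x. norm (f x) \<partial>lborel)"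
proof -
  have "h * norm (cell_avg h f j) = norm (LINT x:cell h j|lborel. f x)" for j
    unfolding cell_integral_scale[OF h, symmetric] using h by simp
  then show ?thesis using sum_norm_cell_integral_le[OF assms] by simp
qed

lemma in_cell_shift: "x + real n * h \<in> cell h (j + int n) \<longleftrightarrow> x \<in> cell h j"
  by (simp add: cell_def algebra_simps)

text \<open>Shifting the averages by \<open>n\<close> cells is averaging the translate of
  \<open>f\<close> by \<open>n * h\<close>, so the differences sum to at most the L1 modulus of
  continuity of \<open>f\<close>.\<close>

lemma sum_cell_avg_translation_le:
  fixes f :: "real \<Rightarrow> 'a::{banach, second_countable_topology}"
  assumes h: "0 < h" and f: "integrable lborel f" and A: "finite A"
  shows "(\<Sum>j\<in>A. h * norm (cell_avg h f (j + int n) - cell_avg h f j))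
    \<le> (\<integral>x. norm (f (x + real n * h) - f x) \<partial>lborel)"
proof -
  let ?s = "real n * h"
  have fs: "integrable lborel (\<lambda>x. f (x + ?s))" by (rule integrable_lborel_translate[OF f])
  have "h * norm (cell_avg h f (j + int n) - cell_avg h f j) = norm (LINT x:cell h j|lborel. f (x + ?s) - f x)" for j
  proof -
    have "(LINT x:cell h (j + int n)|lborel. f x) = (\<integral>x. indicator (cell h (j + int n)) (x + ?s) *\<^sub>R f (x + ?s) \<partial>lborel)"
      unfolding set_lebesgue_integral_def by (rule integral_lborel_translate[symmetric])
    also have "\<dots> = (\<integral>x. indicator (cell h j) x *\<^sub>R f (x + ?s) \<partial>lborel)"
      by (simp add: indicator_def in_cell_shift)
    finally have "(LINT x:cell h (j + int n)|lborel. f x) - (LINT x:cell h j|lborel. f x)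
        = (\<integral>x. indicator (cell h j) x *\<^sub>R f (x + ?s) \<partial>lborel) - (\<integral>x. indicator (cell h j) x *\<^sub>R f x \<partial>lborel)"
      by (simp add: set_lebesgue_integral_def)
    also have "\<dots> = (\<integral>x. indicator (cell h j) x *\<^sub>R f (x + ?s) - indicator (cell h j) x *\<^sub>R f x \<partial>lborel)"
      by (rule Bochner_Integration.integral_diff[symmetric]) (intro integrable_cell fs f)+
    finally have "h *\<^sub>R (cell_avg h f (j + int n) - cell_avg h f j) = (LINT x:cell h j|lborel. f (x + ?s) - f x)"
      unfolding scaleR_diff_right cell_integral_scale[OF h] by (simp add: set_lebesgue_integral_def scaleR_diff_right)
    from arg_cong[OF this, of norm] show ?thesis using h by simp
  qed
  then show ?thesis using sum_norm_cell_integral_le[OF h _ A, of "\<lambda>x. f (x + ?s) - f x"] f fs by simp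
qed

lemma norm_cell_avg_le:
  fixes f :: "real \<Rightarrow> 'a::{banach, second_countable_topology}"
  assumes h: "0 < h" and f: "integrable lborel f" and le: "AE x in lborel. norm (f x) \<le> M" and "0 \<le> M"
  shows "norm (cell_avg h f j) \<le> M"
proof -
  have "norm (LINT x:cell h j|lborel. f x) \<le> (\<integral>x. norm (indicator (cell h j) x *\<^sub>R f x) \<partial>lborel)"
    unfolding set_lebesgue_integral_def by (rule integral_norm_bound)
  also have "\<dots> \<le> (\<integral>x. M * indicator (cell h j) x \<partial>lborel)"
  proof (rule integral_mono_AE)
    show "integrable lborel (\<lambda>x. norm (indicator (cell h j) x *\<^sub>R f x))"
      by (rule integrable_norm[OF integrable_cell[OF f]])
    show "integrable lborel (\<lambda>x. M * indicator (cell h j) x)"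
      by (intro integrable_mult_right integrable_real_indicator) (auto simp: emeasure_cell[OF h])
    show "AE x in lborel. norm (indicator (cell h j) x *\<^sub>R f x) \<le> M * indicator (cell h j) x"
      using le by eventually_elim (auto simp: indicator_def)
  qed
  also have "\<dots> = M * h" using h by (simp add: measure_def emeasure_cell[OF h])
  finally have "norm (LINT x:cell h j|lborel. f x) \<le> M * h" .
  then show ?thesis using h by (simp add: cell_avg_def divide_le_eq)
qed

text \<open>Convexity of the cone, in the form of the triangle inequality for integrals.\<close>

lemma cell_avg_cone:
  fixes f :: "real \<Rightarrow> 'a::euclidean_space"
  assumes h: "0 < h" and f: "integrable lborel f" and le: "AE x in lborel. \<delta> * norm (f x) \<le> e \<bullet> f x" and \<delta>: "0 \<le> \<delta>"
  shows "\<delta> * norm (cell_avg h f j) \<le> e \<bullet> cell_avg h f j"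
proof -
  let ?f = "\<lambda>x. indicator (cell h j) x *\<^sub>R f x"
  have I: "integrable lborel ?f" by (rule integrable_cell[OF f])
  have "\<delta> * norm (\<integral>x. ?f x \<partial>lborel) \<le> \<delta> * (\<integral>x. norm (?f x) \<partial>lborel)"
    using \<delta> by (intro mult_left_mono integral_norm_bound)
  also have "\<dots> = (\<integral>x. \<delta> * norm (?f x) \<partial>lborel)" by simp
  also have "\<dots> \<le> (\<integral>x. e \<bullet> ?f x \<partial>lborel)"
  proof (rule integral_mono_AE)
    show "integrable lborel (\<lambda>x. \<delta> * norm (?f x))" by (intro integrable_mult_right integrable_norm I)
    show "integrable lborel (\<lambda>x. e \<bullet> ?f x)" by (intro integrable_inner_right I)
    show "AE x in lborel. \<delta> * norm (?f x) \<le> e \<bullet> ?f x"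
      using le by eventually_elim (auto simp: indicator_def)
  qed
  also have "\<dots> = e \<bullet> (\<integral>x. ?f x \<partial>lborel)" using I by (intro integral_inner_right) auto
  finally have "(1 / h) * (\<delta> * norm (\<integral>x. ?f x \<partial>lborel)) \<le> (1 / h) * (e \<bullet> (\<integral>x. ?f x \<partial>lborel))"
    using h by (intro mult_left_mono) auto
  then show ?thesis using h by (simp add: cell_avg_def set_lebesgue_integral_def)
qed

text \<open>Replacing \<open>\<psi>\<close> by its values at the cell centres costs \<open>B * h\<close>, and \<open>f\<close> and its averages have the
  same integral over every cell.\<close>

lemma cell_avg_weak_error:
  fixes f :: "real \<Rightarrow> 'a::{banach, second_countable_topology}" and \<psi> :: "real \<Rightarrow> real"
  assumes h: "0 < h" and f: "integrable lborel f" and \<psi>m: "\<psi> \<in> borel_measurable borel"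
    and \<psi>b: "\<And>x. \<bar>\<psi> x\<bar> \<le> P" and lip: "\<And>x y. \<bar>\<psi> x - \<psi> y\<bar> \<le> B * \<bar>x - y\<bar>" and B: "0 \<le> B"
    and supp: "\<And>x. X < \<bar>x\<bar> \<Longrightarrow> \<psi> x = 0"
  shows "integrable lborel (\<lambda>x. \<psi> x *\<^sub>R cell_avg h f (cell_index h x))"
    and "norm ((\<integral>x. \<psi> x *\<^sub>R cell_avg h f (cell_index h x) \<partial>lborel) - (\<integral>x. \<psi> x *\<^sub>R f x \<partial>lborel))
      \<le> B * h * (2 * (\<integral>x. norm (f x) \<partial>lborel))"
proof -
  define w where "w x = cell_avg h f (cell_index h x)" for x
  define m where "m = (\<integral>x. norm (f x) \<partial>lborel)"
  have m: "0 \<le> m" by (simp add: m_def)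
  have wm: "w \<in> borel_measurable borel"
    unfolding w_def by (rule measurable_compose[OF cell_index_measurable]) simp
  have nn: "(\<integral>\<^sup>+x. ennreal (norm (w x)) \<partial>lborel) \<le> ennreal m"
    unfolding w_def m_def by (rule nn_integral_step_le[OF h]) (auto intro: sum_cell_avg_le[OF h f])
  have w: "integrable lborel w" using wm le_less_trans[OF nn] by (intro integrableI_bounded) auto
  have wle: "(\<integral>x. norm (w x) \<partial>lborel) \<le> m" by (rule integral_real_bounded[OF m nn])
  have mult: "integrable lborel (\<lambda>x. q x *\<^sub>R k x)"
    if "q \<in> borel_measurable borel" "\<And>x. \<bar>q x\<bar> \<le> b" "integrable lborel k" for q :: "real \<Rightarrow> real" and k :: "real \<Rightarrow> 'a" and b
  proof (rule Bochner_Integration.integrable_bound[where f = "\<lambda>x. b * norm (k x)"])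
    show "integrable lborel (\<lambda>x. b * norm (k x))" using that(3) by simp
    show "(\<lambda>x. q x *\<^sub>R k x) \<in> borel_measurable lborel"
      using that(1) borel_measurable_integrable[OF that(3)] by (intro borel_measurable_scaleR) simp_all
    have "\<bar>q x\<bar> * norm (k x) \<le> \<bar>b\<bar> * norm (k x)" for x
      using that(2)[of x] by (intro mult_right_mono) auto
    then show "AE x in lborel. norm (q x *\<^sub>R k x) \<le> norm (b * norm (k x))"
      by (intro AE_I2) (simp add: abs_mult)
  qed
  show I\<psi>w: "integrable lborel (\<lambda>x. \<psi> x *\<^sub>R cell_avg h f (cell_index h x))"
    using mult[OF \<psi>m \<psi>b w] by (simp add: w_def)
  define \<psi>h where "\<psi>h x = \<psi> (real_of_int (cell_index h x) * h)" for x
  have \<psi>hm: "\<psi>h \<in> borel_measurable borel"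
    unfolding \<psi>h_def by (rule measurable_compose[OF cell_index_measurable]) simp
  have near: "\<bar>\<psi> x - \<psi>h x\<bar> \<le> B * h" for x
  proof -
    have "x \<in> cell h (cell_index h x)" using in_cell_iff[OF h] by simp
    then have "\<bar>x - real_of_int (cell_index h x) * h\<bar> \<le> h" using h by (auto simp: cell_def abs_le_iff)
    from mult_left_mono[OF this B] show ?thesis unfolding \<psi>h_def using lip[of x "real_of_int (cell_index h x) * h"] by linarith
  qed
  have wf: "integrable lborel (\<lambda>x. w x - f x)" using w f by simp
  have zero: "(\<integral>x. \<psi>h x *\<^sub>R (w x - f x) \<partial>lborel) = 0"
  proof -
    \<comment> \<open>The cell centres with index outside \<open>{-J..J}\<close> lie beyond the
      support, which makes the sum over the cells finite.\<close>
    define J where "J = \<lceil>\<bar>X\<bar> / h\<rceil>"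
    have out: "\<psi> (real_of_int j * h) = 0" if "j \<notin> {-J..J}" for j
    proof -
      have "\<bar>X\<bar> / h < real_of_int \<bar>j\<bar>"
      proof -
        have "J < \<bar>j\<bar>" using that by auto
        then show ?thesis unfolding J_def by linarith
      qed
      then have "\<bar>X\<bar> < real_of_int \<bar>j\<bar> * h" using h by (simp add: divide_less_eq)
      then have "X < \<bar>real_of_int j * h\<bar>" using h by (simp add: abs_mult)
      then show ?thesis by (rule supp)
    qed
    have "\<psi>h x *\<^sub>R (w x - f x) = (\<Sum>j\<in>{-J..J}. \<psi> (real_of_int j * h) *\<^sub>R (indicator (cell h j) x *\<^sub>R (w x - f x)))" for x
    proof -
      have "(\<Sum>j\<in>{-J..J}. \<psi> (real_of_int j * h) *\<^sub>R (indicator (cell h j) x *\<^sub>R (w x - f x)))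
        = (\<Sum>j\<in>{-J..J}. if j = cell_index h x then \<psi>h x *\<^sub>R (w x - f x) else 0)"
        by (intro sum.cong) (auto simp: indicator_def in_cell_iff[OF h] \<psi>h_def)
      also have "\<dots> = \<psi>h x *\<^sub>R (w x - f x)"
        using out[of "cell_index h x"] by (simp add: sum.delta \<psi>h_def)
      finally show ?thesis ..
    qed
    then have "(\<integral>x. \<psi>h x *\<^sub>R (w x - f x) \<partial>lborel)
        = (\<integral>x. (\<Sum>j\<in>{-J..J}. \<psi> (real_of_int j * h) *\<^sub>R (indicator (cell h j) x *\<^sub>R (w x - f x))) \<partial>lborel)"
      by (simp only:)
    also have "\<dots> = (\<Sum>j\<in>{-J..J}. \<integral>x. \<psi> (real_of_int j * h) *\<^sub>R (indicator (cell h j) x *\<^sub>R (w x - f x)) \<partial>lborel)"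
      by (intro Bochner_Integration.integral_sum integrable_scaleR_right integrable_cell wf)
    also have "\<dots> = (\<Sum>j\<in>{-J..J}. \<psi> (real_of_int j * h) *\<^sub>R (\<integral>x. indicator (cell h j) x *\<^sub>R (w x - f x) \<partial>lborel))"
      by (intro sum.cong refl integral_scaleR_right integrable_cell wf)
    also have "\<dots> = 0"
    proof (intro sum.neutral ballI)
      fix j
      have "(\<integral>x. indicator (cell h j) x *\<^sub>R w x \<partial>lborel) = (\<integral>x. indicator (cell h j) x *\<^sub>R cell_avg h f j \<partial>lborel)"
        by (intro Bochner_Integration.integral_cong) (auto simp: indicator_def in_cell_iff[OF h] w_def)
      also have "\<dots> = h *\<^sub>R cell_avg h f j"
        using h by (subst integral_scaleR_left) (auto simp: measure_def emeasure_cell[OF h])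
      also have "\<dots> = (\<integral>x. indicator (cell h j) x *\<^sub>R f x \<partial>lborel)"
        unfolding cell_integral_scale[OF h] set_lebesgue_integral_def ..
      finally have "(\<integral>x. indicator (cell h j) x *\<^sub>R (w x - f x) \<partial>lborel) = 0"
        by (simp add: scaleR_diff_right Bochner_Integration.integral_diff integrable_cell[OF w] integrable_cell[OF f])
      then show "\<psi> (real_of_int j * h) *\<^sub>R (\<integral>x. indicator (cell h j) x *\<^sub>R (w x - f x) \<partial>lborel) = 0" by simp
    qed
    finally show ?thesis .
  qed
  have \<psi>hb: "\<bar>\<psi>h x\<bar> \<le> P" for x unfolding \<psi>h_def by (rule \<psi>b)
  have dm: "(\<lambda>x. \<psi> x - \<psi>h x) \<in> borel_measurable borel" using \<psi>m \<psi>hm by simp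
  have "(\<integral>x. \<psi> x *\<^sub>R w x \<partial>lborel) - (\<integral>x. \<psi> x *\<^sub>R f x \<partial>lborel) = (\<integral>x. \<psi> x *\<^sub>R (w x - f x) \<partial>lborel)"
    unfolding scaleR_diff_right by (rule Bochner_Integration.integral_diff[symmetric]) (intro mult[OF \<psi>m \<psi>b] w f)+
  also have "\<dots> = (\<integral>x. \<psi> x *\<^sub>R (w x - f x) \<partial>lborel) - (\<integral>x. \<psi>h x *\<^sub>R (w x - f x) \<partial>lborel)"
    using zero by simp
  also have "\<dots> = (\<integral>x. (\<psi> x - \<psi>h x) *\<^sub>R (w x - f x) \<partial>lborel)"
    unfolding scaleR_diff_left by (rule Bochner_Integration.integral_diff[symmetric]) (intro mult[OF \<psi>m \<psi>b] mult[OF \<psi>hm \<psi>hb] wf)+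
  finally have "norm ((\<integral>x. \<psi> x *\<^sub>R w x \<partial>lborel) - (\<integral>x. \<psi> x *\<^sub>R f x \<partial>lborel)) \<le> (\<integral>x. norm ((\<psi> x - \<psi>h x) *\<^sub>R (w x - f x)) \<partial>lborel)"
    using integral_norm_bound[of lborel "\<lambda>x. (\<psi> x - \<psi>h x) *\<^sub>R (w x - f x)"] by simp
  also have "\<dots> \<le> (\<integral>x. B * h * (norm (w x) + norm (f x)) \<partial>lborel)"
  proof (rule integral_mono)
    show "integrable lborel (\<lambda>x. norm ((\<psi> x - \<psi>h x) *\<^sub>R (w x - f x)))"
      by (intro integrable_norm mult[OF dm near wf])
    show "integrable lborel (\<lambda>x. B * h * (norm (w x) + norm (f x)))" using w f by simp
    fix x
    show "norm ((\<psi> x - \<psi>h x) *\<^sub>R (w x - f x)) \<le> B * h * (norm (w x) + norm (f x))"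
      unfolding norm_scaleR real_norm_def using near[of x] B h
      by (intro mult_mono norm_triangle_ineq4) auto
  qed
  also have "\<dots> = B * h * ((\<integral>x. norm (w x) \<partial>lborel) + m)" using w f by (simp add: m_def)
  also have "\<dots> \<le> B * h * (m + m)" using wle B h by (intro mult_left_mono add_mono) auto
  finally show "norm ((\<integral>x. \<psi> x *\<^sub>R cell_avg h f (cell_index h x) \<partial>lborel) - (\<integral>x. \<psi> x *\<^sub>R f x \<partial>lborel))
      \<le> B * h * (2 * (\<integral>x. norm (f x) \<partial>lborel))" by (simp add: w_def m_def)
qed

subsection \<open>The weak formulation\<close>

context lattice_ode
begin

definition flux :: "real \<Rightarrow> int \<Rightarrow> 'a" where "flux t j = \<phi> (norm (u t j)) *\<^sub>R u t j"

lemma flux_cont: "continuous_on {0..} (\<lambda>t. flux t j)"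
  unfolding flux_def
  by (intro continuous_intros u_cont continuous_on_compose2[OF phi_cont continuous_on_norm[OF u_cont]]) auto

lemma u_deriv_flux: "0 < t \<Longrightarrow> ((\<lambda>s. u s j) has_vector_derivative - (flux t j - flux t (j - 1)) /\<^sub>R h) (at t)"
  using u_deriv[of t j] by (simp only: D_minus_def flux_def scaleR_minus_right)

text \<open>The fluxes telescope over the block and leave those at its two ends, each at most
  \<open>q\<close>, whatever \<open>n\<close> and \<open>h\<close> are.\<close>

lemma block_time_estimate:
  assumes bound: "\<And>t j. t \<in> {0..T} \<Longrightarrow> norm (flux t j) \<le> q" and "s \<in> {0..T}" "t \<in> {0..T}"
  shows "norm (\<Sum>i<n. h *\<^sub>R (u s (j + int i) - u t (j + int i))) \<le> 2 * q * \<bar>s - t\<bar>"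
proof -
  define X where "X x = (\<Sum>i<n. h *\<^sub>R u x (j + int i))" for x
  have X': "(X has_vector_derivative - (flux x (j + int n - 1) - flux x (j - 1))) (at x)" if x: "0 < x" for x
  proof -
    have "(X has_vector_derivative (\<Sum>i<n. h *\<^sub>R (- (flux x (j + int i) - flux x (j + int i - 1)) /\<^sub>R h))) (at x)"
      unfolding X_def
      by (intro has_vector_derivative_sum bounded_linear.has_vector_derivative[OF bounded_linear_scaleR_right] u_deriv_flux x)
    also have "(\<Sum>i<n. h *\<^sub>R (- (flux x (j + int i) - flux x (j + int i - 1)) /\<^sub>R h))
        = - (\<Sum>i<n. flux x (j + int (Suc i) - 1) - flux x (j + int i - 1))"
      unfolding sum_negf[symmetric] using h_pos by (intro sum.cong) auto
    also have "\<dots> = - (flux x (j + int n - 1) - flux x (j - 1))"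
      by (subst sum_lessThan_telescope[of "\<lambda>i. flux x (j + int i - 1)" n]) simp
    finally show ?thesis .
  qed
  have main: "norm (X b - X a) \<le> 2 * q * (b - a)" if ab: "0 \<le> a" "a < b" "b \<le> T" for a b
  proof -
    have "norm (X b - X a) \<le> 2 * q * b - 2 * q * a"
    proof (rule differentiable_bound_general[OF ab(2), where f' = "\<lambda>x. - (flux x (j + int n - 1) - flux x (j - 1))" and \<phi>' = "\<lambda>_. 2 * q"])
      show "continuous_on {a..b} X"
        unfolding X_def by (intro continuous_intros continuous_on_subset[OF u_cont]) (use ab in auto)
      show "continuous_on {a..b} (\<lambda>x. 2 * q * x)" by (intro continuous_intros)
      fix x assume x: "a < x" "x < b"
      show "(X has_vector_derivative - (flux x (j + int n - 1) - flux x (j - 1))) (at x)"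
        by (rule X') (use x ab in simp)
      show "((\<lambda>x. 2 * q * x) has_vector_derivative 2 * q) (at x)"
        unfolding has_real_derivative_iff_has_vector_derivative[symmetric] by (auto intro!: derivative_eq_intros)
      show "norm (- (flux x (j + int n - 1) - flux x (j - 1))) \<le> 2 * q"
        using bound[of x "j + int n - 1"] bound[of x "j - 1"] x ab
          norm_triangle_ineq4[of "flux x (j + int n - 1)" "flux x (j - 1)"] by (simp add: norm_minus_commute)
    qed
    then show ?thesis by (simp add: right_diff_distrib)
  qed
  have "(\<Sum>i<n. h *\<^sub>R (u s (j + int i) - u t (j + int i))) = X s - X t"
    by (simp add: X_def sum_subtractf scaleR_diff_right)
  moreover have "norm (X s - X t) \<le> 2 * q * \<bar>s - t\<bar>"
  proof -
    consider "s < t" | "s = t" | "t < s" by linarith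
    then show ?thesis using main[of s t] main[of t s] assms(2,3) by cases (auto simp: norm_minus_commute)
  qed
  ultimately show ?thesis by simp
qed

end

text \<open>Restrictions of test functions to \<open>[0, T1]\<close>, where \<open>T1\<close> is beyond the support. Values at times
  outside \<open>[0, T1]\<close> are irrelevant.\<close>

locale cutoff_test =
  fixes \<psi> \<psi>x \<psi>t :: "real \<Rightarrow> real \<Rightarrow> real" and T1 X :: real
  assumes T1_pos: "0 < T1" and X_nonneg: "0 \<le> X"
    and \<psi>_cont: "continuous_on (UNIV \<times> {0..T1}) (\<lambda>(x, t). \<psi> x t)"
    and \<psi>x_cont: "continuous_on (UNIV \<times> {0..T1}) (\<lambda>(x, t). \<psi>x x t)"
    and \<psi>t_cont: "continuous_on (UNIV \<times> {0..T1}) (\<lambda>(x, t). \<psi>t x t)"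
    and \<psi>_x: "\<And>x t. t \<in> {0..T1} \<Longrightarrow> ((\<lambda>y. \<psi> y t) has_real_derivative \<psi>x x t) (at x)"
    and \<psi>_t: "\<And>x t. t \<in> {0<..<T1} \<Longrightarrow> ((\<lambda>s. \<psi> x s) has_real_derivative \<psi>t x t) (at t)"
    and supp: "\<And>x t. t \<in> {0..T1} \<Longrightarrow> X < \<bar>x\<bar> \<Longrightarrow> \<psi> x t = 0 \<and> \<psi>x x t = 0 \<and> \<psi>t x t = 0"
    and final: "\<And>x. \<psi> x T1 = 0"
begin

text \<open>Extension by 0 makes integrals over the strip integrals of Borel functions over the
  plane, where translation invariance and Fubini's theorem apply.\<close>

definition ext :: "(real \<Rightarrow> real \<Rightarrow> real) \<Rightarrow> real \<times> real \<Rightarrow> real" where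
  "ext f p = (if snd p \<in> {0..T1} then f (fst p) (snd p) else 0)"

lemma ext_measurable:
  assumes "continuous_on (UNIV \<times> {0..T1}) (\<lambda>(x, t). f x t)"
  shows "ext f \<in> borel_measurable borel"
proof -
  have "(\<lambda>p. if p \<in> UNIV \<times> {0..T1} then (\<lambda>(x, t). f x t) p else 0) \<in> borel_measurable borel"
    by (rule borel_measurable_continuous_on_if[OF _ assms continuous_on_const])
      (intro borel_closed closed_Times, auto)
  then show ?thesis by (simp add: ext_def[abs_def] mem_Times_iff case_prod_beta cong: if_cong)
qed

lemma bounded_on_strip:
  fixes f :: "real \<Rightarrow> real \<Rightarrow> real"
  assumes "continuous_on (UNIV \<times> {0..T1}) (\<lambda>(x, t). f x t)"
    and z: "\<And>x t. t \<in> {0..T1} \<Longrightarrow> X < \<bar>x\<bar> \<Longrightarrow> f x t = 0"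
  shows "\<exists>B>0. \<forall>x. \<forall>t\<in>{0..T1}. \<bar>f x t\<bar> \<le> B"
proof -
  have "continuous_on ({-X..X} \<times> {0..T1}) (\<lambda>(x, t). f x t)"
    by (rule continuous_on_subset[OF assms(1)]) auto
  then have "bounded ((\<lambda>(x, t). f x t) ` ({-X..X} \<times> {0..T1}))"
    by (intro compact_imp_bounded compact_continuous_image compact_Times compact_Icc)
  then obtain B where B: "0 < B" "\<And>y. y \<in> (\<lambda>(x, t). f x t) ` ({-X..X} \<times> {0..T1}) \<Longrightarrow> norm y \<le> B"
    unfolding bounded_pos by blast
  have "\<bar>f x t\<bar> \<le> B" if t: "t \<in> {0..T1}" for x t
  proof (cases "X < \<bar>x\<bar>")
    case True
    then show ?thesis using z[OF t True] B(1) by simp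
  next
    case False
    then have "f x t \<in> (\<lambda>(x, t). f x t) ` ({-X..X} \<times> {0..T1})"
      using t by (intro image_eqI[of _ _ "(x, t)"]) auto
    then show ?thesis using B(2) by force
  qed
  then show ?thesis using B(1) by blast
qed

lemma ext_integrable:
  fixes k :: "real \<times> real \<Rightarrow> 'b::{banach, second_countable_topology}"
  assumes e: "e \<in> borel_measurable borel" "\<And>p. \<bar>e p\<bar> \<le> b" "\<And>p. p \<notin> {-Y..Y} \<times> {0..T1} \<Longrightarrow> e p = 0"
    and k: "k \<in> borel_measurable borel" "\<And>p. norm (k p) \<le> c"
  shows "integrable lborel (\<lambda>p. e p *\<^sub>R k p)"
proof (rule Bochner_Integration.integrable_bound[where f = "\<lambda>p. b * c * indicator ({-Y..Y} \<times> {0..T1}) p"])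
  have "compact ({-Y..Y} \<times> {0..T1})" by (intro compact_Times compact_Icc)
  then have "emeasure lborel ({-Y..Y} \<times> {0..T1}) < \<infinity>" by (intro emeasure_bounded_finite compact_imp_bounded)
  moreover have "{-Y..Y} \<times> {0..T1} \<in> sets (borel :: (real \<times> real) measure)"
    by (intro borel_closed closed_Times) auto
  ultimately show "integrable lborel (\<lambda>p. b * c * indicator ({-Y..Y} \<times> {0..T1}) p)"
    by (intro integrable_mult_right integrable_real_indicator) simp_all
  show "(\<lambda>p. e p *\<^sub>R k p) \<in> borel_measurable lborel" using e(1) k(1) by simp
  show "AE p in lborel. norm (e p *\<^sub>R k p) \<le> norm (b * c * indicator ({-Y..Y} \<times> {0..T1}) p)"
  proof (intro AE_I2)
    fix p
    show "norm (e p *\<^sub>R k p) \<le> norm (b * c * indicator ({-Y..Y} \<times> {0..T1}) p)"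
    proof (cases "p \<in> {-Y..Y} \<times> {0..T1}")
      case True
      have "\<bar>e p\<bar> * norm (k p) \<le> b * c" using e(2)[of p] k(2)[of p] by (intro mult_mono) auto
      then show ?thesis using True by simp
    qed (simp add: e(3))
  qed
qed

end

locale scheme_test = lattice_ode \<phi> h u + cutoff_test \<psi> \<psi>x \<psi>t T1 X
  for \<phi> h and u :: "real \<Rightarrow> int \<Rightarrow> 'a::euclidean_space" and \<psi> \<psi>x \<psi>t T1 X +
  fixes q M :: real
  assumes u_M: "\<And>t j. t \<in> {0..T1} \<Longrightarrow> norm (u t j) \<le> M"
    and flux_q: "\<And>t j. t \<in> {0..T1} \<Longrightarrow> norm (flux t j) \<le> q" and q_nonneg: "0 \<le> q" and M_nonneg: "0 \<le> M"
begin

definition S :: "real \<times> real \<Rightarrow> 'a" where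
  "S p = (if snd p \<in> {0..T1} then u (snd p) (cell_index h (fst p)) else 0)"
definition FS :: "real \<times> real \<Rightarrow> 'a" where
  "FS p = (if snd p \<in> {0..T1} then flux (snd p) (cell_index h (fst p)) else 0)"
text \<open>The flux entering the cell from the left; as a function on the plane it is a translate
  of \<open>FS\<close>.\<close>

definition FS' :: "real \<times> real \<Rightarrow> 'a" where
  "FS' p = (if snd p \<in> {0..T1} then flux (snd p) (cell_index h (fst p) - 1) else 0)"

lemma S_measurable: "S \<in> borel_measurable borel"
  unfolding S_def[abs_def] by (rule step_measurable, rule continuous_on_subset[OF u_cont]) auto
lemma FS_measurable: "FS \<in> borel_measurable borel"
  unfolding FS_def[abs_def] by (rule step_measurable, rule continuous_on_subset[OF flux_cont]) auto
lemma FS'_measurable: "FS' \<in> borel_measurable borel"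
  unfolding FS'_def[abs_def]
  by (rule step_measurable[of _ "\<lambda>t j. flux t (j - 1)"], rule continuous_on_subset[OF flux_cont]) auto

lemma S_bound: "norm (S p) \<le> M" using u_M M_nonneg by (simp add: S_def)
lemma FS_bound: "norm (FS p) \<le> q" using flux_q q_nonneg by (simp add: FS_def)
lemma FS'_bound: "norm (FS' p) \<le> q" using flux_q q_nonneg by (simp add: FS'_def)

lemma cell_index_shift: "cell_index h (x + h) = cell_index h x + 1"
  using h_pos by (simp add: cell_index_def add_divide_distrib add.assoc) linarith

lemma FS'_shift: "FS' ((h, 0) + p) = FS p"
  using cell_index_shift[of "fst p"] by (simp add: FS'_def FS_def add.commute)

text \<open>Integration by parts in time within one cell: the integrand is the derivative of
  \<open>\<psi> x t *\<^sub>R u t j\<close>, and the value at \<open>T1\<close> vanishes by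
  \<open>final\<close>.\<close>

lemma time_integral:
  "(\<integral>t. ext \<psi>t (x, t) *\<^sub>R S (x, t) - (ext \<psi> (x, t) / h) *\<^sub>R (FS (x, t) - FS' (x, t)) \<partial>lborel)
    = - (\<psi> x 0 *\<^sub>R u 0 (cell_index h x))"
proof -
  define j where "j = cell_index h x"
  define k where "k t = \<psi>t x t *\<^sub>R u t j - (\<psi> x t / h) *\<^sub>R (flux t j - flux t (j - 1))" for t
  have slice: "continuous_on {0..T1} (\<lambda>t. f x t)" if "continuous_on (UNIV \<times> {0..T1}) (\<lambda>(x, t). f x t)" for f :: "real \<Rightarrow> real \<Rightarrow> real"
  proof -
    have "continuous_on {0..T1} (\<lambda>t. (x, t))" by (intro continuous_intros)
    then have "continuous_on {0..T1} (\<lambda>t. (\<lambda>(x, t). f x t) (x, t))"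
      by (rule continuous_on_compose2[OF that]) auto
    then show ?thesis by simp
  qed
  have c: "continuous_on {0..T1} (\<lambda>t. \<psi> x t)" "continuous_on {0..T1} (\<lambda>t. \<psi>t x t)"
    "\<And>j. continuous_on {0..T1} (\<lambda>t. u t j)" "\<And>j. continuous_on {0..T1} (\<lambda>t. flux t j)"
    using slice[OF \<psi>_cont] slice[OF \<psi>t_cont] continuous_on_subset[OF u_cont, of "{0..T1}"]
      continuous_on_subset[OF flux_cont, of "{0..T1}"] by auto
  have kc: "continuous_on {0..T1} k"
    unfolding k_def using h_pos by (intro continuous_intros c) simp
  have "(k has_integral (\<psi> x T1 *\<^sub>R u T1 j - \<psi> x 0 *\<^sub>R u 0 j)) {0..T1}"
  proof (rule fundamental_theorem_of_calculus_interior)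
    show "0 \<le> T1" using T1_pos by simp
    show "continuous_on {0..T1} (\<lambda>t. \<psi> x t *\<^sub>R u t j)" by (intro continuous_intros c)
    fix t assume t: "t \<in> {0<..<T1}"
    have "((\<lambda>t. \<psi> x t *\<^sub>R u t j) has_vector_derivative
        \<psi> x t *\<^sub>R (- (flux t j - flux t (j - 1)) /\<^sub>R h) + \<psi>t x t *\<^sub>R u t j) (at t)"
      by (rule has_vector_derivative_scaleR[OF \<psi>_t[OF t] u_deriv_flux]) (use t in simp)
    also have "\<psi> x t *\<^sub>R (- (flux t j - flux t (j - 1)) /\<^sub>R h) + \<psi>t x t *\<^sub>R u t j = k t"
      by (simp add: k_def divide_inverse scaleR_diff_right)
    finally show "((\<lambda>t. \<psi> x t *\<^sub>R u t j) has_vector_derivative k t) (at t)" .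
  qed
  then have I: "integral {0..T1} k = - (\<psi> x 0 *\<^sub>R u 0 j)" by (simp add: final integral_unique)
  have "set_integrable lborel {0..T1} k"
    unfolding set_integrable_def by (rule borel_integrable_compact[OF compact_Icc kc])
  from set_borel_integral_eq_integral(2)[OF this] I
  have "(\<integral>t. indicator {0..T1} t *\<^sub>R k t \<partial>lborel) = - (\<psi> x 0 *\<^sub>R u 0 j)"
    by (simp add: set_lebesgue_integral_def)
  moreover have "indicator {0..T1} t *\<^sub>R k t = ext \<psi>t (x, t) *\<^sub>R S (x, t) - (ext \<psi> (x, t) / h) *\<^sub>R (FS (x, t) - FS' (x, t))" for t
    by (simp add: k_def ext_def S_def FS_def FS'_def j_def indicator_def)
  ultimately show ?thesis by (simp add: j_def)
qed

definition ext_dq :: "real \<times> real \<Rightarrow> real" where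
  "ext_dq p = (ext \<psi> ((h, 0) + p) - ext \<psi> p) / h"

lemma ext_shift_measurable: "(\<lambda>p. ext \<psi> ((h, 0) + p)) \<in> borel_measurable borel"
  by (rule measurable_compose[OF _ ext_measurable[OF \<psi>_cont]])
    (intro borel_measurable_continuous_onI continuous_intros)

text \<open>Summation by parts in space becomes a translation of the plane by \<open>h\<close>,
  which moves the difference of fluxes onto a difference quotient of \<open>\<psi>\<close>.\<close>

theorem discrete_weak_form:
  "(\<integral>p. ext \<psi>t p *\<^sub>R S p + ext_dq p *\<^sub>R FS p \<partial>lborel) + (\<integral>x. \<psi> x 0 *\<^sub>R u 0 (cell_index h x) \<partial>lborel) = 0"
proof -
  obtain B where B: "0 < B" "\<And>x t. t \<in> {0..T1} \<Longrightarrow> \<bar>\<psi> x t\<bar> \<le> B"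
    using bounded_on_strip[OF \<psi>_cont] supp by blast
  obtain Bt where Bt: "0 < Bt" "\<And>x t. t \<in> {0..T1} \<Longrightarrow> \<bar>\<psi>t x t\<bar> \<le> Bt"
    using bounded_on_strip[OF \<psi>t_cont] supp by blast
  have eb: "\<bar>ext \<psi> p\<bar> \<le> B" "\<bar>ext \<psi>t p\<bar> \<le> Bt" for p using B Bt by (simp_all add: ext_def)
  have ez: "ext \<psi> p = 0 \<and> ext \<psi>t p = 0" if "p \<notin> {-X..X} \<times> {0..T1}" for p
  proof (cases "snd p \<in> {0..T1}")
    case True
    then have "X < \<bar>fst p\<bar>" using that by (cases p) auto
    then show ?thesis using supp[OF True] True by (simp add: ext_def)
  next
    case False
    then show ?thesis by (auto simp: ext_def)
  qed
  have m: "ext \<psi> \<in> borel_measurable borel" "ext \<psi>t \<in> borel_measurable borel"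
    using ext_measurable \<psi>_cont \<psi>t_cont by auto
  have I1: "integrable lborel (\<lambda>p. ext \<psi>t p *\<^sub>R S p)"
    by (rule ext_integrable[OF m(2) eb(2) _ S_measurable S_bound]) (use ez in blast)
  have I2: "integrable lborel (\<lambda>p. ext \<psi> p *\<^sub>R FS p)"
    by (rule ext_integrable[OF m(1) eb(1) _ FS_measurable FS_bound]) (use ez in blast)
  have I3: "integrable lborel (\<lambda>p. ext \<psi> p *\<^sub>R FS' p)"
    by (rule ext_integrable[OF m(1) eb(1) _ FS'_measurable FS'_bound]) (use ez in blast)
  have I4: "integrable lborel (\<lambda>p. ext \<psi> ((h, 0) + p) *\<^sub>R FS p)"
  proof (rule ext_integrable[OF ext_shift_measurable eb(1) _ FS_measurable FS_bound])
    fix p assume "p \<notin> {-(X + h)..X + h} \<times> {0..T1}"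
    then have "(h, 0) + p \<notin> {-X..X} \<times> {0..T1}" using h_pos by (cases p) auto
    then show "ext \<psi> ((h, 0) + p) = 0" using ez by blast
  qed
  have shift: "(\<integral>p. ext \<psi> p *\<^sub>R FS' p \<partial>lborel) = (\<integral>p. ext \<psi> ((h, 0) + p) *\<^sub>R FS p \<partial>lborel)"
  proof -
    have "(\<integral>p. ext \<psi> p *\<^sub>R FS' p \<partial>lborel) = (\<integral>p. ext \<psi> p *\<^sub>R FS' p \<partial>distr lborel borel ((+) (h, 0)))"
      by (simp add: lborel_distr_plus)
    also have "\<dots> = (\<integral>p. ext \<psi> ((h, 0) + p) *\<^sub>R FS' ((h, 0) + p) \<partial>lborel)"
      using m(1) FS'_measurable by (intro integral_distr) simp_all
    finally show ?thesis by (simp only: FS'_shift)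
  qed
  let ?Q = "\<lambda>p. ext \<psi>t p *\<^sub>R S p - (ext \<psi> p / h) *\<^sub>R (FS p - FS' p)"
  have Q: "?Q = (\<lambda>p. ext \<psi>t p *\<^sub>R S p - (1 / h) *\<^sub>R (ext \<psi> p *\<^sub>R FS p - ext \<psi> p *\<^sub>R FS' p))"
    by (simp add: fun_eq_iff scaleR_diff_right)
  have IQ: "integrable lborel ?Q"
    unfolding Q by (intro Bochner_Integration.integrable_diff integrable_scaleR_right I1 I2 I3)
  have "(\<integral>p. ?Q p \<partial>lborel) = (\<integral>x. (\<integral>t. ?Q (x, t) \<partial>lborel) \<partial>lborel)"
    using lborel_pair.integral_fst'[of ?Q] IQ unfolding lborel_prod by simp
  also have "\<dots> = - (\<integral>x. \<psi> x 0 *\<^sub>R u 0 (cell_index h x) \<partial>lborel)"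
    unfolding time_integral by simp
  finally have 1: "(\<integral>p. ?Q p \<partial>lborel) = - (\<integral>x. \<psi> x 0 *\<^sub>R u 0 (cell_index h x) \<partial>lborel)" .
  have "(\<integral>p. ?Q p \<partial>lborel) = (\<integral>p. ext \<psi>t p *\<^sub>R S p \<partial>lborel)
      - (1 / h) *\<^sub>R ((\<integral>p. ext \<psi> p *\<^sub>R FS p \<partial>lborel) - (\<integral>p. ext \<psi> p *\<^sub>R FS' p \<partial>lborel))"
    unfolding Q by (simp add: Bochner_Integration.integral_diff I1 I2 I3)
  also have "\<dots> = (\<integral>p. ext \<psi>t p *\<^sub>R S p \<partial>lborel)
      + (1 / h) *\<^sub>R ((\<integral>p. ext \<psi> ((h, 0) + p) *\<^sub>R FS p \<partial>lborel) - (\<integral>p. ext \<psi> p *\<^sub>R FS p \<partial>lborel))"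
    unfolding shift by (simp add: scaleR_diff_right)
  also have "\<dots> = (\<integral>p. ext \<psi>t p *\<^sub>R S p + (1 / h) *\<^sub>R (ext \<psi> ((h, 0) + p) *\<^sub>R FS p - ext \<psi> p *\<^sub>R FS p) \<partial>lborel)"
    by (simp add: Bochner_Integration.integral_diff Bochner_Integration.integral_add I1 I2 I4)
  also have "\<dots> = (\<integral>p. ext \<psi>t p *\<^sub>R S p + ext_dq p *\<^sub>R FS p \<partial>lborel)"
    by (simp add: ext_dq_def scaleR_diff_left scaleR_diff_right diff_divide_distrib)
  finally have 2: "(\<integral>p. ?Q p \<partial>lborel) = (\<integral>p. ext \<psi>t p *\<^sub>R S p + ext_dq p *\<^sub>R FS p \<partial>lborel)" .
  show ?thesis unfolding 2[symmetric] 1 by simp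
qed

end

lemma (in cutoff_test) \<psi>_lipschitz:
  assumes t: "t \<in> {0..T1}" and B: "\<And>x. \<bar>\<psi>x x t\<bar> \<le> B"
  shows "\<bar>\<psi> x t - \<psi> y t\<bar> \<le> B * \<bar>x - y\<bar>"
proof -
  have "norm (\<psi> x t - \<psi> y t) \<le> B * norm (x - y)"
    by (rule field_differentiable_bound[of UNIV "\<lambda>y. \<psi> y t" "\<lambda>x. \<psi>x x t", OF convex_UNIV \<psi>_x[OF t]])
      (simp_all add: B)
  then show ?thesis by simp
qed

text \<open>Dominated convergence in the discrete identity. The difference quotients of
  \<open>\<psi>\<close> are bounded by \<open>Bx\<close> and converge pointwise to
  \<open>\<psi>x\<close>; convergence almost everywhere passes through the continuous map
  \<open>F\<close> in the nonlinear term; the initial term is handled by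
  \<open>cell_avg_weak_error\<close>.\<close>

theorem weak_form_limit:
  fixes u :: "real \<times> real \<Rightarrow> 'a::euclidean_space" and U :: "nat \<Rightarrow> real \<Rightarrow> int \<Rightarrow> 'a"
  assumes test: "cutoff_test \<psi> \<psi>x \<psi>t T1 X" and T1: "T1 \<le> T"
    and ode: "\<And>k. lattice_ode \<phi> (h k) (U k)" and h: "h \<longlonglongrightarrow> 0"
    and bound: "\<And>k t j. t \<in> {0..T} \<Longrightarrow> norm (U k t j) \<le> M" and M: "0 \<le> M"
    and um: "u \<in> borel_measurable borel" and ub: "\<And>p. norm (u p) \<le> M"
    and conv: "AE p in lborel. snd p \<in> {0..T} \<longrightarrow> (\<lambda>k. U k (snd p) (cell_index (h k) (fst p))) \<longlonglongrightarrow> u p"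
    and init: "\<And>k j. U k 0 j = cell_avg (h k) f j" and f: "integrable lborel f"
  shows "(\<integral>p. cutoff_test.ext T1 \<psi>t p *\<^sub>R u p + cutoff_test.ext T1 \<psi>x p *\<^sub>R (\<phi> (norm (u p)) *\<^sub>R u p) \<partial>lborel)
    + (\<integral>x. \<psi> x 0 *\<^sub>R f x \<partial>lborel) = 0"
proof -
  interpret cutoff_test \<psi> \<psi>x \<psi>t T1 X by fact
  have hp: "0 < h k" for k using lattice_ode.h_pos[OF ode] .
  have phi0: "0 \<le> \<phi> r" if "0 \<le> r" for r using lattice_ode.phi_nonneg[OF ode[of 0] that] .
  have phic: "continuous_on {0..} \<phi>" using lattice_ode.phi_cont[OF ode[of 0]] .
  define F where "F w = \<phi> (norm w) *\<^sub>R w" for w :: 'a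
  have Fc: "continuous_on UNIV F"
    unfolding F_def by (intro continuous_intros continuous_on_compose2[OF phic, of UNIV norm]) auto
  have "bounded (\<phi> ` {0..M})"
    by (intro compact_imp_bounded compact_continuous_image continuous_on_subset[OF phic]) auto
  then obtain P where "\<forall>y\<in>\<phi> ` {0..M}. norm y \<le> P" unfolding bounded_iff by blast
  then have P: "\<phi> r \<le> P" if "0 \<le> r" "r \<le> M" for r using that by (auto simp: abs_le_iff)
  have P0: "0 \<le> P" using P[of 0] phi0[of 0] M by linarith
  define q where "q = P * M"
  have q0: "0 \<le> q" using P0 M by (simp add: q_def)
  have Fq: "norm (F w) \<le> q" if "norm w \<le> M" for w
    unfolding F_def q_def norm_scaleR using P[of "norm w"] phi0[of "norm w"] that P0 by (intro mult_mono) auto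
  have Tsub: "t \<in> {0..T}" if "t \<in> {0..T1}" for t using that T1 by simp
  have st: "scheme_test \<phi> (h k) (U k) \<psi> \<psi>x \<psi>t T1 X q M" for k
  proof -
    interpret lattice_ode \<phi> "h k" "U k" by (rule ode)
    show ?thesis
    proof
      show "norm (U k t j) \<le> M" if "t \<in> {0..T1}" for t j by (rule bound[OF Tsub[OF that]])
      show "norm (flux t j) \<le> q" if "t \<in> {0..T1}" for t j
        using Fq[OF bound[OF Tsub[OF that]]] by (simp add: flux_def F_def)
    qed (use q0 M in auto)
  qed
  define S where "S k p = (if snd p \<in> {0..T1} then U k (snd p) (cell_index (h k) (fst p)) else 0)" for k and p :: "real \<times> real"
  define dq where "dq k p = (ext \<psi> ((h k, 0) + p) - ext \<psi> p) / h k" for k and p :: "real \<times> real"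
  have S_eq: "scheme_test.S (h k) (U k) T1 = S k" for k
    using scheme_test.S_def[OF st[of k]] by (simp add: fun_eq_iff S_def)
  have FS_eq: "scheme_test.FS \<phi> (h k) (U k) T1 p = F (S k p)" for k p
    using scheme_test.FS_def[OF st[of k]] lattice_ode.flux_def[OF ode[of k]] by (simp add: F_def S_def)
  have dq_eq: "scheme_test.ext_dq (h k) \<psi> T1 = dq k" for k
    using scheme_test.ext_dq_def[OF st[of k]] by (simp add: fun_eq_iff dq_def)
  have ident: "(\<integral>p. ext \<psi>t p *\<^sub>R S k p + dq k p *\<^sub>R F (S k p) \<partial>lborel)
      + (\<integral>x. \<psi> x 0 *\<^sub>R cell_avg (h k) f (cell_index (h k) x) \<partial>lborel) = 0" for k
    using scheme_test.discrete_weak_form[OF st[of k]] unfolding S_eq FS_eq dq_eq init .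
  obtain B where B: "0 < B" "\<And>x t. t \<in> {0..T1} \<Longrightarrow> \<bar>\<psi> x t\<bar> \<le> B"
    using bounded_on_strip[OF \<psi>_cont] supp by blast
  obtain Bt where Bt: "0 < Bt" "\<And>x t. t \<in> {0..T1} \<Longrightarrow> \<bar>\<psi>t x t\<bar> \<le> Bt"
    using bounded_on_strip[OF \<psi>t_cont] supp by blast
  obtain Bx where Bx: "0 < Bx" "\<And>x t. t \<in> {0..T1} \<Longrightarrow> \<bar>\<psi>x x t\<bar> \<le> Bx"
    using bounded_on_strip[OF \<psi>x_cont] supp by blast
  obtain H where H: "\<And>k. h k \<le> H"
  proof -
    have "Bseq h" using h by (rule convergent_imp_Bseq[OF convergentI])
    then obtain H where "\<forall>k. norm (h k) \<le> H" unfolding Bseq_def by blast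
    then have "h k \<le> H" for k by (metis abs_le_D1 real_norm_def)
    then show thesis by (rule that)
  qed
  have dqb: "\<bar>dq k p\<bar> \<le> Bx" for k p
  proof (cases "snd p \<in> {0..T1}")
    case True
    then have "\<bar>\<psi> (h k + fst p) (snd p) - \<psi> (fst p) (snd p)\<bar> \<le> Bx * \<bar>h k + fst p - fst p\<bar>"
      by (intro \<psi>_lipschitz Bx(2))
    then have "\<bar>\<psi> (h k + fst p) (snd p) - \<psi> (fst p) (snd p)\<bar> \<le> Bx * h k" using hp[of k] by simp
    then have "\<bar>\<psi> (h k + fst p) (snd p) - \<psi> (fst p) (snd p)\<bar> / h k \<le> Bx"
      using hp[of k] by (simp add: divide_le_eq)
    then show ?thesis using True hp[of k] by (simp add: dq_def ext_def abs_divide)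
  next
    case False
    then show ?thesis using Bx(1) by (auto simp: dq_def ext_def)
  qed
  have ext_zero: "ext a p = 0" if "snd p \<notin> {0..T1}" for a p using that by (auto simp: ext_def)
  \<comment> \<open>Enlarged by \<open>H\<close> because the difference quotient at a point involves
    \<open>\<psi>\<close> at distance \<open>h k\<close> from it.\<close>
  define R where "R = {-(X + H)..X + H} \<times> {0..T1}"
  have out: "ext \<psi>t p = 0 \<and> dq k p = 0" if "p \<notin> R" for k p
  proof (cases "snd p \<in> {0..T1}")
    case True
    have H0: "0 < H" using hp[of 0] H[of 0] by linarith
    have "X + H < \<bar>fst p\<bar>" using that True by (cases p) (auto simp: R_def)
    then have "X < \<bar>fst p\<bar>" "X < \<bar>h k + fst p\<bar>" using H[of k] hp[of k] H0 by linarith+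
    then show ?thesis using supp[OF True] True by (simp add: ext_def dq_def)
  next
    case False
    then show ?thesis by (auto simp: ext_def dq_def)
  qed
  have Sm: "S k \<in> borel_measurable borel" for k
    using scheme_test.S_measurable[OF st[of k]] unfolding S_eq .
  have FSm: "(\<lambda>p. F (S k p)) \<in> borel_measurable borel" for k
    by (rule measurable_compose[OF Sm borel_measurable_continuous_onI[OF Fc]])
  have Fum: "(\<lambda>p. F (u p)) \<in> borel_measurable borel"
    by (rule measurable_compose[OF um borel_measurable_continuous_onI[OF Fc]])
  have dqm: "dq k \<in> borel_measurable borel" for k
    unfolding dq_def using scheme_test.ext_shift_measurable[OF st[of k]] ext_measurable[OF \<psi>_cont]
    by (intro borel_measurable_divide borel_measurable_diff) simp_all
  have Sb: "norm (S k p) \<le> M" for k p using bound[OF Tsub] M by (cases "snd p \<in> {0..T1}") (simp_all only: S_def if_True if_False norm_zero)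
  have lim1: "(\<lambda>k. \<integral>p. ext \<psi>t p *\<^sub>R S k p + dq k p *\<^sub>R F (S k p) \<partial>lborel)
      \<longlonglongrightarrow> (\<integral>p. ext \<psi>t p *\<^sub>R u p + ext \<psi>x p *\<^sub>R F (u p) \<partial>lborel)"
  proof (rule integral_dominated_convergence[where w = "\<lambda>p. (Bt * M + Bx * q) * indicator R p"])
    show "(\<lambda>p. ext \<psi>t p *\<^sub>R u p + ext \<psi>x p *\<^sub>R F (u p)) \<in> borel_measurable lborel"
      using ext_measurable[OF \<psi>t_cont] ext_measurable[OF \<psi>x_cont] um Fum by simp
    show "(\<lambda>p. ext \<psi>t p *\<^sub>R S k p + dq k p *\<^sub>R F (S k p)) \<in> borel_measurable lborel" for k
      using ext_measurable[OF \<psi>t_cont] dqm Sm FSm by simp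
    have "compact R" unfolding R_def by (intro compact_Times compact_Icc)
    then have "emeasure lborel R < \<infinity>" by (intro emeasure_bounded_finite compact_imp_bounded)
    moreover have "R \<in> sets borel" unfolding R_def by (intro borel_closed closed_Times) auto
    ultimately show "integrable lborel (\<lambda>p. (Bt * M + Bx * q) * indicator R p)"
      by (intro integrable_mult_right integrable_real_indicator) simp_all
    show "AE p in lborel. norm (ext \<psi>t p *\<^sub>R S k p + dq k p *\<^sub>R F (S k p)) \<le> (Bt * M + Bx * q) * indicator R p" for k
    proof (intro AE_I2)
      fix p
      show "norm (ext \<psi>t p *\<^sub>R S k p + dq k p *\<^sub>R F (S k p)) \<le> (Bt * M + Bx * q) * indicator R p"
      proof (cases "p \<in> R")
        case True
        have "\<bar>ext \<psi>t p\<bar> \<le> Bt" using Bt by (simp add: ext_def)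
        then have "\<bar>ext \<psi>t p\<bar> * norm (S k p) \<le> Bt * M" using Sb[of k p] by (intro mult_mono) auto
        moreover have "\<bar>dq k p\<bar> * norm (F (S k p)) \<le> Bx * q"
          using dqb[of k p] Fq[OF Sb[of k p]] Bx(1) by (intro mult_mono) auto
        ultimately show ?thesis
          using norm_triangle_ineq[of "ext \<psi>t p *\<^sub>R S k p" "dq k p *\<^sub>R F (S k p)"] True by simp
      next
        case False
        then show ?thesis using out[OF False, of k] by simp
      qed
    qed
    show "AE p in lborel. (\<lambda>k. ext \<psi>t p *\<^sub>R S k p + dq k p *\<^sub>R F (S k p))
        \<longlonglongrightarrow> ext \<psi>t p *\<^sub>R u p + ext \<psi>x p *\<^sub>R F (u p)"
      using conv
    proof eventually_elim
      case (elim p)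
      show ?case
      proof (cases "snd p \<in> {0..T1}")
        case True
        then have S: "(\<lambda>k. S k p) \<longlonglongrightarrow> u p" using elim Tsub by (simp add: S_def)
        have "isCont F (u p)" using Fc by (simp add: continuous_on_eq_continuous_at)
        then have FSl: "(\<lambda>k. F (S k p)) \<longlonglongrightarrow> F (u p)" by (rule isCont_tendsto_compose[OF _ S])
        have "((\<lambda>d. (\<psi> (fst p + d) (snd p) - \<psi> (fst p) (snd p)) / d) \<longlongrightarrow> \<psi>x (fst p) (snd p)) (at 0)"
          using \<psi>_x[OF True] by (rule DERIV_D)
        moreover have "filterlim h (at 0) sequentially"
          unfolding filterlim_at using h by (simp add: less_imp_neq[OF hp, symmetric])
        ultimately have "(\<lambda>k. (\<psi> (fst p + h k) (snd p) - \<psi> (fst p) (snd p)) / h k) \<longlonglongrightarrow> \<psi>x (fst p) (snd p)"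
          by (rule filterlim_compose)
        then have "(\<lambda>k. dq k p) \<longlonglongrightarrow> ext \<psi>x p"
          using True by (simp add: dq_def ext_def add.commute)
        then show ?thesis by (intro tendsto_intros S FSl)
      next
        case False
        then have "dq k p = 0" for k by (auto simp: dq_def ext_def)
        then show ?thesis by (simp add: ext_zero[OF False])
      qed
    qed
  qed
  have t0: "0 \<in> {0..T1}" using T1_pos by simp
  define m where "m = (\<integral>x. norm (f x) \<partial>lborel)"
  have \<psi>0m: "(\<lambda>x. \<psi> x 0) \<in> borel_measurable borel"
  proof (rule borel_measurable_continuous_onI)
    have "continuous_on UNIV (\<lambda>x::real. (x, 0::real))" by (intro continuous_intros)
    then have "continuous_on UNIV (\<lambda>x. (\<lambda>(x, t). \<psi> x t) (x, 0))"
      by (rule continuous_on_compose2[OF \<psi>_cont]) (use t0 in auto)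
    then show "continuous_on UNIV (\<lambda>x. \<psi> x 0)" by simp
  qed
  have le: "norm ((\<integral>x. \<psi> x 0 *\<^sub>R cell_avg (h k) f (cell_index (h k) x) \<partial>lborel) - (\<integral>x. \<psi> x 0 *\<^sub>R f x \<partial>lborel)) \<le> Bx * h k * (2 * m)" for k
    unfolding m_def
  proof (rule cell_avg_weak_error(2)[OF hp f \<psi>0m])
    show "\<bar>\<psi> x 0\<bar> \<le> B" for x by (rule B(2)[OF t0])
    show "\<bar>\<psi> x 0 - \<psi> y 0\<bar> \<le> Bx * \<bar>x - y\<bar>" for x y by (rule \<psi>_lipschitz[OF t0 Bx(2)[OF t0]])
    show "\<psi> x 0 = 0" if "X < \<bar>x\<bar>" for x using supp[OF t0 that] by simp
  qed (use Bx in simp)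
  have l0: "(\<lambda>k. Bx * h k * (2 * m)) \<longlonglongrightarrow> 0"
    using tendsto_mult_left_zero[OF tendsto_mult_right_zero[OF h, of Bx], of "2 * m"] .
  have "(\<lambda>k. (\<integral>x. \<psi> x 0 *\<^sub>R cell_avg (h k) f (cell_index (h k) x) \<partial>lborel) - (\<integral>x. \<psi> x 0 *\<^sub>R f x \<partial>lborel)) \<longlonglongrightarrow> 0"
    by (rule Lim_null_comparison[OF _ l0]) (intro always_eventually allI le)
  then have lim2: "(\<lambda>k. \<integral>x. \<psi> x 0 *\<^sub>R cell_avg (h k) f (cell_index (h k) x) \<partial>lborel) \<longlonglongrightarrow> (\<integral>x. \<psi> x 0 *\<^sub>R f x \<partial>lborel)"
    by (rule LIM_zero_cancel)
  have "(\<integral>p. ext \<psi>t p *\<^sub>R u p + ext \<psi>x p *\<^sub>R F (u p) \<partial>lborel) + (\<integral>x. \<psi> x 0 *\<^sub>R f x \<partial>lborel) = 0"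
    using tendsto_add[OF lim1 lim2] unfolding ident by (simp add: LIMSEQ_const_iff)
  then show ?thesis by (simp add: F_def)
qed

subsection \<open>The approximations of the initial value problem\<close>

lemma norm_e_vec: "norm (e_vec :: real ^ 'n) = 1"
proof -
  have "norm ((\<chi> i. 1) :: real ^ 'n) = sqrt (real CARD('n))"
    by (simp add: norm_vec_def L2_set_def)
  then show ?thesis by (simp add: e_vec_def)
qed

lemma flux_lipschitz_on:
  assumes d1: "\<And>r. 0 \<le> r \<Longrightarrow> (\<phi> has_real_derivative \<phi>' r) (at r within {0..})"
    and d2: "\<And>r. 0 \<le> r \<Longrightarrow> (\<phi>' has_real_derivative \<phi>'' r) (at r within {0..})"
  shows "\<exists>L\<ge>0. \<forall>r\<in>{0..B}. \<forall>s\<in>{0..B}. \<bar>r * \<phi> r - s * \<phi> s\<bar> \<le> L * \<bar>r - s\<bar>"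
proof -
  have "continuous_on {0..} \<phi>" by (rule DERIV_continuous_on) (use d1 in simp)
  moreover have "continuous_on {0..} \<phi>'" by (rule DERIV_continuous_on) (use d2 in simp)
  ultimately have c: "continuous_on {0..B} (\<lambda>r. \<phi> r + \<phi>' r * r)"
    by (intro continuous_intros) (auto elim: continuous_on_subset)
  have "bounded ((\<lambda>r. \<phi> r + \<phi>' r * r) ` {0..B})"
    by (rule compact_imp_bounded[OF compact_continuous_image[OF c compact_Icc]])
  then obtain L where L: "0 < L" "\<forall>y\<in>(\<lambda>r. \<phi> r + \<phi>' r * r) ` {0..B}. norm y \<le> L"
    unfolding bounded_pos by blast
  have "\<bar>r * \<phi> r - s * \<phi> s\<bar> \<le> L * \<bar>r - s\<bar>" if rs: "r \<in> {0..B}" "s \<in> {0..B}" for r s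
  proof -
    have "norm (r * \<phi> r - s * \<phi> s) \<le> L * norm (r - s)"
    proof (rule field_differentiable_bound[of "{0..B}" "\<lambda>r. r * \<phi> r" "\<lambda>r. \<phi> r + \<phi>' r * r"])
      fix x assume x: "x \<in> {0..B}"
      have "(\<phi> has_real_derivative \<phi>' x) (at x within {0..B})"
        by (rule DERIV_subset[OF d1]) (use x in auto)
      from DERIV_mult[OF DERIV_ident this]
      show "((\<lambda>r. r * \<phi> r) has_real_derivative \<phi> x + \<phi>' x * x) (at x within {0..B})" by simp
      show "norm (\<phi> x + \<phi>' x * x) \<le> L" using L(2) x by blast
    qed (use rs in auto)
    then show ?thesis by simp
  qed
  then show ?thesis using L(1) by (intro exI[of _ L]) auto
qed

lemma mono_on_of_derivative_nonneg:
  fixes \<phi> \<phi>' :: "real \<Rightarrow> real"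
  assumes d1: "\<And>r. 0 \<le> r \<Longrightarrow> (\<phi> has_real_derivative \<phi>' r) (at r within {0..})"
    and nonneg: "\<And>r. 0 \<le> r \<Longrightarrow> r \<le> M \<Longrightarrow> 0 \<le> \<phi>' r"
    and rs: "0 \<le> r" "r \<le> s" "s \<le> M"
  shows "\<phi> r \<le> \<phi> s"
proof (rule DERIV_nonneg_imp_increasing_open[OF rs(2)])
  fix x assume x: "r < x" "x < s"
  have "at x within {0..} = at x" by (rule at_within_nhd[of _ "{0<..}"]) (use x rs in auto)
  then have "(\<phi> has_real_derivative \<phi>' x) (at x)" using d1[of x] x rs by simp
  moreover have "0 \<le> \<phi>' x" by (rule nonneg) (use x rs in auto)
  ultimately show "\<exists>y. (\<phi> has_real_derivative y) (at x) \<and> 0 \<le> y" by blast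
next
  have "continuous_on {0..} \<phi>" by (rule DERIV_continuous_on) (use d1 in simp)
  then show "continuous_on {r..s} \<phi>" by (rule continuous_on_subset) (use rs in auto)
qed

lemma relevant_interval:
  assumes "Linfty lebesgue (\<lambda>x. norm (u0 x))"
  obtains M where "0 \<le> M" "relevant u0 = {0..M}" "AE x in lebesgue. norm (u0 x) \<le> M"
proof -
  define s where "s = esssup lebesgue (\<lambda>x. ereal (norm (u0 x)))"
  have "s < \<infinity>" using assms by (simp add: Linfty_def s_def)
  have AE: "AE x in lebesgue. ereal (norm (u0 x)) \<le> s" unfolding s_def by (rule esssup_AE)
  \<comment> \<open>A negative essential supremum of norms would make the whole line a null set.
    This also excludes the value minus infinity.\<close>
  have "0 \<le> s"
  proof (rule ccontr)
    assume "\<not> 0 \<le> s"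
    then have no: "ereal (norm (u0 x)) \<le> s \<Longrightarrow> False" for x
      by (metis ereal_less_eq(5) norm_ge_zero order_trans)
    from AE have "AE x in (lebesgue :: real measure). False" by eventually_elim (rule no)
    then show False by (simp add: AE_iff_null null_sets_def)
  qed
  then obtain M where M: "s = ereal M" "0 \<le> M" using \<open>s < \<infinity>\<close> by (cases s) auto
  show thesis
  proof (rule that[OF M(2)])
    show "relevant u0 = {0..M}" using M(1) unfolding relevant_def s_def[symmetric] by auto
    show "AE x in lebesgue. norm (u0 x) \<le> M" using AE unfolding M(1) by simp
  qed
qed

text \<open>\<open>ennreal C\<close> is 0 for negative \<open>C\<close>, hence the maximum.\<close>

lemma lattice_BV_sum_le:
  assumes "lattice_BV v \<le> ennreal C" "finite A"
  shows "(\<Sum>j\<in>A. \<bar>v j - v (j - 1)\<bar>) \<le> max C 0"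
proof -
  have "ennreal (\<Sum>j\<in>A. \<bar>v j - v (j - 1)\<bar>) = (\<Sum>j\<in>A. ennreal \<bar>v j - v (j - 1)\<bar>)"
    by (rule sum_ennreal[symmetric]) simp
  also have "\<dots> \<le> lattice_BV v"
    unfolding lattice_BV_def using assms(2) by (subst nonneg_infsum_complete) (auto intro!: SUP_upper)
  also have "\<dots> \<le> ennreal (max C 0)"
    using assms(1) by (rule order_trans) (simp add: ennreal_leI)
  finally show ?thesis by simp
qed

lemma total_variation_cart_le:
  fixes \<tau> :: "int \<Rightarrow> real ^ 'n"
  assumes "\<And>i. lattice_BV (\<lambda>j. \<tau> j $ i) \<le> ennreal C" "finite A"
  shows "(\<Sum>j\<in>A. norm (\<tau> j - \<tau> (j - 1))) \<le> real CARD('n) * max C 0"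
proof -
  have "(\<Sum>j\<in>A. norm (\<tau> j - \<tau> (j - 1))) \<le> (\<Sum>j\<in>A. \<Sum>i\<in>UNIV. \<bar>(\<tau> j - \<tau> (j - 1)) $ i\<bar>)"
    by (intro sum_mono norm_le_l1_cart)
  also have "\<dots> = (\<Sum>i\<in>UNIV. \<Sum>j\<in>A. \<bar>\<tau> j $ i - \<tau> (j - 1) $ i\<bar>)"
    by (subst sum.swap) simp
  also have "\<dots> \<le> (\<Sum>i\<in>(UNIV :: 'n set). max C 0)"
    by (intro sum_mono lattice_BV_sum_le assms)
  finally show ?thesis by simp
qed

section \<open>Choice of the parameters in the translation estimate\<close>

context cone_scheme
begin

text \<open>If all \<open>u 0 j\<close> vanish, then \<open>\<tau>\<close> is an arbitrary constant and has no a priori bound.\<close>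

lemma bounded_profile:
  assumes tau: "\<And>j. v 0 j \<noteq> 0 \<Longrightarrow> \<tau> j = u 0 j /\<^sub>R v 0 j"
    and TV: "\<And>a b. (\<Sum>i\<in>{a..b}. norm (\<tau> i - \<tau> (i - 1))) \<le> V"
  obtains \<tau>' where "\<And>j. v 0 j \<noteq> 0 \<Longrightarrow> \<tau>' j = u 0 j /\<^sub>R v 0 j"
    "\<And>a b. (\<Sum>i\<in>{a..b}. norm (\<tau>' i - \<tau>' (i - 1))) \<le> V" "\<And>j. norm (\<tau>' j) \<le> 1 / \<delta> + V"
proof (cases "\<forall>j. v 0 j = 0")
  case True
  have V: "0 \<le> V" using TV[of 1 0] by simp
  show thesis by (rule that[of "\<lambda>_. 0"]) (use True V delta_pos in simp_all)
next
  case False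
  then obtain j0 where j0: "v 0 j0 \<noteq> 0" by blast
  then have pos: "0 < v 0 j0" using v_nonneg[of 0 j0] by simp
  have "norm (\<tau> j0) = r 0 j0 / v 0 j0" unfolding tau[OF j0] using pos by (simp add: r_def divide_inverse mult.commute)
  also have "\<dots> \<le> 1 / \<delta>" using v_ge[of 0 j0] pos delta_pos by (simp add: field_simps)
  finally have b0: "norm (\<tau> j0) \<le> 1 / \<delta>" .
  have diff: "norm (\<tau> j - \<tau> i) \<le> V" if "i \<le> j" for i j
  proof -
    have "(\<Sum>l\<in>{i + 1..j}. \<tau> l - \<tau> (l - 1)) = \<tau> j - \<tau> i" using that by (subst sum_int_telescope) auto
    then have "norm (\<tau> j - \<tau> i) \<le> (\<Sum>l\<in>{i + 1..j}. norm (\<tau> l - \<tau> (l - 1)))" by (metis norm_sum)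
    then show ?thesis using TV[of "i + 1" j] by linarith
  qed
  have "norm (\<tau> j) \<le> 1 / \<delta> + V" for j
  proof -
    have "norm (\<tau> j - \<tau> j0) \<le> V"
      using diff[of j0 j] diff[of j j0] by (cases "j0 \<le> j") (simp_all add: norm_minus_commute)
    then show ?thesis using b0 norm_triangle_sub[of "\<tau> j" "\<tau> j0"] by linarith
  qed
  then have b: "\<And>j. norm (\<tau> j) \<le> 1 / \<delta> + V" .
  show thesis by (rule that[of \<tau>]) (fact tau, fact TV, fact b)
qed

text \<open>\<open>\<kappa>\<close> makes \<open>\<kappa> * m / \<delta>\<close> at most
  \<open>E / 4\<close>, and \<open>\<rho>\<close> is the size of \<open>R\<close> for which
  \<open>R + R / (\<kappa> * \<delta>)\<close> is \<open>E / 4\<close>. Each of the three summands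
  of \<open>R\<close> may be \<open>\<rho> / 3\<close>: the initial translation by
  \<open>init\<close>, the initial energy by the choice of \<open>\<epsilon>\<close>, the growth of
  the energy by \<open>h1\<close>. Another \<open>E / 4\<close> goes to the variation of the
  profile.\<close>

lemma scheme_translation_small:
  fixes \<tau> :: "int \<Rightarrow> 'a"
  assumes tau: "\<And>j. v 0 j \<noteq> 0 \<Longrightarrow> \<tau> j = u 0 j /\<^sub>R v 0 j"
    and TV: "\<And>a b. (\<Sum>i\<in>{a..b}. norm (\<tau> i - \<tau> (i - 1))) \<le> V"
    and E: "0 < E" and \<kappa>: "\<kappa> = \<delta> * E / (4 * (m + 1))" and \<rho>: "\<rho> = E / 4 / (1 + 1 / (\<kappa> * \<delta>))"
    and \<epsilon>: "\<epsilon> = \<rho> / (12 * (V\<^sup>2 + 1))"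
    and init: "\<And>N. (\<Sum>j\<in>{-N..N}. h * norm (u 0 (j + int n) - u 0 j)) \<le> \<rho> / 3"
    and h1: "T * (16 * \<phi> M * M\<^sup>2 * (V / \<epsilon>)\<^sup>2 * m) * h \<le> \<rho> / 3"
    and h2: "V / \<epsilon> * M * m / \<delta> * (real n * h + 2 * h) \<le> E / 4" and t: "0 \<le> t" "t \<le> T"
  shows "(\<Sum>j\<in>{-J..J}. h * norm (u t (j + int n) - u t j)) \<le> E"
proof -
  have V: "0 \<le> V" using TV[of 1 0] by simp
  have \<kappa>0: "0 < \<kappa>" using E delta_pos m_nonneg by (simp add: \<kappa>)
  define A where "A = 1 + 1 / (\<kappa> * \<delta>)"
  have A: "0 < A" using \<kappa>0 delta_pos by (simp add: A_def add_pos_pos)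
  have \<rho>A: "\<rho> * A = E / 4" using A unfolding \<rho> A_def[symmetric] by simp
  have \<rho>0: "0 < \<rho>" using E A unfolding \<rho> A_def[symmetric] by simp
  have V1: "0 < V\<^sup>2 + 1" by (simp add: add_nonneg_pos)
  have \<epsilon>0: "0 < \<epsilon>" unfolding \<epsilon> using \<rho>0 V1 by simp
  obtain \<tau>' where \<tau>': "\<And>j. v 0 j \<noteq> 0 \<Longrightarrow> \<tau>' j = u 0 j /\<^sub>R v 0 j"
    "\<And>a b. (\<Sum>i\<in>{a..b}. norm (\<tau>' i - \<tau>' (i - 1))) \<le> V" "\<And>j. norm (\<tau>' j) \<le> 1 / \<delta> + V"
    using bounded_profile[of \<tau> V, OF tau TV] by metis
  define R where "R = \<rho> / 3 + 4 * V\<^sup>2 * \<epsilon> + t * (16 * \<phi> M * M\<^sup>2 * (V / \<epsilon>)\<^sup>2 * h * m)"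
  have est: "(\<Sum>j\<in>{-J..J}. h * norm (u t (j + int n) - u t j))
    \<le> R + (\<kappa> * m + R / \<kappa>) / \<delta> + V / \<epsilon> * h * M * (real n + 2) * m / \<delta>"
    by (rule translation_estimate[OF \<tau>' t(1) \<epsilon>0 \<kappa>0 init R_def])
  have "V\<^sup>2 * \<epsilon> \<le> (V\<^sup>2 + 1) * \<epsilon>" using \<epsilon>0 by (intro mult_right_mono) auto
  also have "\<dots> = \<rho> / 12"
  proof -
    have "X * (\<rho> / (12 * X)) = \<rho> / 12" if "0 < X" for X using that by simp
    from this[OF V1] show ?thesis unfolding \<epsilon> .
  qed
  finally have R1: "4 * V\<^sup>2 * \<epsilon> \<le> \<rho> / 3" by simp
  define G where "G = 16 * \<phi> M * M\<^sup>2 * (V / \<epsilon>)\<^sup>2 * h * m"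
  have "0 \<le> G" unfolding G_def using phi_nonneg[OF M_nonneg] h_pos m_nonneg by simp
  then have "t * G \<le> T * G" using t(2) by (intro mult_right_mono)
  also have "T * G = T * (16 * \<phi> M * M\<^sup>2 * (V / \<epsilon>)\<^sup>2 * m) * h" by (simp add: G_def)
  finally have R2: "t * G \<le> \<rho> / 3" using h1 by linarith
  have "R \<le> \<rho>" using R1 R2 unfolding R_def G_def by linarith
  then have "R * A \<le> E / 4" using A unfolding \<rho>A[symmetric] by (intro mult_right_mono) auto
  moreover have "R * A = R + R / \<kappa> / \<delta>" using \<kappa>0 delta_pos by (simp add: A_def distrib_left)
  ultimately have RA: "R + R / \<kappa> / \<delta> \<le> E / 4" by simp
  have "\<delta> * E / (4 * x) * m / \<delta> = E / 4 * (m / x)" if "0 < x" for x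
    using that delta_pos by (simp add: field_simps)
  from this[of "m + 1"] have "\<kappa> * m / \<delta> = E / 4 * (m / (m + 1))" unfolding \<kappa> using m_nonneg by simp
  also have "\<dots> \<le> E / 4 * 1" using E m_nonneg by (intro mult_left_mono) auto
  finally have km: "\<kappa> * m / \<delta> \<le> E / 4" by simp
  have last: "V / \<epsilon> * h * M * (real n + 2) * m / \<delta> = V / \<epsilon> * M * m / \<delta> * (real n * h + 2 * h)"
    by (simp add: algebra_simps add_divide_distrib)
  have "R + (\<kappa> * m + R / \<kappa>) / \<delta> = (R + R / \<kappa> / \<delta>) + \<kappa> * m / \<delta>" by (simp add: add_divide_distrib)
  then show ?thesis using est RA km h2 E unfolding last by linarith
qed

end

text \<open>\<open>\<kappa>\<close>, \<open>\<rho>\<close> and \<open>\<epsilon>\<close> are fixed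
  first and depend only on \<open>E\<close> and on data common to all \<open>k\<close>. Mesh size
  and translation length are restricted afterwards, so the thresholds \<open>\<eta>\<close> and
  \<open>k0\<close> are independent of \<open>t\<close> and \<open>J\<close>.\<close>

lemma uniform_translation_continuity:
  fixes U :: "nat \<Rightarrow> real \<Rightarrow> int \<Rightarrow> 'a::real_inner"
  assumes cs: "\<And>k. cone_scheme \<phi> (h k) (U k) M \<delta> L m e" and h: "h \<longlonglongrightarrow> 0" and T: "0 < T"
    and tau: "\<And>k j. e \<bullet> U k 0 j \<noteq> 0 \<Longrightarrow> \<tau> k j = U k 0 j /\<^sub>R (e \<bullet> U k 0 j)"
    and TV: "\<And>k a b. (\<Sum>i\<in>{a..b}. norm (\<tau> k i - \<tau> k (i - 1))) \<le> V"
    and init: "\<And>k n N. (\<Sum>j\<in>{-N..N}. h k * norm (U k 0 (j + int n) - U k 0 j)) \<le> \<omega> (real n * h k)"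
    and \<omega>: "\<And>\<epsilon>. 0 < \<epsilon> \<Longrightarrow> \<exists>d>0. \<forall>s. \<bar>s\<bar> < d \<longrightarrow> \<omega> s \<le> \<epsilon>"
    and E: "0 < E"
  shows "\<exists>\<eta>>0. \<exists>k0. \<forall>k\<ge>k0. \<forall>n. real n * h k \<le> \<eta> \<longrightarrow>
      (\<forall>t\<in>{0..T}. \<forall>J. (\<Sum>j\<in>{-J..J}. h k * norm (U k t (j + int n) - U k t j)) \<le> E)"
proof -
  have c0: "0 \<le> M" "0 < \<delta>" using cone_scheme.M_nonneg[OF cs[of 0]] cone_scheme.delta_pos[OF cs[of 0]] by auto
  have m0: "0 \<le> m" by (rule cone_scheme.m_nonneg[OF cs[of 0]])
  have h0: "0 < h k" for k using cs[of k] by (simp add: cone_scheme_def lattice_ode_def)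
  have V: "0 \<le> V" using TV[of 0 1 0] by simp
  define \<kappa> where "\<kappa> = \<delta> * E / (4 * (m + 1))"
  have \<kappa>: "0 < \<kappa>" using c0 m0 E by (simp add: \<kappa>_def)
  define \<rho> where "\<rho> = E / 4 / (1 + 1 / (\<kappa> * \<delta>))"
  have \<rho>: "0 < \<rho>" using \<kappa> c0 E by (simp add: \<rho>_def add_pos_pos)
  define \<epsilon> where "\<epsilon> = \<rho> / (12 * (V\<^sup>2 + 1))"
  have \<epsilon>: "0 < \<epsilon>" using \<rho> by (simp add: \<epsilon>_def add_nonneg_pos)
  define G where "G = T * (16 * \<phi> M * M\<^sup>2 * (V / \<epsilon>)\<^sup>2 * m)"
  define Q where "Q = V / \<epsilon> * M * m / \<delta>"
  have phiM: "0 \<le> \<phi> M" using cs[of 0] c0 by (simp add: cone_scheme_def lattice_ode_def)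
  have G: "0 \<le> G" using T phiM m0 by (simp add: G_def)
  have Q: "0 \<le> Q" using V \<epsilon> c0 m0 by (simp add: Q_def)
  have "0 < \<rho> / 3" using \<rho> by simp
  then obtain d where d: "0 < d" "\<And>s. \<bar>s\<bar> < d \<Longrightarrow> \<omega> s \<le> \<rho> / 3" using \<omega> by blast
  \<comment> \<open>\<open>Q\<close> multiplies \<open>n * h + 2 * h\<close>, which is at most
    \<open>3 * q\<close>, and \<open>G\<close> multiplies \<open>h\<close>. The 1 in the
    denominators covers vanishing \<open>Q\<close> and \<open>G\<close>.\<close>
  define q where "q = E / 12 / (Q + 1)"
  define g where "g = \<rho> / 3 / (G + 1)"
  have q: "0 < q" and g: "0 < g" using E Q \<rho> G by (auto simp: q_def g_def)
  have "0 < min q g" using q g by simp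
  from order_tendstoD(2)[OF h this] obtain k0 where k0: "\<And>k. k \<ge> k0 \<Longrightarrow> h k < min q g"
    unfolding eventually_sequentially by blast
  have cancel: "X * (a / X) = a" if "0 < X" for X a :: real using that by simp
  have Qq: "Q * (3 * q) \<le> E / 4"
  proof -
    have "Q * q \<le> (Q + 1) * q" using q by (intro mult_right_mono) auto
    also have "\<dots> = E / 12" unfolding q_def by (rule cancel) (use Q in simp)
    finally show ?thesis by simp
  qed
  have Gg: "G * g \<le> \<rho> / 3"
  proof -
    have "G * g \<le> (G + 1) * g" using g by (intro mult_right_mono) auto
    also have "\<dots> = \<rho> / 3" unfolding g_def by (rule cancel) (use G in simp)
    finally show ?thesis .
  qed
  have main: "(\<Sum>j\<in>{-J..J}. h k * norm (U k t (j + int n) - U k t j)) \<le> E"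
    if k: "k \<ge> k0" and n: "real n * h k \<le> min (d / 2) q" and t: "t \<in> {0..T}" for k n t J
  proof -
    interpret cone_scheme \<phi> "h k" "U k" M \<delta> L m e by (rule cs)
    show ?thesis
    proof (rule scheme_translation_small[OF _ TV E \<kappa>_def \<rho>_def \<epsilon>_def])
      show "\<tau> k j = U k 0 j /\<^sub>R v 0 j" if "v 0 j \<noteq> 0" for j
        using tau[of k j] that by (simp add: v_def)
      show "(\<Sum>j\<in>{-N..N}. h k * norm (U k 0 (j + int n) - U k 0 j)) \<le> \<rho> / 3" for N
      proof -
        have "\<bar>real n * h k\<bar> < d" using n d(1) h0[of k] by simp
        then show ?thesis using init[where N = N and k = k and n = n] d(2)[of "real n * h k"] by linarith
      qed
      have "G * h k \<le> G * g" using k0[OF k] G by (intro mult_left_mono) auto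
      then show "T * (16 * \<phi> M * M\<^sup>2 * (V / \<epsilon>)\<^sup>2 * m) * h k \<le> \<rho> / 3" using Gg unfolding G_def by linarith
      have "Q * (real n * h k + 2 * h k) \<le> Q * (3 * q)"
        using k0[OF k] n Q by (intro mult_left_mono) auto
      then show "V / \<epsilon> * M * m / \<delta> * (real n * h k + 2 * h k) \<le> E / 4" using Qq unfolding Q_def by linarith
    qed (use t in auto)
  qed
  have "0 < min (d / 2) q" using d(1) q by simp
  then show ?thesis using main by blast
qed

section \<open>Lebesgue integrals of the limit function and test functions\<close>

lemma bounded_set_integrable:
  fixes f :: "'a::euclidean_space \<Rightarrow> 'b::{banach, second_countable_topology}"
  assumes f: "f \<in> borel_measurable borel" and b: "\<And>x. norm (f x) \<le> M" and K: "compact K" and M: "0 \<le> M"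
  shows "set_integrable lborel K f" "set_integrable lebesgue K f"
    "(LINT x:K|lebesgue. norm (f x)) \<le> M * measure lborel K"
proof -
  have Kb: "K \<in> sets borel" using K by (simp add: borel_compact)
  have Kf: "emeasure lborel K < \<infinity>" using K by (intro emeasure_bounded_finite compact_imp_bounded)
  have IK: "integrable lborel (\<lambda>x. M * indicator K x)"
    using Kb Kf by (intro integrable_mult_right integrable_real_indicator) simp_all
  have le: "norm (indicator K x *\<^sub>R f x) \<le> M * indicator K x" for x
    using b[of x] by (simp add: indicator_def)
  have m: "(\<lambda>x. indicator K x *\<^sub>R f x) \<in> borel_measurable lborel" using f Kb by simp
  show I: "set_integrable lborel K f"
    unfolding set_integrable_def
  proof (rule Bochner_Integration.integrable_bound[OF IK m])
    show "AE x in lborel. norm (indicator K x *\<^sub>R f x) \<le> norm (M * indicator K x)"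
      by (intro AE_I2 order_trans[OF le]) simp
  qed
  then show "set_integrable lebesgue K f"
    unfolding set_integrable_def by (simp add: integrable_completion m)
  have m2: "(\<lambda>x. indicator K x *\<^sub>R norm (f x)) \<in> borel_measurable lborel" using f Kb by simp
  have "(LINT x:K|lebesgue. norm (f x)) = (\<integral>x. indicator K x *\<^sub>R norm (f x) \<partial>lborel)"
    unfolding set_lebesgue_integral_def by (rule integral_completion[OF m2])
  also have "\<dots> \<le> (\<integral>x. M * indicator K x \<partial>lborel)"
  proof (rule integral_mono)
    have "integrable lborel (\<lambda>x. norm (indicator K x *\<^sub>R f x))"
      using I unfolding set_integrable_def by (rule integrable_norm)
    then show "integrable lborel (\<lambda>x. indicator K x *\<^sub>R norm (f x))" by simp
    show "indicator K x *\<^sub>R norm (f x) \<le> M * indicator K x" for x using le[of x] by simp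
  qed (rule IK)
  also have "\<dots> = M * measure lborel K" using Kb by simp
  finally show "(LINT x:K|lebesgue. norm (f x)) \<le> M * measure lborel K" .
qed

text \<open>A compact support in the half-open strip leaves a gap before \<open>T\<close>, and
  \<open>T1\<close> is the middle of such a gap. There \<open>\<psi>\<close> vanishes together with
  its derivatives, so on \<open>(0, T)\<close> these coincide with their extensions by 0 from
  \<open>[0, T1]\<close>.\<close>

lemma test_function_cutoff:
  assumes T: "0 < T" and test: "test_function T \<psi>"
  obtains \<psi>x \<psi>t T1 X where "cutoff_test \<psi> \<psi>x \<psi>t T1 X" "T1 < T"
    "\<And>x t. t \<in> {0<..<T} \<Longrightarrow> deriv (\<lambda>s. \<psi> x s) t = cutoff_test.ext T1 \<psi>t (x, t)"
    "\<And>x t. t \<in> {0<..<T} \<Longrightarrow> deriv (\<lambda>y. \<psi> y t) x = cutoff_test.ext T1 \<psi>x (x, t)"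
proof -
  obtain D K where D0: "D 0 0 = \<psi>"
    and Dc: "\<And>i j. continuous_on (UNIV \<times> {0..<T}) (\<lambda>(x, t). D i j x t)"
    and Dx: "\<And>i j x t. t \<in> {0..<T} \<Longrightarrow> ((\<lambda>y. D i j y t) has_real_derivative D (Suc i) j x t) (at x)"
    and Dt: "\<And>i j x t. t \<in> {0..<T} \<Longrightarrow> ((\<lambda>s. D i j x s) has_real_derivative D i (Suc j) x t) (at t within {0..<T})"
    and K: "compact K" "K \<subseteq> UNIV \<times> {0..<T}" and Kz: "\<And>x t. t \<in> {0..<T} \<Longrightarrow> (x, t) \<notin> K \<Longrightarrow> \<psi> x t = 0"
    using test unfolding test_function_def by (elim exE conjE) metis
  define \<psi>x where "\<psi>x = D 1 0"
  define \<psi>t where "\<psi>t = D 0 1"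
  have px: "((\<lambda>y. \<psi> y t) has_real_derivative \<psi>x x t) (at x)" if "t \<in> {0..<T}" for x t
    using Dx[OF that, of 0 0 x] by (simp add: D0 \<psi>x_def)
  have pt: "((\<lambda>s. \<psi> x s) has_real_derivative \<psi>t x t) (at t within {0..<T})" if "t \<in> {0..<T}" for x t
    using Dt[OF that, of 0 0 x] by (simp add: D0 \<psi>t_def)
  have pt': "((\<lambda>s. \<psi> x s) has_real_derivative \<psi>t x t) (at t)" if t: "t \<in> {0<..<T}" for x t
  proof -
    have "at t within {0..<T} = at t" by (rule at_within_nhd[of _ "{0<..<T}"]) (use t in auto)
    then show ?thesis using pt[of t x] t by simp
  qed
  have "bounded (fst ` K)" "compact (snd ` K)"
    using K(1) by (auto intro!: compact_imp_bounded compact_continuous_image continuous_on_fst continuous_on_snd continuous_on_id)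
  then obtain X where X: "0 < X" "\<And>x. x \<in> fst ` K \<Longrightarrow> norm x \<le> X" unfolding bounded_pos by blast
  obtain T0 where T0: "0 \<le> T0" "T0 < T" "\<And>t. t \<in> snd ` K \<Longrightarrow> t \<le> T0"
  proof (cases "K = {}")
    case True
    then show thesis using that[of 0] T by simp
  next
    case False
    then obtain s where s: "s \<in> snd ` K" "\<And>t. t \<in> snd ` K \<Longrightarrow> t \<le> s"
      using compact_attains_sup[OF \<open>compact (snd ` K)\<close>] by blast
    then have "s \<in> {0..<T}" using K(2) by fastforce
    then show thesis using that[of s] s(2) by simp
  qed
  have zX: "\<psi> x t = 0" if "t \<in> {0..<T}" "X < \<bar>x\<bar>" for x t
  proof (rule Kz[OF that(1)])
    show "(x, t) \<notin> K" using X(2)[of x] that(2) by force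
  qed
  have zT: "\<psi> x t = 0" if "t \<in> {0..<T}" "T0 < t" for x t
  proof (rule Kz[OF that(1)])
    show "(x, t) \<notin> K" using T0(3)[of t] that(2) by force
  qed
  have zXx: "\<psi>x x t = 0" if t: "t \<in> {0..<T}" and x: "X < \<bar>x\<bar>" for x t
  proof -
    have "open {y::real. X < \<bar>y\<bar>}" by (intro open_Collect_less continuous_intros)
    then have "((\<lambda>y. 0) has_real_derivative \<psi>x x t) (at x)"
      by (rule has_field_derivative_transform_within_open[OF px[OF t]]) (use x zX[OF t] in auto)
    then show ?thesis using DERIV_unique DERIV_const by blast
  qed
  \<comment> \<open>Time 0 is included, where the derivative is one-sided. It is unique because
    every point of \<open>[0, T)\<close> is a limit point of this interval.\<close>
  have zXt: "\<psi>t x t = 0" if t: "t \<in> {0..<T}" and x: "X < \<bar>x\<bar>" for x t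
  proof -
    have "((\<lambda>s. 0) has_real_derivative \<psi>t x t) (at t within {0..<T})"
      by (rule has_field_derivative_transform_within[OF pt[OF t], of 1]) (use t zX x in auto)
    then have 1: "((\<lambda>s. 0::real) has_vector_derivative \<psi>t x t) (at t within {0..<T})"
      by (simp add: has_real_derivative_iff_has_vector_derivative)
    have "t islimpt {t<..<T}" by (rule islimpt_greaterThanLessThan1) (use t in auto)
    then have "t islimpt {0..<T}" by (rule islimpt_subset) (use t in auto)
    then have "at t within {0..<T} \<noteq> bot" by (simp add: trivial_limit_within)
    then show ?thesis by (rule vector_derivative_unique_within[OF _ 1 has_vector_derivative_const])
  qed
  have zTx: "\<psi>x x t = 0" if t: "t \<in> {0..<T}" and x: "T0 < t" for x t
  proof -
    have "((\<lambda>y. 0) has_real_derivative \<psi>x x t) (at x)"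
      by (rule has_field_derivative_transform_within_open[OF px[OF t] open_UNIV]) (use zT[OF t x] in auto)
    then show ?thesis using DERIV_unique DERIV_const by blast
  qed
  have zTt: "\<psi>t x t = 0" if t: "t \<in> {0<..<T}" and x: "T0 < t" for x t
  proof -
    have "((\<lambda>s. 0) has_real_derivative \<psi>t x t) (at t)"
      by (rule has_field_derivative_transform_within_open[OF pt'[OF t], of "{max 0 T0<..<T}"])
        (use t x zT in auto)
    then show ?thesis using DERIV_unique DERIV_const by blast
  qed
  define T1 where "T1 = (T0 + T) / 2"
  have T1: "0 < T1" "T0 < T1" "T1 < T" using T0 T by (auto simp: T1_def)
  have sub: "UNIV \<times> {0..T1} \<subseteq> UNIV \<times> {0..<T}" using T1 by auto
  have cut: "cutoff_test \<psi> \<psi>x \<psi>t T1 X"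
  proof
    show "0 < T1" "0 \<le> X" using T1 X by auto
    show "continuous_on (UNIV \<times> {0..T1}) (\<lambda>(x, t). \<psi> x t)"
      using continuous_on_subset[OF Dc[of 0 0] sub] by (simp add: D0)
    show "continuous_on (UNIV \<times> {0..T1}) (\<lambda>(x, t). \<psi>x x t)"
      using continuous_on_subset[OF Dc[of 1 0] sub] by (simp add: \<psi>x_def)
    show "continuous_on (UNIV \<times> {0..T1}) (\<lambda>(x, t). \<psi>t x t)"
      using continuous_on_subset[OF Dc[of 0 1] sub] by (simp add: \<psi>t_def)
    show "((\<lambda>y. \<psi> y t) has_real_derivative \<psi>x x t) (at x)" if "t \<in> {0..T1}" for x t
      by (rule px) (use that T1 in auto)
    show "((\<lambda>s. \<psi> x s) has_real_derivative \<psi>t x t) (at t)" if "t \<in> {0<..<T1}" for x t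
      by (rule pt') (use that T1 in auto)
    show "\<psi> x t = 0 \<and> \<psi>x x t = 0 \<and> \<psi>t x t = 0" if "t \<in> {0..T1}" "X < \<bar>x\<bar>" for x t
    proof -
      have t: "t \<in> {0..<T}" using that(1) T1 by auto
      show ?thesis using zX[OF t that(2)] zXx[OF t that(2)] zXt[OF t that(2)] by simp
    qed
    show "\<psi> x T1 = 0" for x by (rule zT) (use T1 in auto)
  qed
  show thesis
  proof (rule that[OF cut T1(3)])
    fix x t assume t: "t \<in> {0<..<T}"
    then have t': "t \<in> {0..<T}" by simp
    show "deriv (\<lambda>s. \<psi> x s) t = cutoff_test.ext T1 \<psi>t (x, t)"
      unfolding cutoff_test.ext_def[OF cut] DERIV_imp_deriv[OF pt'[OF t]]
      using zTt[OF t, of x] t T1 by auto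
    show "deriv (\<lambda>y. \<psi> y t) x = cutoff_test.ext T1 \<psi>x (x, t)"
      unfolding cutoff_test.ext_def[OF cut] DERIV_imp_deriv[OF px[OF t']]
      using zTx[OF t', of x] t T1 by auto
  qed
qed

text \<open>The iterated Lebesgue integrals are replaced by Borel ones slice by slice before
  Fubini's theorem is applied. Restricting time to \<open>(0, T)\<close> is harmless: outside
  \<open>[0, T1]\<close> the integrand vanishes, and the time 0 is a null set.\<close>

lemma weak_integral_eq:
  fixes f :: "real \<times> real \<Rightarrow> 'a::euclidean_space"
  assumes f: "integrable lborel f" and z: "\<And>x t. t \<notin> {0..T1} \<Longrightarrow> f (x, t) = 0" and T1: "T1 < T"
    and g: "\<And>x t. t \<in> {0<..<T} \<Longrightarrow> g t x = f (x, t)"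
  shows "(LINT t:{0<..<T}|lebesgue. LINT x|lebesgue. g t x) = (\<integral>p. f p \<partial>lborel)"
proof -
  have fp: "integrable (lborel \<Otimes>\<^sub>M lborel) (\<lambda>(x, t). f (x, t))"
    unfolding lborel_prod using f by simp
  have fm: "f \<in> borel_measurable borel" using borel_measurable_integrable[OF f] by simp
  have slice: "(\<lambda>x. f (x, t)) \<in> borel_measurable lborel" for t
  proof -
    have "(\<lambda>x::real. (x, t)) \<in> borel_measurable borel"
      by (intro borel_measurable_continuous_onI continuous_intros)
    from measurable_compose[OF this fm] show ?thesis by simp
  qed
  define J where "J t = (\<integral>x. f (x, t) \<partial>lborel)" for t
  have Jm: "J \<in> borel_measurable lborel"
    unfolding J_def using lborel_pair.integrable_snd[OF fp] by (rule borel_measurable_integrable)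
  have "(LINT t:{0<..<T}|lebesgue. LINT x|lebesgue. g t x) = (\<integral>t. indicator {0<..<T} t *\<^sub>R J t \<partial>lebesgue)"
    unfolding set_lebesgue_integral_def
  proof (intro Bochner_Integration.integral_cong refl)
    fix t
    show "indicator {0<..<T} t *\<^sub>R (LINT x|lebesgue. g t x) = indicator {0<..<T} t *\<^sub>R J t"
    proof (cases "t \<in> {0<..<T}")
      case True
      have "(LINT x|lebesgue. g t x) = (LINT x|lebesgue. f (x, t))" by (simp only: g[OF True])
      also have "\<dots> = J t" unfolding J_def by (rule integral_completion[OF slice])
      finally show ?thesis by simp
    qed simp
  qed
  also have "\<dots> = (\<integral>t. indicator {0<..<T} t *\<^sub>R J t \<partial>lborel)"
    using Jm by (intro integral_completion) simp
  also have "\<dots> = (\<integral>t. J t \<partial>lborel)"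
  proof (rule integral_cong_AE)
    show "(\<lambda>t. indicator {0<..<T} t *\<^sub>R J t) \<in> borel_measurable lborel" using Jm by simp
    show "AE t in lborel. indicator {0<..<T} t *\<^sub>R J t = J t"
      using AE_lborel_singleton[of "0::real"]
    proof eventually_elim
      case (elim t)
      show ?case
      proof (cases "t \<in> {0..T1}")
        case True
        then show ?thesis using elim T1 by simp
      next
        case False
        then have "J t = 0" unfolding J_def using z[OF False] by simp
        then show ?thesis by simp
      qed
    qed
  qed (rule Jm)
  also have "\<dots> = (\<integral>p. f p \<partial>lborel)"
    unfolding J_def using lborel_pair.integral_snd[OF fp] by (simp add: lborel_prod)
  finally show ?thesis .
qed

theorem theorem3p1:
  fixes \<phi> \<phi>' \<phi>'' :: "real \<Rightarrow> real"
    and u0 :: "real \<Rightarrow> real ^ 'n"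
    and T \<delta> C :: real
    and \<Delta>x :: "nat \<Rightarrow> real"
    and U \<tau> :: "nat \<Rightarrow> real \<Rightarrow> int \<Rightarrow> real ^ 'n"
  assumes T: "T > 0"
    and phi_range: "\<forall>r\<ge>0. \<phi> r \<ge> 0"
    and phi_deriv: "\<forall>r\<ge>0. (\<phi> has_real_derivative \<phi>' r) (at r within {0..})"
    and phi_deriv2: "\<forall>r\<ge>0. (\<phi>' has_real_derivative \<phi>'' r) (at r within {0..})"
    and A1: "\<phi> 0 = 0" "\<forall>r\<in>relevant u0. r > 0 \<longrightarrow> \<phi> r > 0" "\<forall>r\<in>relevant u0. \<phi>' r \<ge> 0"
    and A2: "bounded (\<phi> ` relevant u0)" "bounded (\<phi>' ` relevant u0)"
      "bounded (\<phi>'' ` relevant u0)"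
    and A3: "{r. r \<ge> 0 \<and> 2 * \<phi>' r + r * \<phi>'' r = 0} \<in> null_sets lebesgue"
    and A4: "u0 \<in> borel_measurable lebesgue" "integrable lebesgue (\<lambda>x. norm (u0 x))"
      "Linfty lebesgue (\<lambda>x. norm (u0 x))"
      "\<forall>K. \<exists>C\<^sub>K>0. ereal C\<^sub>K \<le> (INF x\<in>\<A> (\<lambda>y. norm (u0 y)) K. ereal (norm (u0 x)))"
    and delta: "sqrt ((real CARD('n) - 1) / real CARD('n)) < \<delta>" "\<delta> < 1"
    and A5: "\<forall>x. u0 x \<in> Gamma_cone \<delta>"
    and dx: "\<forall>k. \<Delta>x k > 0" "\<Delta>x \<longlonglongrightarrow> 0"
    and scheme: "\<forall>k. scheme_solution \<phi> u0 (\<Delta>x k) (U k)"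
    and tau: "\<forall>k. \<forall>t\<ge>0. is_tau (U k t) (\<tau> k t)"
    and tau_BV: "\<forall>k i. lattice_BV (\<lambda>j. \<tau> k 0 j $ i) \<le> ennreal C"
  shows "\<exists>(u :: real \<Rightarrow> real \<Rightarrow> real ^ 'n) \<sigma>.
           Linfty_L1loc T u \<and>
           strict_mono (\<sigma> :: nat \<Rightarrow> nat) \<and>
           tendsto_L1loc (UNIV \<times> {0<..<T})
             (\<lambda>k (x, t). step_fun (\<Delta>x (\<sigma> k)) (U (\<sigma> k) t) x) (\<lambda>(x, t). u x t) \<and>
           weak_solution \<phi> T u0 u"
proof -
  obtain M where M: "0 \<le> M" "relevant u0 = {0..M}" and u0M: "AE x in lebesgue. norm (u0 x) \<le> M"
    using relevant_interval[OF A4(3)] by metis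
  have phi_cont: "continuous_on {0..} \<phi>" by (rule DERIV_continuous_on[where D = \<phi>']) (use phi_deriv in simp)
  have phi0: "0 \<le> \<phi> r" if "0 \<le> r" for r using phi_range that by simp
  have phi_pos: "0 < \<phi> r" if "0 < r" "r \<le> M" for r
    using A1(2) that unfolding M(2) by simp
  have phi_mono: "\<phi> r \<le> \<phi> s" if rs: "0 \<le> r" "r \<le> s" "s \<le> M" for r s
  proof (rule mono_on_of_derivative_nonneg[OF _ _ rs])
    show "(\<phi> has_real_derivative \<phi>' r) (at r within {0..})" if "0 \<le> r" for r using phi_deriv that by simp
    show "0 \<le> \<phi>' r" if "0 \<le> r" "r \<le> M" for r using A1(3) that unfolding M(2) by simp
  qed
  have lip: "\<exists>L\<ge>0. \<forall>r\<in>{0..B}. \<forall>s\<in>{0..B}. \<bar>r * \<phi> r - s * \<phi> s\<bar> \<le> L * \<bar>r - s\<bar>" for B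
  proof (rule flux_lipschitz_on)
    show "(\<phi> has_real_derivative \<phi>' r) (at r within {0..})" if "0 \<le> r" for r using phi_deriv that by simp
    show "(\<phi>' has_real_derivative \<phi>'' r) (at r within {0..})" if "0 \<le> r" for r using phi_deriv2 that by simp
  qed
  obtain L where L: "0 \<le> L" "\<And>r s. r \<in> {0..M} \<Longrightarrow> s \<in> {0..M} \<Longrightarrow> \<bar>r * \<phi> r - s * \<phi> s\<bar> \<le> L * \<bar>r - s\<bar>"
    using lip[of M] by blast
  have \<delta>0: "0 < \<delta>"
  proof -
    have "0 \<le> sqrt ((real CARD('n) - 1) / real CARD('n))" by (simp add: Suc_leI)
    then show ?thesis using delta(1) by linarith
  qed
  have h0: "0 < \<Delta>x k" for k using dx(1) by simp
  \<comment> \<open>The initial function enters the scheme and the weak formulation through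
    integrals, so a Borel version may replace it there.\<close>
  obtain f where fm: "f \<in> borel_measurable borel" and fu: "AE x in lborel. u0 x = f x"
    using lebesgue_measurable_borel_version[OF A4(1)] by metis
  have fu': "AE x in lebesgue. u0 x = f x" using fu by (rule AE_completion)
  have f: "integrable lborel f"
  proof -
    have "integrable lebesgue u0" using A4(2) by (subst (asm) integrable_norm_iff) (rule A4(1), assumption)
    then have "integrable lebesgue f"
      by (rule Bochner_Integration.integrable_cong_AE_imp) (use fm fu' in \<open>auto simp: measurable_completion\<close>)
    then show ?thesis using integrable_completion[of f lborel] fm by simp
  qed
  have fM: "AE x in lborel. norm (f x) \<le> M"
  proof -
    have "AE x in lebesgue. norm (f x) \<le> M" using u0M fu' by eventually_elim simp
    then show ?thesis by (simp add: AE_completion_iff)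
  qed
  have fcone: "AE x in lborel. \<delta> * norm (f x) \<le> e_vec \<bullet> f x"
    using fu
  proof eventually_elim
    case (elim x)
    then show ?case using A5[rule_format, of x] by (simp add: Gamma_cone_def)
  qed
  define m where "m = (\<integral>x. norm (f x) \<partial>lborel)"
  have init: "U k 0 j = cell_avg (\<Delta>x k) f j" for k j
  proof -
    have "U k 0 j = (1 / \<Delta>x k) *\<^sub>R (LINT x:cell (\<Delta>x k) j|lebesgue. u0 x)"
      using scheme unfolding scheme_solution_def by blast
    also have "(LINT x:cell (\<Delta>x k) j|lebesgue. u0 x) = (LINT x:cell (\<Delta>x k) j|lebesgue. f x)"
      unfolding set_lebesgue_integral_def
    proof (rule integral_cong_AE)
      show "(\<lambda>x. indicator (cell (\<Delta>x k) j) x *\<^sub>R u0 x) \<in> borel_measurable lebesgue"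
        using A4(1) by (intro borel_measurable_scaleR borel_measurable_indicator) (auto simp: cell_def)
      show "(\<lambda>x. indicator (cell (\<Delta>x k) j) x *\<^sub>R f x) \<in> borel_measurable lebesgue"
        using fm by (intro measurable_completion) simp
      show "AE x in lebesgue. indicator (cell (\<Delta>x k) j) x *\<^sub>R u0 x = indicator (cell (\<Delta>x k) j) x *\<^sub>R f x"
        using fu' by eventually_elim simp
    qed
    also have "\<dots> = (LINT x:cell (\<Delta>x k) j|lborel. f x)"
      unfolding set_lebesgue_integral_def using fm by (intro integral_completion) simp
    finally show ?thesis by (simp add: cell_avg_def)
  qed
  have ode: "lattice_ode \<phi> (\<Delta>x k) (U k)" for k
    by (rule lattice_ode_of_scheme_solution[OF h0 _ phi0 phi_cont]) (use scheme in blast)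
  have init_bound: "norm (U k 0 j) \<le> M" for k j
    unfolding init by (rule norm_cell_avg_le[OF h0 f fM M(1)])
  have bound: "norm (U k t j) \<le> M" if "0 \<le> t" for k t j
    by (rule lattice_ode.norm_le_of_initial[OF ode M(1) lip phi_mono init_bound that])
  have init_cone: "\<delta> * norm (U k 0 j) \<le> e_vec \<bullet> U k 0 j" for k j
    unfolding init by (rule cell_avg_cone[OF h0 f fcone]) (use \<delta>0 in simp)
  have cs: "cone_scheme \<phi> (\<Delta>x k) (U k) M \<delta> L m e_vec" for k
  proof -
    interpret lattice_ode \<phi> "\<Delta>x k" "U k" by (rule ode)
    show ?thesis
    proof
      show "\<delta> * norm (U k t j) \<le> e_vec \<bullet> U k t j" if "0 \<le> t" for t j
        by (rule cone_of_initial[OF init_cone _ that]) (use \<delta>0 in simp)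
      \<comment> \<open>As \<open>e_vec\<close> is a unit vector, the initial mass is at most the L1
        norm of \<open>f\<close>.\<close>
      show "(\<Sum>i\<in>{a..b}. \<Delta>x k * (e_vec \<bullet> U k 0 i)) \<le> m" for a b
      proof -
        have "(\<Sum>i\<in>{a..b}. \<Delta>x k * (e_vec \<bullet> U k 0 i)) \<le> (\<Sum>i\<in>{a..b}. \<Delta>x k * norm (cell_avg (\<Delta>x k) f i))"
        proof (intro sum_mono mult_left_mono)
          fix i
          show "e_vec \<bullet> U k 0 i \<le> norm (cell_avg (\<Delta>x k) f i)"
            using norm_cauchy_schwarz[of e_vec "U k 0 i"] by (simp add: norm_e_vec init)
        qed (use h0[of k] in simp)
        also have "\<dots> \<le> m" unfolding m_def by (rule sum_cell_avg_le[OF h0 f]) simp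
        finally show ?thesis .
      qed
    qed (fact M(1) \<delta>0 norm_e_vec L(1) bound phi_pos phi_mono L(2))+
  qed
  \<comment> \<open>The L1 modulus of continuity of the initial data controls the initial
    translations for all mesh sizes at once.\<close>
  define \<omega> where "\<omega> s = (\<integral>x. norm (f (x + s) - f x) \<partial>lborel)" for s
  have space: "\<exists>\<eta>>0. \<exists>k0. \<forall>k\<ge>k0. \<forall>n. real n * \<Delta>x k \<le> \<eta> \<longrightarrow>
      (\<forall>t\<in>{0..T}. \<forall>J. (\<Sum>j\<in>{-J..J}. \<Delta>x k * norm (U k t (j + int n) - U k t j)) \<le> E)" if E: "0 < E" for E
  proof (rule uniform_translation_continuity[OF cs dx(2) T, of "\<lambda>k. \<tau> k 0" "real CARD('n) * max C 0" \<omega>])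
    fix k j assume nz: "e_vec \<bullet> U k 0 j \<noteq> 0"
    have "is_tau (U k 0) (\<tau> k 0)" using tau by simp
    then have "\<tau> k 0 j = (if U k 0 j \<noteq> 0 then U k 0 j /\<^sub>R (U k 0 j \<bullet> e_vec) else \<tau> k 0 (j + 1))"
      unfolding is_tau_def by blast
    moreover have "U k 0 j \<noteq> 0" using nz by auto
    ultimately show "\<tau> k 0 j = U k 0 j /\<^sub>R (e_vec \<bullet> U k 0 j)" by (simp add: inner_commute)
  next
    show "(\<Sum>i\<in>{a..b}. norm (\<tau> k 0 i - \<tau> k 0 (i - 1))) \<le> real CARD('n) * max C 0" for k a b
      by (rule total_variation_cart_le) (use tau_BV in simp_all)
    show "(\<Sum>j\<in>{-N..N}. \<Delta>x k * norm (U k 0 (j + int n) - U k 0 j)) \<le> \<omega> (real n * \<Delta>x k)" for k n N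
      unfolding init \<omega>_def by (rule sum_cell_avg_translation_le[OF h0 f]) simp
    show "\<exists>d>0. \<forall>s. \<bar>s\<bar> < d \<longrightarrow> \<omega> s \<le> \<epsilon>" if "0 < \<epsilon>" for \<epsilon>
      using integrable_imp_L1_translation_continuous[OF f] that
      unfolding L1_translation_continuous_def \<omega>_def by blast
  qed (rule E)
  define q where "q = \<phi> M * M"
  have q: "0 \<le> q" unfolding q_def using phi0[OF M(1)] M(1) by simp
  have flux: "norm (lattice_ode.flux \<phi> (U k) t j) \<le> q" if "t \<in> {0..T}" for k t j
  proof -
    have t: "0 \<le> t" using that by simp
    have "\<phi> (norm (U k t j)) * norm (U k t j) \<le> \<phi> M * M"
      using phi_mono[of "norm (U k t j)" M] bound[OF t, of k j] phi0[of M] M(1) by (intro mult_mono) simp_all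
    then show ?thesis
      using phi0[of "norm (U k t j)"] unfolding q_def lattice_ode.flux_def[OF ode] by simp
  qed
  have bound': "norm (U k t j) \<le> M" if "t \<in> {0..T}" for k t j using bound that by simp
  have cont: "continuous_on {0..T} (\<lambda>t. U k t j)" for k j
    by (rule continuous_on_subset[OF lattice_ode.u_cont[OF ode]]) auto
  have time: "norm (\<Sum>i<n. \<Delta>x k *\<^sub>R (U k s (j + int i) - U k t (j + int i))) \<le> 2 * q * \<bar>s - t\<bar>"
    if "s \<in> {0..T}" "t \<in> {0..T}" for k s t j n
    by (rule lattice_ode.block_time_estimate[OF ode flux that])
  have q2: "0 \<le> 2 * q" using q by simp
  have "\<exists>\<sigma> u. strict_mono (\<sigma> :: nat \<Rightarrow> nat) \<and> u \<in> borel_measurable (borel :: (real \<times> real) measure) \<and>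
      (\<forall>p. norm (u p) \<le> M) \<and> (AE p in lborel. snd p \<in> {0..T} \<longrightarrow>
      (\<lambda>k. U (\<sigma> k) (snd p) (cell_index (\<Delta>x (\<sigma> k)) (fst p))) \<longlonglongrightarrow> u p)"
  proof (rule lattice_compactness[of \<Delta>x T "2 * q" U M, OF h0 dx(2) T q2 bound' cont time space])
    fix \<sigma> :: "nat \<Rightarrow> nat" and u :: "real \<times> real \<Rightarrow> real ^ 'n"
    assume "strict_mono \<sigma>" "u \<in> borel_measurable (borel :: (real \<times> real) measure)" "\<And>p. norm (u p) \<le> M"
      "AE p in lborel. snd p \<in> {0..T} \<longrightarrow>
        (\<lambda>k. U (\<sigma> k) (snd p) (cell_index (\<Delta>x (\<sigma> k)) (fst p))) \<longlonglongrightarrow> u p"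
    then show ?thesis by (intro exI[of _ \<sigma>] exI[of _ u] conjI allI)
  qed
  then obtain \<sigma> u where lim: "strict_mono (\<sigma> :: nat \<Rightarrow> nat) \<and> u \<in> borel_measurable (borel :: (real \<times> real) measure) \<and>
      (\<forall>p. norm (u p) \<le> M) \<and> (AE p in lborel. snd p \<in> {0..T} \<longrightarrow>
      (\<lambda>k. U (\<sigma> k) (snd p) (cell_index (\<Delta>x (\<sigma> k)) (fst p))) \<longlonglongrightarrow> u p)"
    by (elim exE) (rule that)
  note \<sigma> = lim[THEN conjunct1] and um = lim[THEN conjunct2, THEN conjunct1]
    and ub = lim[THEN conjunct2, THEN conjunct2, THEN conjunct1, rule_format]
    and conv = lim[THEN conjunct2, THEN conjunct2, THEN conjunct2]
  have h\<sigma>: "(\<lambda>k. \<Delta>x (\<sigma> k)) \<longlonglongrightarrow> 0" using LIMSEQ_subseq_LIMSEQ[OF dx(2) \<sigma>] by (simp add: o_def)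
  have uleb: "u \<in> borel_measurable lebesgue" using um by (intro measurable_completion) simp
  have L1loc: "Linfty_L1loc T (\<lambda>x t. u (x, t))"
    unfolding Linfty_L1loc_def case_prod_eta
  proof (intro conjI allI impI)
    show "u \<in> borel_measurable (lebesgue_on (UNIV \<times> {0..T}))"
      by (rule measurable_restrict_space1[OF uleb])
    fix K :: "real set" assume K: "compact K"
    have slice: "(\<lambda>x. u (x, t)) \<in> borel_measurable borel" for t
    proof -
      have "(\<lambda>x::real. (x, t)) \<in> borel_measurable borel"
        by (intro borel_measurable_continuous_onI continuous_intros)
      from measurable_compose[OF this um] show ?thesis .
    qed
    show "\<exists>M'. AE t in lebesgue. t \<in> {0..T} \<longrightarrow>
        set_integrable lebesgue K (\<lambda>x. u (x, t)) \<and> (LINT x:K|lebesgue. norm (u (x, t))) \<le> M'"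
    proof (intro exI AE_I2 impI conjI)
      fix t
      show "set_integrable lebesgue K (\<lambda>x. u (x, t))"
        by (rule bounded_set_integrable(2)[OF slice ub K M(1)])
      show "(LINT x:K|lebesgue. norm (u (x, t))) \<le> M * measure lborel K"
        by (rule bounded_set_integrable(3)[OF slice ub K M(1)])
    qed
  qed
  have L1conv: "tendsto_L1loc (UNIV \<times> {0<..<T})
      (\<lambda>k (x, t). step_fun (\<Delta>x (\<sigma> k)) (U (\<sigma> k) t) x) (\<lambda>(x, t). u (x, t))"
    unfolding tendsto_L1loc_def case_prod_eta
  proof (intro allI impI)
    fix K :: "(real \<times> real) set" assume "compact K \<and> K \<subseteq> UNIV \<times> {0<..<T}"
    then have K: "compact K" "K \<subseteq> UNIV \<times> {0<..<T}" by auto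
    \<comment> \<open>A bounded Borel function on the plane that agrees with the step function on
      \<open>K\<close>.\<close>
    define S where "S k p = (if snd p \<in> {0..T} then U (\<sigma> k) (snd p) (cell_index (\<Delta>x (\<sigma> k)) (fst p)) else 0)"
      for k and p :: "real \<times> real"
    have Sm: "S k \<in> borel_measurable borel" for k
      unfolding S_def[abs_def]
      by (rule step_measurable, rule continuous_on_subset[OF lattice_ode.u_cont[OF ode]]) auto
    have Sb: "norm (S k p) \<le> M" for k p
      using bound[of "snd p" "\<sigma> k"] M(1) by (simp add: S_def)
    have S_eq: "(case p of (x, t) \<Rightarrow> step_fun (\<Delta>x (\<sigma> k)) (U (\<sigma> k) t) x) = S k p" if "p \<in> K" for p k
    proof -
      have "snd p \<in> {0..T}" using K(2) that by force
      then show ?thesis by (cases p) (simp add: S_def step_fun_eq[OF h0])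
    qed
    have Kb: "K \<in> sets borel" using K(1) by (simp add: borel_compact)
    have "set_integrable lebesgue K (\<lambda>(x, t). step_fun (\<Delta>x (\<sigma> k)) (U (\<sigma> k) t) x)" for k
    proof -
      have "set_integrable lebesgue K (S k)" by (rule bounded_set_integrable(2)[OF Sm Sb K(1) M(1)])
      then show ?thesis using S_eq by (subst set_integrable_cong[OF refl refl, of K _ "S k"]) auto
    qed
    moreover have "set_integrable lebesgue K u" by (rule bounded_set_integrable(2)[OF um ub K(1) M(1)])
    moreover have "(\<lambda>k. LINT p:K|lebesgue. norm ((case p of (x, t) \<Rightarrow> step_fun (\<Delta>x (\<sigma> k)) (U (\<sigma> k) t) x) - u p)) \<longlonglongrightarrow> 0"
    proof -
      have dm: "(\<lambda>p. norm (S k p - u p)) \<in> borel_measurable borel" for k using Sm um by simp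
      have eq: "(LINT p:K|lebesgue. norm ((case p of (x, t) \<Rightarrow> step_fun (\<Delta>x (\<sigma> k)) (U (\<sigma> k) t) x) - u p))
          = (\<integral>p. indicator K p * norm (S k p - u p) \<partial>lborel)" for k
      proof -
        have "(LINT p:K|lebesgue. norm ((case p of (x, t) \<Rightarrow> step_fun (\<Delta>x (\<sigma> k)) (U (\<sigma> k) t) x) - u p))
            = (\<integral>p. indicator K p * norm (S k p - u p) \<partial>lebesgue)"
          unfolding set_lebesgue_integral_def
        proof (intro Bochner_Integration.integral_cong refl)
          fix p
          show "indicator K p *\<^sub>R norm ((case p of (x, t) \<Rightarrow> step_fun (\<Delta>x (\<sigma> k)) (U (\<sigma> k) t) x) - u p)
              = indicator K p * norm (S k p - u p)"
            using S_eq[of p k] by (cases "p \<in> K") simp_all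
        qed
        also have "\<dots> = (\<integral>p. indicator K p * norm (S k p - u p) \<partial>lborel)"
          using dm Kb by (intro integral_completion) simp
        finally show ?thesis .
      qed
      have "(\<lambda>k. \<integral>p. indicator K p * norm (S k p - u p) \<partial>lborel) \<longlonglongrightarrow> (\<integral>p. 0 \<partial>(lborel :: (real \<times> real) measure))"
      proof (rule integral_dominated_convergence[where w = "\<lambda>p. 2 * M * indicator K p"])
        show "(\<lambda>p. indicator K p * norm (S k p - u p)) \<in> borel_measurable lborel" for k using dm Kb by simp
        have "emeasure lborel K < \<infinity>" using K(1) by (intro emeasure_bounded_finite compact_imp_bounded)
        then show "integrable lborel (\<lambda>p. 2 * M * indicator K p)"
          using Kb by (intro integrable_mult_right integrable_real_indicator) simp_all
        show "AE p in lborel. norm (indicator K p * norm (S k p - u p)) \<le> 2 * M * indicator K p" for k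
        proof (intro AE_I2)
          fix p
          have "norm (S k p - u p) \<le> 2 * M" using norm_triangle_ineq4[of "S k p" "u p"] Sb[of k p] ub[of p] by linarith
          then show "norm (indicator K p * norm (S k p - u p)) \<le> 2 * M * indicator K p" by (simp add: indicator_def)
        qed
        show "AE p in lborel. (\<lambda>k. indicator K p * norm (S k p - u p)) \<longlonglongrightarrow> 0"
          using conv
        proof eventually_elim
          case (elim p)
          show ?case
          proof (cases "p \<in> K")
            case True
            then have p: "snd p \<in> {0..T}" using K(2) by force
            then have "(\<lambda>k. S k p) \<longlonglongrightarrow> u p" using elim by (simp add: S_def)
            then have "(\<lambda>k. norm (S k p - u p)) \<longlonglongrightarrow> 0" by (intro tendsto_norm_zero LIM_zero)
            then show ?thesis using True by simp
          qed simp
        qed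
      qed simp
      then show ?thesis unfolding eq by simp
    qed
    ultimately show "(\<forall>k. set_integrable lebesgue K (\<lambda>(x, t). step_fun (\<Delta>x (\<sigma> k)) (U (\<sigma> k) t) x)) \<and>
        set_integrable lebesgue K u \<and>
        (\<lambda>k. LINT p:K|lebesgue. norm ((case p of (x, t) \<Rightarrow> step_fun (\<Delta>x (\<sigma> k)) (U (\<sigma> k) t) x) - u p)) \<longlonglongrightarrow> 0"
      by blast
  qed
  have weak: "weak_solution \<phi> T u0 (\<lambda>x t. u (x, t))"
    unfolding weak_solution_def case_prod_eta
  proof (intro conjI allI impI)
    have m: "u \<in> borel_measurable (lebesgue_on (UNIV \<times> {0<..<T}))"
      by (rule measurable_restrict_space1[OF uleb])
    have "esssup (lebesgue_on (UNIV \<times> {0<..<T})) (\<lambda>p. ereal (norm (u p))) \<le> ereal M"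
      by (rule esssup_I) (use m ub in auto)
    then show "Linfty (lebesgue_on (UNIV \<times> {0<..<T})) u"
      unfolding Linfty_def using m by (auto intro: le_less_trans)
    fix \<psi> assume test: "test_function T \<psi>"
    obtain \<psi>x \<psi>t T1 X where cut: "cutoff_test \<psi> \<psi>x \<psi>t T1 X" and T1: "T1 < T"
      and dt: "\<And>x t. t \<in> {0<..<T} \<Longrightarrow> deriv (\<lambda>s. \<psi> x s) t = cutoff_test.ext T1 \<psi>t (x, t)"
      and dx': "\<And>x t. t \<in> {0<..<T} \<Longrightarrow> deriv (\<lambda>y. \<psi> y t) x = cutoff_test.ext T1 \<psi>x (x, t)"
      using test_function_cutoff[OF T test] by metis
    interpret cutoff_test \<psi> \<psi>x \<psi>t T1 X by (rule cut)
    define F where "F w = \<phi> (norm w) *\<^sub>R w" for w :: "real ^ 'n"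
    have Fc: "continuous_on UNIV F"
      unfolding F_def by (intro continuous_intros continuous_on_compose2[OF phi_cont, of UNIV norm]) auto
    have Fum: "(\<lambda>p. F (u p)) \<in> borel_measurable borel"
      by (rule measurable_compose[OF um borel_measurable_continuous_onI[OF Fc]])
    have Fb: "norm (F (u p)) \<le> q" for p
      unfolding F_def q_def norm_scaleR
      using phi_mono[of "norm (u p)" M] ub[of p] phi0[of M] phi0[of "norm (u p)"] M(1) by (intro mult_mono) simp_all
    have lim_eq: "(\<integral>p. ext \<psi>t p *\<^sub>R u p + ext \<psi>x p *\<^sub>R F (u p) \<partial>lborel) + (\<integral>x. \<psi> x 0 *\<^sub>R f x \<partial>lborel) = 0"
      unfolding F_def
    proof (rule weak_form_limit[OF cut _ ode h\<sigma> _ M(1) um ub conv init f])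
      show "T1 \<le> T" using T1 by simp
      show "norm (U (\<sigma> k) t j) \<le> M" if "t \<in> {0..T}" for k t j using bound that by simp
    qed
    have int: "integrable lborel (\<lambda>p. ext a p *\<^sub>R k p)"
      if a: "continuous_on (UNIV \<times> {0..T1}) (\<lambda>(x, t). a x t)" "\<And>x t. t \<in> {0..T1} \<Longrightarrow> X < \<bar>x\<bar> \<Longrightarrow> a x t = 0"
        and k: "k \<in> borel_measurable borel" "\<And>p. norm (k p) \<le> c" for a and k :: "real \<times> real \<Rightarrow> real ^ 'n" and c
    proof -
      obtain B where B: "0 < B" "\<And>x t. t \<in> {0..T1} \<Longrightarrow> \<bar>a x t\<bar> \<le> B" using bounded_on_strip[OF a] by blast
      show ?thesis
      proof (rule ext_integrable[OF ext_measurable[OF a(1)] _ _ k])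
        show "\<bar>ext a p\<bar> \<le> B" for p using B(2)[of "snd p" "fst p"] B(1) by (simp add: ext_def)
        show "ext a p = 0" if p: "p \<notin> {-X..X} \<times> {0..T1}" for p
        proof (cases "snd p \<in> {0..T1}")
          case True
          then have "X < \<bar>fst p\<bar>" using p by (cases p) auto
          then show ?thesis using a(2)[OF True] by (simp add: ext_def)
        next
          case False
          then show ?thesis by (auto simp: ext_def)
        qed
      qed
    qed
    have I1: "integrable lborel (\<lambda>p. ext \<psi>t p *\<^sub>R u p)" by (rule int[OF \<psi>t_cont _ um ub]) (simp add: supp)
    have I2: "integrable lborel (\<lambda>p. ext \<psi>x p *\<^sub>R F (u p))" by (rule int[OF \<psi>x_cont _ Fum Fb]) (simp add: supp)
    have "(LINT t:{0<..<T}|lebesgue. LINT x|lebesgue.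
           deriv (\<lambda>s. \<psi> x s) t *\<^sub>R u (x, t) + (\<phi> (norm (u (x, t))) * deriv (\<lambda>y. \<psi> y t) x) *\<^sub>R u (x, t))
        = (\<integral>p. ext \<psi>t p *\<^sub>R u p + ext \<psi>x p *\<^sub>R F (u p) \<partial>lborel)"
    proof (rule weak_integral_eq[OF Bochner_Integration.integrable_add[OF I1 I2] _ T1])
      show "ext \<psi>t (x, t) *\<^sub>R u (x, t) + ext \<psi>x (x, t) *\<^sub>R F (u (x, t)) = 0" if "t \<notin> {0..T1}" for x t
        using that by (auto simp: ext_def)
      show "deriv (\<lambda>s. \<psi> x s) t *\<^sub>R u (x, t) + (\<phi> (norm (u (x, t))) * deriv (\<lambda>y. \<psi> y t) x) *\<^sub>R u (x, t)
          = ext \<psi>t (x, t) *\<^sub>R u (x, t) + ext \<psi>x (x, t) *\<^sub>R F (u (x, t))" if "t \<in> {0<..<T}" for x t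
        unfolding dt[OF that] dx'[OF that] F_def by (simp add: mult.commute)
    qed
    moreover have "(LINT x|lebesgue. \<psi> x 0 *\<^sub>R u0 x) = (\<integral>x. \<psi> x 0 *\<^sub>R f x \<partial>lborel)"
    proof -
      have "continuous_on UNIV (\<lambda>x. (\<lambda>(x, t). \<psi> x t) (x, 0))"
        by (rule continuous_on_compose2[OF \<psi>_cont]) (use T1_pos in \<open>auto intro!: continuous_intros\<close>)
      then have \<psi>m: "(\<lambda>x. \<psi> x 0) \<in> borel_measurable borel" by (intro borel_measurable_continuous_onI) simp
      then have \<psi>m': "(\<lambda>x. \<psi> x 0) \<in> borel_measurable lebesgue" by (intro measurable_completion) simp
      have fm': "f \<in> borel_measurable lebesgue" using fm by (intro measurable_completion) simp
      have "(LINT x|lebesgue. \<psi> x 0 *\<^sub>R u0 x) = (LINT x|lebesgue. \<psi> x 0 *\<^sub>R f x)"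
      proof (rule integral_cong_AE)
        show "AE x in lebesgue. \<psi> x 0 *\<^sub>R u0 x = \<psi> x 0 *\<^sub>R f x" using fu' by eventually_elim simp
      qed (intro borel_measurable_scaleR \<psi>m' A4(1) fm')+
      also have "\<dots> = (\<integral>x. \<psi> x 0 *\<^sub>R f x \<partial>lborel)"
        using \<psi>m fm by (intro integral_completion) simp
      finally show ?thesis .
    qed
    ultimately show "(LINT t:{0<..<T}|lebesgue. LINT x|lebesgue.
           deriv (\<lambda>s. \<psi> x s) t *\<^sub>R u (x, t) + (\<phi> (norm (u (x, t))) * deriv (\<lambda>y. \<psi> y t) x) *\<^sub>R u (x, t))
        + (LINT x|lebesgue. \<psi> x 0 *\<^sub>R u0 x) = 0"
      using lim_eq by simp
  qed
  show ?thesis using L1loc \<sigma> L1conv weak by blast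
qed

end
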